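(* Consider a sequence of problem instances indexed by $n\to\infty$ (with $m$ and $K$ depending on $n$, $\sigma\in(0,\infty)$ fixed). Suppose $K\subset\mathbb{R}^n$ is a closed convex cone with $\delta_K\to\infty$ and $\limsup_n(m/\delta_K)<1$. Then $$\mathbb{P}\bigg(\sup_{\tilde\mu(\sigma)\in\operatorname{arg\,min}_{\mu\in K}\|Y-X\mu\|^2} n^{-1}\|\tilde\mu(\sigma)-\mu_0\|^2=\infty\ \text{ for all }\mu_0\in K\bigg)\to1,$$ where for each $\mu_0\in K$, $Y=X\mu_0+\xi$.
   Context: $X\in\mathbb{R}^{m\times n}$ has i.i.d. $\mathcal{N}(0,1/n)$ entries; $\xi\in\mathbb{R}^m$ is independent of $X$ with i.i.d. coordinates of mean $0$ and variance $\sigma^2$ (the same $X$ and $\xi$ are used for all $\mu_0$). $\|\cdot\|$ is the Euclidean norm. For a closed convex cone $K$, $\delta_K=\mathbb{E}\|\Pi_K(h)\|^2$ with $h\sim\mathcal{N}(0,I_n)$ and $\Pi_K$ the metric projection onto $K$. *)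

theory Defs
  imports "HOL-Probability.Probability" "HOL-Library.Function_Algebras"
begin

text \<open>
  Since the dimension varies along the sequence, \<open>\<real>\<^sup>n\<close> is the carrier of the library topology
  \<^const>\<open>Euclidean_space\<close> \<open>n\<close>, i.e. the functions \<open>nat \<Rightarrow> real\<close> that vanish from \<open>n\<close> on.
  The pointwise vector space structure below makes \<^const>\<open>convex\<close> and \<^const>\<open>cone\<close> available
  there.  The Euclidean norm of \<open>x\<close> is \<open>L2_set x {..<n}\<close> (the norm- and distance-related
  notions of the type class hierarchy are not used on functions).
\<close>

instantiation "fun" :: (type, real_vector) real_vector
begin

definition scaleR_fun :: "real \<Rightarrow> ('a \<Rightarrow> 'b) \<Rightarrow> 'a \<Rightarrow> 'b"
  where "scaleR_fun c f = (\<lambda>x. c *\<^sub>R f x)"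

instance
  by standard (simp_all add: scaleR_fun_def fun_eq_iff scaleR_add_right scaleR_add_left)

end

text \<open>An \<open>m \<times> n\<close> matrix \<open>A\<close> has entries \<open>A i j\<close> with \<open>i < m\<close> and \<open>j < n\<close>.\<close>

definition mat_vec :: "nat \<Rightarrow> (nat \<Rightarrow> nat \<Rightarrow> real) \<Rightarrow> (nat \<Rightarrow> real) \<Rightarrow> nat \<Rightarrow> real"
  where "mat_vec n A x = (\<lambda>i. \<Sum>j<n. A i j * x j)"

text \<open>
  \<open>K\<close> is meant to be a nonempty closed convex subset of \<open>\<real>\<^sup>n\<close>, so that the minimizer exists and
  is unique.  Only the coordinates of \<open>h\<close> below \<open>n\<close> matter.
\<close>

definition metric_proj :: "nat \<Rightarrow> (nat \<Rightarrow> real) set \<Rightarrow> (nat \<Rightarrow> real) \<Rightarrow> nat \<Rightarrow> real"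
  where "metric_proj n K h = arg_min_on (\<lambda>p. L2_set (h - p) {..<n}) K"

definition std_gaussian :: "nat \<Rightarrow> (nat \<Rightarrow> real) measure"
  where "std_gaussian n = (\<Pi>\<^sub>M i\<in>{..<n}. density lborel std_normal_density)"

definition stat_dim :: "nat \<Rightarrow> (nat \<Rightarrow> real) set \<Rightarrow> real"
  where "stat_dim n K = (\<integral>h. (L2_set (metric_proj n K h) {..<n})\<^sup>2 \<partial>std_gaussian n)"

definition least_squares :: "nat \<Rightarrow> nat \<Rightarrow> (nat \<Rightarrow> nat \<Rightarrow> real) \<Rightarrow> (nat \<Rightarrow> real) \<Rightarrow> (nat \<Rightarrow> real) set
    \<Rightarrow> (nat \<Rightarrow> real) set"
  where "least_squares m n A y K =
    {\<mu>. is_arg_min (\<lambda>\<mu>. (L2_set (y - mat_vec n A \<mu>) {..<m})\<^sup>2) (\<lambda>\<mu>. \<mu> \<in> K) \<mu>}"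

text \<open>
  An event quantifying over all \<open>\<mu>\<^sub>0 \<in> K\<close> is an uncountable intersection and need not belong to
  \<open>sets M\<close>, in which case \<^const>\<open>measure\<close> would return the junk value \<open>0\<close>.  The inner probability
  agrees with the probability on every event measurable for \<open>M\<close> or for its completion.
\<close>

definition inner_prob :: "'a measure \<Rightarrow> 'a set \<Rightarrow> real"
  where "inner_prob M E = (SUP A \<in> {A \<in> sets M. A \<subseteq> E}. measure M A)"

lemma inner_prob_completion:
  assumes "finite_measure M" and E: "E \<in> sets (completion M)"
  shows "inner_prob M E = measure (completion M) E"
proof -
  interpret finite_measure M by fact
  interpret C: finite_measure "completion M"
    by (rule finite_measureI) (simp add: emeasure_completion emeasure_finite)
  have main: "main_part M E \<in> sets M" "main_part M E \<subseteq> E"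
    using main_part_sets[OF E] main_part_null_part_Un[OF E] by auto
  have eq: "measure (completion M) E = measure M (main_part M E)"
    unfolding measure_def using E by (simp add: emeasure_completion)
  have le: "measure M A \<le> measure (completion M) E" if "A \<in> sets M" "A \<subseteq> E" for A
    using C.finite_measure_mono[OF that(2) E] measure_completion[OF that(1)] by simp
  show ?thesis
    unfolding inner_prob_def
  proof (rule cSup_eq_maximum)
    show "measure (completion M) E \<in> measure M ` {A \<in> sets M. A \<subseteq> E}"
      using main eq by auto
  qed (use le in auto)
qed

lemma inner_prob_eq:
  assumes "finite_measure M" and "E \<in> sets M"
  shows "inner_prob M E = measure M E"
  using inner_prob_completion[OF assms(1)] assms(2)
  by (simp add: measure_completion sets_completionI_sets)

end

theory Submission
  imports Defs
begin

text \<open>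
  The noise plays no role: it suffices that, with probability tending to one, the random matrix maps
  the cone \<open>K\<close> onto \<open>\<real>\<^sup>m\<close> and has a nonzero kernel vector in \<open>K\<close>.  The rows are added one at a time.
  For a closed convex cone \<open>C\<close> put \<open>\<phi>(h) = |\<Pi>\<^sub>C h|\<^sup>2\<close>.  For independent standard Gaussian \<open>h, g\<close> the
  function \<open>t \<mapsto> \<phi>(cos t h + sin t g)\<close> is the squared support function \<open>s\<^sup>2\<close> of a planar convex body, and
  by duality the analogue of \<open>\<phi>(h)\<close> for the section of \<open>C\<close> orthogonal to \<open>g\<close> is the square of the
  radial function \<open>r\<close> at angle \<open>0\<close>.  The pair \<open>(h, g)\<close> is rotation invariant, so the identities
  \<open>\<integral> r\<^sup>2 = \<integral> (s\<^sup>2 - s'\<^sup>2)\<close> and \<open>\<integral> r\<^sup>4 = \<integral> (s\<^sup>4 - 2 s\<^sup>2 s'\<^sup>2 - s'\<^sup>4 / 3)\<close> over the circle control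
  the first two moments: a section lowers \<open>\<delta> = E \<phi>(h)\<close> by at most one on average and lowers
  \<open>E \<phi>(h)\<^sup>2\<close> by at least \<open>2 \<delta>\<close>.  Together with \<open>Var \<phi>(h) \<le> 8 \<pi>\<^sup>2 \<delta>\<close>, Chebyshev's inequality bounds
  the probability that the section by all \<open>m\<close> rows is trivial by \<open>8 \<pi>\<^sup>2 \<delta> / (\<delta> - m)\<^sup>2\<close>.
  A Gaussian hyperplane almost surely does not touch a cone from one side in a nonzero section, so
  each new row takes both signs on the section by the previous rows, which gives surjectivity.
\<close>

subsection \<open>Support and radial functions of planar convex bodies\<close>

text \<open>Why the radial function appears: for |x| < pi/2 the quotient s(x) / cos x is the norm of
  the projection of h + tan x g, so r(0)^2 is the infimum of \<phi>(h + t g) over t. This is the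
  Lagrangian dual of maximizing 2<h,y> - |y|^2 over y in C with <g,y> = 0, whose value is that of
  the section. Two defects of s obstruct the circle identities. It may vanish, so s^2 is replaced by
  s^2 + \<epsilon>^2; and \<phi> has only a Lipschitz gradient while the identities contain a
  curvature, so s is averaged over short windows. Inequalities survive both limits, and each moment
  asks for one direction only. The two moments fit together: with a = \<delta> - m they give E (Z -
  a)^2 \<le> Var \<phi>(h), where Z is the squared projection norm for the section by all m rows, so
  slicing does not enlarge the variance bound. The constant 8 pi^2 stems from a crude Poincare
  inequality on the circle. Its size is immaterial, because \<delta> - m eventually exceeds a fixed
  fraction of \<delta>, which tends to infinity.\<close>

lemma periodic_reduce:
  obtains y k where "y \<in> {0..2 * pi}" "x = y + of_int k * (2 * pi)"
proof -
  define k where "k = \<lfloor>x / (2 * pi)\<rfloor>"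
  have "of_int k \<le> x / (2 * pi)" "x / (2 * pi) < of_int k + 1"
    unfolding k_def by linarith+
  then have "of_int k * (2 * pi) \<le> x" "x \<le> (of_int k + 1) * (2 * pi)"
    by (simp_all add: field_simps)
  then show thesis by (intro that[of "x - of_int k * (2 * pi)" k]) (auto simp: algebra_simps)
qed

lemma periodic_int:
  fixes f :: "real \<Rightarrow> 'b"
  assumes "\<And>x. f (x + 2 * pi) = f x"
  shows "f (x + of_int k * (2 * pi)) = f x"
proof -
  interpret periodic_fun_simple f "2 * pi" by standard (rule assms)
  show ?thesis by (rule plus_of_int)
qed

lemma continuous_periodic_bounded:
  fixes f :: "real \<Rightarrow> real"
  assumes "continuous_on UNIV f" and per: "\<And>x. f (x + 2 * pi) = f x"
  obtains B where "0 < B" "\<And>x. \<bar>f x\<bar> \<le> B"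
proof -
  have "compact (f ` {0..2 * pi})"
    using assms(1) by (intro compact_continuous_image) (auto intro: continuous_on_subset)
  then obtain B where "0 < B" "\<And>y. y \<in> {0..2 * pi} \<Longrightarrow> \<bar>f y\<bar> \<le> B"
    using compact_imp_bounded bounded_pos by (metis image_eqI real_norm_def)
  then show thesis
    using that periodic_reduce periodic_int[of f, OF per] by metis
qed

lemma integral_periodic_shift:
  fixes c :: "real \<Rightarrow> real"
  assumes cont: "continuous_on UNIV c" and per: "\<And>x. c (x + 2 * pi) = c x"
    and a: "\<bar>a\<bar> \<le> 2 * pi"
  shows "integral {a..a + 2 * pi} c = integral {0..2 * pi} c"
proof -
  have ci: "c integrable_on {u..v}" for u v
    by (intro integrable_continuous_real continuous_on_subset[OF cont]) auto
  have *: "integral {u..u + 2 * pi} c = integral {v..v + 2 * pi} c"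
    if "u \<le> v" "v \<le> u + 2 * pi" for u v
  proof -
    have "integral {u..v} c = integral {u + 2 * pi..v + 2 * pi} c"
      using integral_shift[of u "2 * pi" v c] per cont by (simp add: o_def continuous_on_subset)
    moreover have "integral {u..v} c + integral {v..u + 2 * pi} c = integral {u..u + 2 * pi} c"
      using that by (intro Henstock_Kurzweil_Integration.integral_combine ci) auto
    moreover have "integral {v..u + 2 * pi} c + integral {u + 2 * pi..v + 2 * pi} c = integral {v..v + 2 * pi} c"
      using that by (intro Henstock_Kurzweil_Integration.integral_combine ci) auto
    ultimately show ?thesis by simp
  qed
  show ?thesis
  proof (cases "0 \<le> a")
    case True
    then show ?thesis using *[of 0 a] a by (simp add: abs_le_iff)
  next
    case False
    then show ?thesis using *[of a 0] a by (simp add: abs_le_iff)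
  qed
qed

text \<open>For positive f, the point at distance \<open>p \<ge> 0\<close> in direction
  \<open>\<psi>\<close> satisfies every constraint \<open>p * cos (x - \<psi>) \<le> f x\<close> iff
  p times this supremum is at most 1. A supremum of cos / f, rather than an infimum of f / cos,
  spares the restriction to angles with positive cosine.\<close>

definition rad :: "(real \<Rightarrow> real) \<Rightarrow> real \<Rightarrow> real"
  where "rad f \<psi> = inverse (SUP x. cos (x - \<psi>) / f x)"

locale periodic_pos =
  fixes f :: "real \<Rightarrow> real"
  assumes cont: "continuous_on UNIV f" and per: "\<And>x. f (x + 2 * pi) = f x" and pos: "\<And>x. 0 < f x"
begin

text \<open>At \<open>x = \<psi>\<close> the ratio is \<open>1 / f \<psi> > 0\<close>, so a
  maximizer over the compact circle faces \<open>\<psi>\<close>. Its line is the constraint that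
  stops the ray.\<close>

lemma rad_attained:
  obtains \<theta> where "0 < cos (\<theta> - \<psi>)" "rad f \<psi> = f \<theta> / cos (\<theta> - \<psi>)"
    "\<And>x. cos (x - \<psi>) / f x \<le> cos (\<theta> - \<psi>) / f \<theta>"
proof -
  define c where "c x = cos (x - \<psi>) / f x" for x
  have cc: "continuous_on S c" for S
    unfolding c_def using pos
    by (intro continuous_intros continuous_on_subset[OF cont]) (auto simp: less_imp_neq[THEN not_sym])
  have cper: "c (x + 2 * pi) = c x" for x
    using cos_periodic[of "x - \<psi>"] by (simp add: c_def per add_diff_eq[symmetric] diff_add_eq)
  obtain \<theta> where "\<theta> \<in> {0..2 * pi}" "\<And>y. y \<in> {0..2 * pi} \<Longrightarrow> c y \<le> c \<theta>"
    using continuous_attains_sup[OF _ _ cc, of "{0..2 * pi}"] by auto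
  then have max: "c x \<le> c \<theta>" for x
    using periodic_reduce periodic_int[of c, OF cper] by metis
  have "0 < c \<psi>" using pos by (simp add: c_def)
  then have "0 < c \<theta>" using max[of \<psi>] by linarith
  then have "0 < cos (\<theta> - \<psi>)" using pos[of \<theta>] by (simp add: c_def zero_less_divide_iff)
  moreover have "(SUP x. c x) = c \<theta>" using max by (intro cSup_eq_maximum) auto
  ultimately show thesis using that[of \<theta>] max by (simp add: rad_def c_def)
qed

lemma rad_pos: "0 < rad f \<psi>"
  using rad_attained[of \<psi>] pos by (metis divide_pos_pos)

lemma rad_cos_le: "rad f \<psi> * cos (x - \<psi>) \<le> f x"
proof -
  obtain \<theta> where t: "0 < cos (\<theta> - \<psi>)" "rad f \<psi> = f \<theta> / cos (\<theta> - \<psi>)"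
    "cos (x - \<psi>) / f x \<le> cos (\<theta> - \<psi>) / f \<theta>"
    using rad_attained by metis
  have "cos (x - \<psi>) * f \<theta> \<le> cos (\<theta> - \<psi>) * f x"
    using t(3) pos[of x] pos[of \<theta>] by (simp add: field_simps)
  then have "f \<theta> * cos (x - \<psi>) / cos (\<theta> - \<psi>) \<le> f x" using t(1) by (simp add: field_simps)
  then show ?thesis using t by simp
qed

text \<open>A point of the body lying on a constraint line that faces it is where its ray leaves the
  body.\<close>

lemma rad_eqI:
  assumes "\<And>x. p * cos (x - \<psi>) \<le> f x" and "p * cos (\<theta> - \<psi>) = f \<theta>" and "0 < cos (\<theta> - \<psi>)"
  shows "rad f \<psi> = p"
proof (rule antisym)
  have "rad f \<psi> * cos (\<theta> - \<psi>) \<le> p * cos (\<theta> - \<psi>)" using rad_cos_le[of \<psi> \<theta>] assms(2) by simp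
  then show "rad f \<psi> \<le> p" using assms(3) by simp
  obtain \<theta>' where t: "0 < cos (\<theta>' - \<psi>)" "rad f \<psi> = f \<theta>' / cos (\<theta>' - \<psi>)"
    using rad_attained by metis
  then show "p \<le> rad f \<psi>" using assms(1)[of \<theta>'] by (simp add: pos_le_divide_eq)
qed

lemma rad_le: "rad f \<psi> \<le> f \<psi>"
  using rad_cos_le[of \<psi> \<psi>] by simp

lemma bounded_below:
  obtains d where "0 < d" "\<And>x. d \<le> f x"
proof -
  have "\<exists>x\<in>{0..2*pi}. \<forall>y\<in>{0..2*pi}. f x \<le> f y"
    by (intro continuous_attains_inf) (auto intro: continuous_on_subset[OF cont])
  then obtain x where "\<And>y. y \<in> {0..2 * pi} \<Longrightarrow> f x \<le> f y" by blast
  then have "f x \<le> f y" for y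
    using periodic_reduce periodic_int[of f, OF per] by metis
  then show thesis using that[of "f x"] pos by auto
qed

lemma bdd_above_ratio: "bdd_above (range (\<lambda>x. cos (x - \<psi>) / f x))"
  using rad_attained[of \<psi>] by (metis (mono_tags, lifting) bdd_aboveI2)

text \<open>With d a positive lower bound of f, all ratios are (1/d)-Lipschitz in
  \<open>\<psi>\<close>, hence so is their supremum; it is positive, so inversion preserves
  continuity.\<close>

lemma continuous_rad: "continuous_on UNIV (rad f)"
proof -
  obtain d where d: "0 < d" "\<And>x. d \<le> f x" using bounded_below by blast
  define \<kappa> where "\<kappa> \<psi> = (SUP x. cos (x - \<psi>) / f x)" for \<psi>
  have lip: "\<kappa> a \<le> \<kappa> b + \<bar>a - b\<bar> / d" for a b
    unfolding \<kappa>_def[of a]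
  proof (rule cSUP_least)
    fix x
    have "\<bar>cos (x - a) - cos (x - b)\<bar> = 2 * (\<bar>sin ((x - a + (x - b)) / 2)\<bar> * \<bar>sin ((a - b) / 2)\<bar>)"
      by (simp add: cos_diff_cos abs_mult)
    also have "\<dots> \<le> 2 * (1 * \<bar>(a - b) / 2\<bar>)"
      by (intro mult_mono abs_sin_x_le_abs_x) auto
    finally have "\<bar>cos (x - a) - cos (x - b)\<bar> \<le> \<bar>a - b\<bar>" by simp
    then have "cos (x - a) / f x \<le> (cos (x - b) + \<bar>a - b\<bar>) / f x"
      using pos[of x] by (intro divide_right_mono) (auto simp: less_imp_le)
    also have "\<dots> \<le> cos (x - b) / f x + \<bar>a - b\<bar> / d"
      using d pos[of x] by (simp add: add_divide_distrib divide_left_mono)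
    also have "cos (x - b) / f x \<le> \<kappa> b"
      unfolding \<kappa>_def by (rule cSUP_upper[OF _ bdd_above_ratio]) simp
    finally show "cos (x - a) / f x \<le> \<kappa> b + \<bar>a - b\<bar> / d" by simp
  qed simp
  have "(1/d)-lipschitz_on UNIV \<kappa>"
  proof (rule lipschitz_onI)
    fix x y show "dist (\<kappa> x) (\<kappa> y) \<le> 1 / d * dist x y"
      using lip[of x y] lip[of y x] by (simp add: dist_real_def abs_minus_commute abs_le_iff)
  qed (use d in simp)
  then have "continuous_on UNIV \<kappa>" by (rule lipschitz_on_continuous_on)
  moreover have "rad f \<psi> = inverse (\<kappa> \<psi>)" for \<psi> by (simp add: rad_def \<kappa>_def)
  moreover have "\<kappa> \<psi> \<noteq> 0" for \<psi> using rad_pos[of \<psi>] by (auto simp: rad_def \<kappa>_def)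
  ultimately show ?thesis by (simp add: continuous_on_inverse)
qed

lemma rad_periodic: "rad f (\<psi> + 2 * pi) = rad f \<psi>"
proof -
  have "cos (x - (\<psi> + 2 * pi)) = cos (x - \<psi>)" for x
    using cos_periodic[of "x - (\<psi> + 2 * pi)"] by simp
  then show ?thesis by (simp add: rad_def)
qed

end

text \<open>
  A positive function \<open>f\<close> on the circle is the support function of a planar convex body with the
  origin in its interior if and only if the boundary point \<open>f(t) n(t) + f'(t) n'(t)\<close>
  satisfies all constraints, where \<open>n(t) = (cos t, sin t)\<close>; then \<^term>\<open>rad f\<close> is its radial function.
\<close>

locale support_fun = periodic_pos +
  fixes f' :: "real \<Rightarrow> real"
  assumes f': "\<And>x. (f has_real_derivative f' x) (at x)"
    and supp: "\<And>x t. f t * cos (x - t) + f' t * sin (x - t) \<le> f x"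
begin

lemma f'_periodic: "f' (x + 2 * pi) = f' x"
proof -
  have "((\<lambda>y. f (y + 2 * pi)) has_real_derivative f' (x + 2 * pi)) (at x)"
    using DERIV_shift[of f "f' (x + 2 * pi)" x "2 * pi"] f'[of "x + 2 * pi"] by simp
  then have "(f has_real_derivative f' (x + 2 * pi)) (at x)" by (simp add: per)
  then show ?thesis using f' DERIV_unique by blast
qed

end

section \<open>Polar integrals of twice differentiable support functions\<close>

locale support_fun_C2 = support_fun +
  fixes f'' :: "real \<Rightarrow> real"
  assumes f'': "\<And>x. (f' has_real_derivative f'' x) (at x)"
    and cont'': "continuous_on UNIV f''"
begin

lemma cont': "continuous_on UNIV f'"
  by (rule DERIV_continuous_on[OF has_field_derivative_at_within[OF f'']])

text \<open>The polar angle of the boundary point f(t) n(t) + f'(t) n'(t), whose outer normal is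
  n(t). Since f is positive, it deviates from t by less than a right angle, which is why arctan
  suffices.\<close>

definition tang :: "real \<Rightarrow> real" where "tang t = t + arctan (f' t / f t)"

lemma tang_polar:
  "sqrt ((f t)\<^sup>2 + (f' t)\<^sup>2) * cos (x - tang t) = f t * cos (x - t) + f' t * sin (x - t)"
proof -
  have f0: "f t > 0" by (rule pos)
  have r: "sqrt ((f t)\<^sup>2 + (f' t)\<^sup>2) = f t * sqrt (1 + (f' t / f t)\<^sup>2)"
  proof -
    have "(f t)\<^sup>2 + (f' t)\<^sup>2 = (f t)\<^sup>2 * (1 + (f' t / f t)\<^sup>2)"
      using f0 by (simp add: field_simps)
    then show ?thesis using f0 by (simp add: real_sqrt_mult)
  qed
  have s0: "sqrt (1 + (f' t / f t)\<^sup>2) > 0" by (simp add: add_pos_nonneg)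
  have "cos (x - tang t) = cos (x - t) * cos (arctan (f' t / f t)) + sin (x - t) * sin (arctan (f' t / f t))"
    using cos_diff[of "x - t" "arctan (f' t / f t)"] by (simp add: tang_def algebra_simps)
  then show ?thesis unfolding r cos_arctan sin_arctan
    using f0 s0 by (simp add: field_simps)
qed

lemma rad_tang: "rad f (tang t) = sqrt ((f t)\<^sup>2 + (f' t)\<^sup>2)"
proof (rule rad_eqI)
  show "sqrt ((f t)\<^sup>2 + (f' t)\<^sup>2) * cos (x - tang t) \<le> f x" for x
    unfolding tang_polar by (rule supp)
  show "sqrt ((f t)\<^sup>2 + (f' t)\<^sup>2) * cos (t - tang t) = f t"
    by (simp add: tang_polar)
  then show "0 < cos (t - tang t)"
    using pos[of t] by (smt (verit) mult_nonneg_nonpos real_sqrt_ge_zero sum_power2_ge_zero)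
qed

lemma DERIV_tang:
  "(tang has_real_derivative f t * (f t + f'' t) / ((f t)\<^sup>2 + (f' t)\<^sup>2)) (at t)"
proof -
  have f0: "f t > 0" by (rule pos)
  have d: "0 < (f t)\<^sup>2 + (f' t)\<^sup>2" using f0 by (simp add: add_pos_nonneg)
  have "(tang has_real_derivative 1 + (f'' t * f t - f' t * f' t) / (f t * f t) / (1 + (f' t / f t)\<^sup>2)) (at t)"
  proof -
    have q: "((\<lambda>t. f' t / f t) has_real_derivative (f'' t * f t - f' t * f' t) / (f t * f t)) (at t)"
      using f0 by (intro DERIV_divide f' f'') simp
    show ?thesis
      unfolding tang_def using DERIV_add[OF DERIV_ident DERIV_chain2[OF DERIV_arctan q]]
      by (simp add: divide_inverse mult.commute mult.left_commute)
  qed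
  moreover have "1 + (f'' t * f t - f' t * f' t) / (f t * f t) / (1 + (f' t / f t)\<^sup>2)
     = f t * (f t + f'' t) / ((f t)\<^sup>2 + (f' t)\<^sup>2)"
  proof -
    have "f t * f t * (1 + (f' t / f t)\<^sup>2) = (f t)\<^sup>2 + (f' t)\<^sup>2"
      using f0 by (simp add: field_simps power2_eq_square)
    then show ?thesis using d f0
      by (simp add: divide_divide_eq_left) (simp add: field_simps power2_eq_square)
  qed
  ultimately show ?thesis by simp
qed

text \<open>Substitute the polar angle \<open>tang t\<close> for \<open>\<psi>\<close>; the weight
  is its derivative. As f and f' are periodic, the angle gains exactly one full turn over a period,
  and the shifted window of integration is moved back to \<open>{0..2 * pi}\<close>.\<close>

lemma integral_rad:
  fixes F :: "real \<Rightarrow> real"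
  assumes F: "continuous_on UNIV F"
  shows "((\<lambda>t. f t * (f t + f'' t) / ((f t)\<^sup>2 + (f' t)\<^sup>2) * F (sqrt ((f t)\<^sup>2 + (f' t)\<^sup>2)))
     has_integral integral {0..2 * pi} (\<lambda>\<psi>. F (rad f \<psi>))) {0..2 * pi}"
proof -
  have cF: "continuous_on S (\<lambda>\<psi>. F (rad f \<psi>))" for S
    by (rule continuous_on_compose2[OF F continuous_on_subset[OF continuous_rad]]) auto
  have tp: "tang (2 * pi) = tang 0 + 2 * pi"
    using per[of 0] f'_periodic[of 0] by (simp add: tang_def)
  have "\<bar>tang 0\<bar> < 2 * pi"
    using arctan_bounded[of "f' 0 / f 0"] pi_gt_zero by (simp add: tang_def abs_less_iff)
  then have "integral {tang 0..tang (2 * pi)} (\<lambda>\<psi>. F (rad f \<psi>)) = integral {0..2 * pi} (\<lambda>\<psi>. F (rad f \<psi>))"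
    unfolding tp using cF rad_periodic by (intro integral_periodic_shift) auto
  moreover have ct: "continuous_on {0..2 * pi} tang"
    by (rule DERIV_continuous_on[OF has_field_derivative_at_within[OF DERIV_tang]])
  obtain lo hi where "tang ` {0..2 * pi} \<subseteq> {lo..hi}"
    using bounded_subset_cbox_symmetric[OF compact_imp_bounded[OF compact_continuous_image[OF ct compact_Icc]]]
    by (metis cbox_interval)
  then have "((\<lambda>t. (f t * (f t + f'' t) / ((f t)\<^sup>2 + (f' t)\<^sup>2)) *\<^sub>R F (rad f (tang t)))
     has_integral integral {tang 0..tang (2 * pi)} (\<lambda>\<psi>. F (rad f \<psi>))) {0..2 * pi}"
    using DERIV_tang cF tp
    by (intro has_integral_substitution[where c = lo and d = hi])
      (auto intro: has_field_derivative_at_within)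
  ultimately show ?thesis by (simp add: rad_tang)
qed

text \<open>The square cancels the denominator of the weight and leaves the integral of f (f + f''),
  twice the area of the body. Subtracting the exact derivative (f f')' trades f'' for f'.\<close>

lemma integral_rad_square:
  "integral {0..2 * pi} (\<lambda>\<psi>. (rad f \<psi>)\<^sup>2) = integral {0..2 * pi} (\<lambda>t. (f t)\<^sup>2 - (f' t)\<^sup>2)"
proof -
  have "((\<lambda>t. f t * (f t + f'' t)) has_integral integral {0..2 * pi} (\<lambda>\<psi>. (rad f \<psi>)\<^sup>2)) {0..2 * pi}"
    using integral_rad[of power2] pos[THEN less_imp_neq, THEN not_sym] by (auto simp: continuous_intros)
  moreover have "((\<lambda>t. (f' t)\<^sup>2 + f t * f'' t) has_integral f (2 * pi) * f' (2 * pi) - f 0 * f' 0) {0..2 * pi}"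
    by (intro fundamental_theorem_of_calculus)
      (auto simp: has_real_derivative_iff_has_vector_derivative[symmetric] power2_eq_square
        intro!: derivative_eq_intros has_field_derivative_at_within[OF f'] has_field_derivative_at_within[OF f''])
  then have "((\<lambda>t. (f' t)\<^sup>2 + f t * f'' t) has_integral 0) {0..2 * pi}"
    using per[of 0] f'_periodic[of 0] by simp
  ultimately have "((\<lambda>t. f t * (f t + f'' t) - ((f' t)\<^sup>2 + f t * f'' t)) has_integral
     integral {0..2 * pi} (\<lambda>\<psi>. (rad f \<psi>)\<^sup>2) - 0) {0..2 * pi}"
    by (rule has_integral_diff)
  then have "((\<lambda>t. (f t)\<^sup>2 - (f' t)\<^sup>2) has_integral integral {0..2 * pi} (\<lambda>\<psi>. (rad f \<psi>)\<^sup>2)) {0..2 * pi}"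
    by (simp add: algebra_simps power2_eq_square)
  then show ?thesis by (simp add: integral_unique)
qed

text \<open>One factor f^2 + f'^2 survives the cancellation. After integration by parts the
  integrand is f^4 - 2 f^2 f'^2 - f'^4 / 3, and dropping the last term gives the bound.\<close>

lemma integral_rad_power4:
  "integral {0..2 * pi} (\<lambda>\<psi>. (rad f \<psi>) ^ 4) \<le> integral {0..2 * pi} (\<lambda>t. (f t) ^ 4 - 2 * (f t)\<^sup>2 * (f' t)\<^sup>2)"
proof -
  have d: "(f t)\<^sup>2 + (f' t)\<^sup>2 > 0" for t using pos[of t] by (simp add: add_pos_nonneg)
  have sq4: "sqrt a ^ 4 = a\<^sup>2" if "0 < a" for a
    using that power_mult[of "sqrt a" 2 2] by simp
  have "((\<lambda>t. f t * (f t + f'' t) * ((f t)\<^sup>2 + (f' t)\<^sup>2)) has_integral integral {0..2 * pi} (\<lambda>\<psi>. (rad f \<psi>) ^ 4)) {0..2 * pi}"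
    using integral_rad[of "\<lambda>r. r ^ 4"] d pos[THEN less_imp_neq, THEN not_sym]
    by (auto simp: continuous_intros sq4 mult.assoc power2_eq_square[of "(f _)\<^sup>2 + _"])
  \<comment> \<open>The primitive f^3 f' + f f'^3 / 3 is chosen to absorb both terms containing f'',
    namely f^3 f'' and f f'^2 f''.\<close>
  moreover have "((\<lambda>t. 3 * (f t)\<^sup>2 * f' t * f' t + (f t) ^ 3 * f'' t + (f' t * (f' t) ^ 3 + f t * (3 * (f' t)\<^sup>2 * f'' t)) / 3)
     has_integral ((f (2 * pi)) ^ 3 * f' (2 * pi) + f (2 * pi) * (f' (2 * pi)) ^ 3 / 3)
        - ((f 0) ^ 3 * f' 0 + f 0 * (f' 0) ^ 3 / 3)) {0..2 * pi}"
    by (intro fundamental_theorem_of_calculus)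
      (auto simp: has_real_derivative_iff_has_vector_derivative[symmetric] algebra_simps
        intro!: derivative_eq_intros has_field_derivative_at_within[OF f'] has_field_derivative_at_within[OF f''])
  then have "((\<lambda>t. 3 * (f t)\<^sup>2 * f' t * f' t + (f t) ^ 3 * f'' t + (f' t * (f' t) ^ 3 + f t * (3 * (f' t)\<^sup>2 * f'' t)) / 3)
     has_integral 0) {0..2 * pi}"
    using per[of 0] f'_periodic[of 0] by simp
  ultimately have "((\<lambda>t. f t * (f t + f'' t) * ((f t)\<^sup>2 + (f' t)\<^sup>2) - (3 * (f t)\<^sup>2 * f' t * f' t + (f t) ^ 3 * f'' t + (f' t * (f' t) ^ 3 + f t * (3 * (f' t)\<^sup>2 * f'' t)) / 3)) has_integral
     integral {0..2 * pi} (\<lambda>\<psi>. (rad f \<psi>) ^ 4) - 0) {0..2 * pi}"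
    by (rule has_integral_diff)
  moreover have "f t * (f t + f'' t) * ((f t)\<^sup>2 + (f' t)\<^sup>2) - (3 * (f t)\<^sup>2 * f' t * f' t + (f t) ^ 3 * f'' t + (f' t * (f' t) ^ 3 + f t * (3 * (f' t)\<^sup>2 * f'' t)) / 3)
     = (f t) ^ 4 - 2 * (f t)\<^sup>2 * (f' t)\<^sup>2 - (f' t) ^ 4 / 3" for t
    by (simp add: field_simps power2_eq_square power3_eq_cube power4_eq_xxxx)
  ultimately have "((\<lambda>t. (f t) ^ 4 - 2 * (f t)\<^sup>2 * (f' t)\<^sup>2 - (f' t) ^ 4 / 3) has_integral
     integral {0..2 * pi} (\<lambda>\<psi>. (rad f \<psi>) ^ 4)) {0..2 * pi}"
    by simp
  moreover have "((\<lambda>t. (f t) ^ 4 - 2 * (f t)\<^sup>2 * (f' t)\<^sup>2) has_integral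
    integral {0..2 * pi} (\<lambda>t. (f t) ^ 4 - 2 * (f t)\<^sup>2 * (f' t)\<^sup>2)) {0..2 * pi}"
    by (intro integrable_integral integrable_continuous_real continuous_intros)
      (auto intro: continuous_on_subset[OF cont] continuous_on_subset[OF cont'])
  ultimately show ?thesis by (rule has_integral_le) simp
qed

end

section \<open>Smoothing, and the two integral inequalities for C1 support functions\<close>

lemma rad_mono:
  assumes "periodic_pos f" "periodic_pos g" and le: "\<And>x. f x \<le> c * g x"
  shows "rad f \<psi> \<le> c * rad g \<psi>"
proof -
  interpret f: periodic_pos f by fact
  interpret g: periodic_pos g by fact
  obtain \<theta> where t: "0 < cos (\<theta> - \<psi>)" "rad g \<psi> = g \<theta> / cos (\<theta> - \<psi>)"
    using g.rad_attained by metis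
  have "rad f \<psi> * cos (\<theta> - \<psi>) \<le> c * g \<theta>"
    using f.rad_cos_le[of \<psi> \<theta>] le[of \<theta>] by linarith
  then show ?thesis using t by (simp add: pos_le_divide_eq)
qed

lemma integrable_UNIV_cont: "continuous_on UNIV (h::real\<Rightarrow>real) \<Longrightarrow> h integrable_on {a..b}"
  by (intro integrable_continuous_real) (rule continuous_on_subset, auto)

locale support_fun_C1 = support_fun +
  assumes cont': "continuous_on UNIV f'"
begin

text \<open>Averaging over a short window makes \<open>f\<close> twice differentiable and keeps it a support function.\<close>

lemma mollify:
  assumes \<eta>: "0 < \<eta>"
  obtains g g' g'' where "support_fun_C2 g g' g''"
    "\<And>x. \<exists>y. \<bar>y - x\<bar> \<le> \<eta> \<and> g x = f y" "\<And>x. \<exists>y. \<bar>y - x\<bar> \<le> \<eta> \<and> g' x = f' y"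
proof -
  have "\<exists>P. \<forall>x. - \<infinity> < ereal x \<longrightarrow> ereal x < \<infinity> \<longrightarrow> (P has_vector_derivative f x) (at x)"
    using cont by (intro einterval_antiderivative) (auto simp: continuous_on_eq_continuous_at)
  then obtain P where P: "\<And>x. (P has_real_derivative f x) (at x)"
    by (auto simp: has_real_derivative_iff_has_vector_derivative)
  have shift: "((\<lambda>x. h (x + c)) has_real_derivative h' (x + c)) (at x)"
    if "\<And>x. (h has_real_derivative h' x) (at x)" for h h' :: "real \<Rightarrow> real" and c x
    using DERIV_shift[of h "h' (x + c)" x c] that by simp
  \<comment> \<open>The mean of f over the window of radius \<open>\<eta>\<close> around x, written
    with a primitive of f so that its first two derivatives are difference quotients of f and
    f'.\<close>
  define g where "g x = (P (x + \<eta>) - P (x - \<eta>)) / (2 * \<eta>)" for x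
  define g' where "g' x = (f (x + \<eta>) - f (x - \<eta>)) / (2 * \<eta>)" for x
  define g'' where "g'' x = (f' (x + \<eta>) - f' (x - \<eta>)) / (2 * \<eta>)" for x
  have mvt: "\<exists>y. \<bar>y - x\<bar> \<le> \<eta> \<and> (h (x + \<eta>) - h (x - \<eta>)) / (2 * \<eta>) = h' y"
    if "\<And>x. (h has_real_derivative h' x) (at x)" for h h' :: "real \<Rightarrow> real" and x
  proof -
    have less: "x - \<eta> < x + \<eta>" using \<eta> by simp
    note mvt2 = MVT2[OF less that]
    obtain z where "x - \<eta> < z" "z < x + \<eta>" "h (x + \<eta>) - h (x - \<eta>) = (x + \<eta> - (x - \<eta>)) * h' z"
      using mvt2 by blast
    then show ?thesis using \<eta> by (intro exI[of _ z]) (auto simp: abs_le_iff)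
  qed
  have g: "\<exists>y. \<bar>y - x\<bar> \<le> \<eta> \<and> g x = f y" for x
    unfolding g_def by (rule mvt[OF P])
  have g': "\<exists>y. \<bar>y - x\<bar> \<le> \<eta> \<and> g' x = f' y" for x
    unfolding g'_def by (rule mvt[OF f'])
  have dg: "(g has_real_derivative g' x) (at x)" for x
    unfolding g_def g'_def using shift[OF P, of \<eta> x] shift[OF P, of "- \<eta>" x]
    by (intro DERIV_cdivide DERIV_diff) auto
  have dg': "(g' has_real_derivative g'' x) (at x)" for x
    unfolding g''_def g'_def using shift[OF f', of \<eta> x] shift[OF f', of "- \<eta>" x]
    by (intro DERIV_cdivide DERIV_diff) auto
  \<comment> \<open>The primitive of a positive function is not periodic, but its gain over a full
    turn is the same from every starting point, and this makes g periodic.\<close>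
  have Pper: "P (y + 2 * pi) - P y = P (0 + 2 * pi) - P 0" for y
  proof (rule DERIV_isconst_all[of "\<lambda>y. P (y + 2 * pi) - P y"], rule allI)
    fix x show "((\<lambda>y. P (y + 2 * pi) - P y) has_real_derivative 0) (at x)"
      using DERIV_diff[OF shift[OF P, of "2 * pi" x] P[of x]] per[of x] by simp
  qed
  have supp_g: "g t * cos (x - t) + g' t * sin (x - t) \<le> g x" for x t
  proof -
    \<comment> \<open>The increment of D from \<open>- \<eta>\<close> to \<open>\<eta>\<close> is
      \<open>2 * \<eta>\<close> times the slack in the desired inequality, and its derivative is the
      slack in \<open>supp\<close> with both angles translated by u.\<close>
    define D where "D u = P (x + u) - cos (x - t) * P (t + u) - sin (x - t) * f (t + u)" for u
    have D_deriv: "\<exists>y. (D has_real_derivative y) (at u) \<and> 0 \<le> y" for u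
    proof -
      have "(D has_real_derivative f (x + u) - cos (x - t) * f (t + u) - sin (x - t) * f' (t + u)) (at u)"
        unfolding D_def using shift[OF P, of x u] shift[OF P, of t u] shift[OF f', of t u]
        by (intro DERIV_diff DERIV_cmult) (auto simp: add.commute)
      moreover have "0 \<le> f (x + u) - cos (x - t) * f (t + u) - sin (x - t) * f' (t + u)"
        using supp[of "t + u" "x + u"] by (simp add: algebra_simps)
      ultimately show ?thesis by blast
    qed
    have "D (- \<eta>) \<le> D \<eta>"
      using D_deriv \<eta> by (intro DERIV_nonneg_imp_nondecreasing[of "- \<eta>" \<eta> D]) auto
    then have "(P (t + \<eta>) - P (t - \<eta>)) * cos (x - t) + (f (t + \<eta>) - f (t - \<eta>)) * sin (x - t)
        \<le> P (x + \<eta>) - P (x - \<eta>)"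
      by (simp add: D_def algebra_simps)
    then have "((P (t + \<eta>) - P (t - \<eta>)) * cos (x - t) + (f (t + \<eta>) - f (t - \<eta>)) * sin (x - t)) / (2 * \<eta>)
        \<le> (P (x + \<eta>) - P (x - \<eta>)) / (2 * \<eta>)"
      using \<eta> by (intro divide_right_mono) auto
    then show ?thesis by (simp add: g_def g'_def add_divide_distrib)
  qed
  have cf': "continuous_on UNIV (\<lambda>x. f' (x + c))" for c
    by (rule continuous_on_compose2[OF cont']) (auto intro!: continuous_intros)
  have "support_fun_C2 g g' g''"
  proof
    show "continuous_on UNIV g"
      using dg by (rule DERIV_continuous_on[OF has_field_derivative_at_within])
    show "g (x + 2 * pi) = g x" for x
      using Pper[of "x + \<eta>"] Pper[of "x - \<eta>"] by (simp add: g_def algebra_simps)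
    show "0 < g x" for x using g[of x] pos by auto
    show "continuous_on UNIV g''"
      unfolding g''_def using cf'[of \<eta>] cf'[of "- \<eta>"] \<eta> by (intro continuous_intros) auto
  qed (use dg dg' supp_g in auto)
  then show thesis using g g' by (rule that)
qed

text \<open>The error is stated as a factor, because \<open>rad_mono\<close> compares bodies through
  dilations. Both directions are provided: one bounds the radial function of g by that of f, the
  other the reverse, so convergence of the radial functions themselves never has to be
  discussed.\<close>

lemma mollified_sequence:
  obtains g g' g'' e where "\<And>k. support_fun_C2 (g k) (g' k) (g'' k)"
    "\<And>k x. g k x \<le> (1 + e k) * f x" "\<And>k x. f x \<le> (1 + e k) * g k x" "e \<longlonglongrightarrow> (0::real)" "\<And>k. 0 \<le> e k"
    "\<And>x. (\<lambda>k. g k x) \<longlonglongrightarrow> f x" "\<And>x. (\<lambda>k. g' k x) \<longlonglongrightarrow> f' x"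
    "\<exists>B. \<forall>k x. \<bar>g k x\<bar> \<le> B" "\<exists>B. \<forall>k x. \<bar>g' k x\<bar> \<le> B"
proof -
  define \<eta> where "\<eta> k = inverse (real (Suc k))" for k
  have \<eta>: "\<eta> k > 0" for k by (simp add: \<eta>_def)
  have \<eta>0: "\<eta> \<longlonglongrightarrow> 0" unfolding \<eta>_def by (rule LIMSEQ_inverse_real_of_nat)
  have "\<forall>k. \<exists>g g' g''. support_fun_C2 g g' g'' \<and>
    (\<forall>x. \<exists>y. \<bar>y - x\<bar> \<le> \<eta> k \<and> g x = f y) \<and> (\<forall>x. \<exists>y. \<bar>y - x\<bar> \<le> \<eta> k \<and> g' x = f' y)"
    using mollify[OF \<eta>] by metis
  then obtain g g' g'' where G: "\<And>k. support_fun_C2 (g k) (g' k) (g'' k)"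
    "\<And>k x. \<exists>y. \<bar>y - x\<bar> \<le> \<eta> k \<and> g k x = f y" "\<And>k x. \<exists>y. \<bar>y - x\<bar> \<le> \<eta> k \<and> g' k x = f' y"
    by metis
  obtain B where B: "0 < B" "\<And>x. \<bar>f x\<bar> \<le> B" using continuous_periodic_bounded[OF cont per] by metis
  obtain L where L: "0 < L" "\<And>x. \<bar>f' x\<bar> \<le> L" using continuous_periodic_bounded[OF cont' f'_periodic] by metis
  obtain d where d: "0 < d" "\<And>x. d \<le> f x" using bounded_below by metis
  have lip: "\<bar>f y - f x\<bar> \<le> L * \<bar>y - x\<bar>" for x y
    using field_differentiable_bound[of UNIV f f' L y x] f' L by simp
  \<comment> \<open>The uniform distance of g k and f is at most \<open>\<eta> k * L\<close>;
    dividing by the lower bound d, which g k shares with f, makes it relative.\<close>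
  define e where "e k = \<eta> k * L / d" for k
  have e0: "0 \<le> e k" for k using \<eta>[of k] L d by (simp add: e_def)
  have close: "\<bar>g k x - f x\<bar> \<le> \<eta> k * L" for k x
  proof -
    obtain y where y: "\<bar>y - x\<bar> \<le> \<eta> k" "g k x = f y" using G(2) by blast
    have "L * \<bar>y - x\<bar> \<le> L * \<eta> k" using y L by (intro mult_left_mono) auto
    then show ?thesis using lip[of y x] y by (simp add: mult.commute)
  qed
  have ed: "\<eta> k * L \<le> e k * z" if "d \<le> z" for k z
  proof -
    have "e k * d \<le> e k * z" using that e0 by (rule mult_left_mono)
    then show ?thesis using d by (simp add: e_def)
  qed
  have gd: "d \<le> g k x" for k x using G(2)[of x k] d(2) by metis
  show thesis
  proof (rule that[of g g' g'' e])
    show "g k x \<le> (1 + e k) * f x" for k x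
      using close[of k x] ed[OF d(2)[of x], of k] by (simp add: algebra_simps)
    show "f x \<le> (1 + e k) * g k x" for k x
      using close[of k x] ed[OF gd[of k x], of k] by (simp add: algebra_simps)
    show "e \<longlonglongrightarrow> 0" unfolding e_def
      using tendsto_divide[OF tendsto_mult[OF \<eta>0 tendsto_const] tendsto_const, of d L] d by simp
    show "(\<lambda>k. g k x) \<longlonglongrightarrow> f x" for x
    proof (rule LIM_zero_cancel, rule tendsto_rabs_zero_cancel, rule tendsto_sandwich[where f = "\<lambda>_. 0"])
      show "\<forall>\<^sub>F k in sequentially. \<bar>g k x - f x\<bar> \<le> \<eta> k * L" using close by simp
      show "(\<lambda>k. \<eta> k * L) \<longlonglongrightarrow> 0" using tendsto_mult[OF \<eta>0 tendsto_const] by simp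
    qed auto
    show "(\<lambda>k. g' k x) \<longlonglongrightarrow> f' x" for x
    proof -
      obtain y where y: "\<And>k. \<bar>y k - x\<bar> \<le> \<eta> k" "\<And>k. g' k x = f' (y k)" using G(3) by metis
      have "y \<longlonglongrightarrow> x"
      proof (rule LIM_zero_cancel, rule tendsto_rabs_zero_cancel, rule tendsto_sandwich[where f = "\<lambda>_. 0"])
        show "\<forall>\<^sub>F k in sequentially. \<bar>y k - x\<bar> \<le> \<eta> k" using y by simp
      qed (use \<eta>0 in auto)
      then have "(\<lambda>k. f' (y k)) \<longlonglongrightarrow> f' x"
        using cont' by (auto simp: continuous_on_eq_continuous_at intro: isCont_tendsto_compose)
      then show ?thesis by (simp add: y)
    qed
    show "\<exists>B. \<forall>k x. \<bar>g k x\<bar> \<le> B" using G(2) B by metis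
    show "\<exists>B. \<forall>k x. \<bar>g' k x\<bar> \<le> B" using G(3) L by metis
  qed (use G e0 in auto)
qed

text \<open>The C2 identity holds for each g k. Its radial side is bounded through the inclusion of
  the body of g k in a slight dilate of that of f, while g k and its derivative converge boundedly
  on the other side.\<close>

lemma integral_rad_square_ge:
  "integral {0..2 * pi} (\<lambda>t. (f t)\<^sup>2 - (f' t)\<^sup>2) \<le> integral {0..2 * pi} (\<lambda>\<psi>. (rad f \<psi>)\<^sup>2)"
proof -
  obtain g g' g'' e where G: "\<And>k. support_fun_C2 (g k) (g' k) (g'' k)"
    and le: "\<And>k x. g k x \<le> (1 + e k) * f x" and e: "e \<longlonglongrightarrow> (0::real)" "\<And>k. 0 \<le> e k"
    and lim: "\<And>x. (\<lambda>k. g k x) \<longlonglongrightarrow> f x" "\<And>x. (\<lambda>k. g' k x) \<longlonglongrightarrow> f' x"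
    and bd: "\<exists>B. \<forall>k x. \<bar>g k x\<bar> \<le> B" "\<exists>B. \<forall>k x. \<bar>g' k x\<bar> \<le> B"
    using mollified_sequence by metis
  obtain A B where A: "\<And>k x. \<bar>g k x\<bar> \<le> A" and B: "\<And>k x. \<bar>g' k x\<bar> \<le> B" using bd by metis
  have G1: "periodic_pos (g k)" for k using G[of k] by (simp add: support_fun_C2_def support_fun_def)
  have cg: "continuous_on UNIV (g k)" "continuous_on UNIV (g' k)" for k
    using periodic_pos.cont[OF G1[of k]] support_fun_C2.cont'[OF G[of k]] by auto
  have step: "integral {0..2 * pi} (\<lambda>t. (g k t)\<^sup>2 - (g' k t)\<^sup>2)
      \<le> (1 + e k)\<^sup>2 * integral {0..2 * pi} (\<lambda>\<psi>. (rad f \<psi>)\<^sup>2)" for k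
  proof -
    interpret g: periodic_pos "g k" by (rule G1)
    have "integral {0..2 * pi} (\<lambda>\<psi>. (rad (g k) \<psi>)\<^sup>2) \<le> integral {0..2 * pi} (\<lambda>\<psi>. (1 + e k)\<^sup>2 * (rad f \<psi>)\<^sup>2)"
    proof (intro integral_le integrable_UNIV_cont continuous_intros continuous_rad g.continuous_rad)
      fix \<psi>
      have "(rad (g k) \<psi>)\<^sup>2 \<le> ((1 + e k) * rad f \<psi>)\<^sup>2"
        using rad_mono[OF G1[of k] periodic_pos_axioms le] g.rad_pos[of \<psi>] by (intro power_mono) auto
      then show "(rad (g k) \<psi>)\<^sup>2 \<le> (1 + e k)\<^sup>2 * (rad f \<psi>)\<^sup>2" by (simp add: power_mult_distrib)
    qed
    then show ?thesis using support_fun_C2.integral_rad_square[OF G[of k]] by simp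
  qed
  have "(\<lambda>k. integral {0..2 * pi} (\<lambda>t. (g k t)\<^sup>2 - (g' k t)\<^sup>2)) \<longlonglongrightarrow> integral {0..2 * pi} (\<lambda>t. (f t)\<^sup>2 - (f' t)\<^sup>2)"
  proof (rule dominated_convergence(2)[where h = "\<lambda>_. A\<^sup>2 + B\<^sup>2"])
    show "(\<lambda>t. (g k t)\<^sup>2 - (g' k t)\<^sup>2) integrable_on {0..2 * pi}" for k
      by (intro integrable_UNIV_cont continuous_intros cg)
    fix k t
    have "(g k t)\<^sup>2 \<le> A\<^sup>2" "(g' k t)\<^sup>2 \<le> B\<^sup>2"
      using power_mono[OF A[of k t], of 2] power_mono[OF B[of k t], of 2] by auto
    moreover have "0 \<le> (g k t)\<^sup>2" "0 \<le> (g' k t)\<^sup>2" by auto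
    ultimately show "norm ((g k t)\<^sup>2 - (g' k t)\<^sup>2) \<le> A\<^sup>2 + B\<^sup>2" unfolding real_norm_def by linarith
  qed (intro integrable_const_ivl tendsto_intros lim)+
  moreover have "(\<lambda>k. (1 + e k)\<^sup>2 * integral {0..2 * pi} (\<lambda>\<psi>. (rad f \<psi>)\<^sup>2)) \<longlonglongrightarrow> (1 + 0)\<^sup>2 * integral {0..2 * pi} (\<lambda>\<psi>. (rad f \<psi>)\<^sup>2)"
    by (intro tendsto_intros e)
  ultimately show ?thesis using step by (auto intro: LIMSEQ_le)
qed

text \<open>The same limit with the opposite inclusion: here the radial function of f is the smaller
  side.\<close>

lemma integral_rad_power4_le:
  "integral {0..2 * pi} (\<lambda>\<psi>. (rad f \<psi>) ^ 4) \<le> integral {0..2 * pi} (\<lambda>t. (f t) ^ 4 - 2 * (f t)\<^sup>2 * (f' t)\<^sup>2)"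
proof -
  obtain g g' g'' e where G: "\<And>k. support_fun_C2 (g k) (g' k) (g'' k)"
    and le: "\<And>k x. f x \<le> (1 + e k) * g k x" and e: "e \<longlonglongrightarrow> (0::real)" "\<And>k. 0 \<le> e k"
    and lim: "\<And>x. (\<lambda>k. g k x) \<longlonglongrightarrow> f x" "\<And>x. (\<lambda>k. g' k x) \<longlonglongrightarrow> f' x"
    and bd: "\<exists>B. \<forall>k x. \<bar>g k x\<bar> \<le> B" "\<exists>B. \<forall>k x. \<bar>g' k x\<bar> \<le> B"
    using mollified_sequence by metis
  obtain A B where A: "\<And>k x. \<bar>g k x\<bar> \<le> A" and B: "\<And>k x. \<bar>g' k x\<bar> \<le> B" using bd by metis
  have G1: "periodic_pos (g k)" for k using G[of k] by (simp add: support_fun_C2_def support_fun_def)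
  have cg: "continuous_on UNIV (g k)" "continuous_on UNIV (g' k)" for k
    using periodic_pos.cont[OF G1[of k]] support_fun_C2.cont'[OF G[of k]] by auto
  have step: "integral {0..2 * pi} (\<lambda>\<psi>. (rad f \<psi>) ^ 4)
      \<le> (1 + e k) ^ 4 * integral {0..2 * pi} (\<lambda>t. (g k t) ^ 4 - 2 * (g k t)\<^sup>2 * (g' k t)\<^sup>2)" for k
  proof -
    interpret g: periodic_pos "g k" by (rule G1)
    have "integral {0..2 * pi} (\<lambda>\<psi>. (rad f \<psi>) ^ 4) \<le> integral {0..2 * pi} (\<lambda>\<psi>. (1 + e k) ^ 4 * (rad (g k) \<psi>) ^ 4)"
    proof (intro integral_le integrable_UNIV_cont continuous_intros continuous_rad g.continuous_rad)
      fix \<psi>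
      have "(rad f \<psi>) ^ 4 \<le> ((1 + e k) * rad (g k) \<psi>) ^ 4"
        using rad_mono[OF periodic_pos_axioms G1[of k] le] rad_pos[of \<psi>] by (intro power_mono) auto
      then show "(rad f \<psi>) ^ 4 \<le> (1 + e k) ^ 4 * (rad (g k) \<psi>) ^ 4" by (simp add: power_mult_distrib)
    qed
    also have "\<dots> = (1 + e k) ^ 4 * integral {0..2 * pi} (\<lambda>\<psi>. (rad (g k) \<psi>) ^ 4)" by simp
    also have "\<dots> \<le> (1 + e k) ^ 4 * integral {0..2 * pi} (\<lambda>t. (g k t) ^ 4 - 2 * (g k t)\<^sup>2 * (g' k t)\<^sup>2)"
      using support_fun_C2.integral_rad_power4[OF G[of k]] e(2)[of k] by (intro mult_left_mono) auto
    finally show ?thesis .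
  qed
  have "(\<lambda>k. integral {0..2 * pi} (\<lambda>t. (g k t) ^ 4 - 2 * (g k t)\<^sup>2 * (g' k t)\<^sup>2)) \<longlonglongrightarrow>
    integral {0..2 * pi} (\<lambda>t. (f t) ^ 4 - 2 * (f t)\<^sup>2 * (f' t)\<^sup>2)"
  proof (rule dominated_convergence(2)[where h = "\<lambda>_. A ^ 4 + 2 * A\<^sup>2 * B\<^sup>2"])
    show "(\<lambda>t. (g k t) ^ 4 - 2 * (g k t)\<^sup>2 * (g' k t)\<^sup>2) integrable_on {0..2 * pi}" for k
      by (intro integrable_UNIV_cont continuous_intros cg)
    fix k t
    have "(g k t) ^ 4 \<le> A ^ 4" "(g k t)\<^sup>2 * (g' k t)\<^sup>2 \<le> A\<^sup>2 * B\<^sup>2"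
      using power_mono[OF A[of k t], of 4] power_mono[OF A[of k t], of 2] power_mono[OF B[of k t], of 2]
      by (auto intro!: mult_mono)
    moreover have "0 \<le> (g k t) ^ 4" "0 \<le> (g k t)\<^sup>2 * (g' k t)\<^sup>2" by auto
    ultimately show "norm ((g k t) ^ 4 - 2 * (g k t)\<^sup>2 * (g' k t)\<^sup>2) \<le> A ^ 4 + 2 * A\<^sup>2 * B\<^sup>2"
      unfolding real_norm_def mult.assoc by linarith
  qed (intro integrable_const_ivl tendsto_intros lim)+
  then have "(\<lambda>k. (1 + e k) ^ 4 * integral {0..2 * pi} (\<lambda>t. (g k t) ^ 4 - 2 * (g k t)\<^sup>2 * (g' k t)\<^sup>2)) \<longlonglongrightarrow>
    (1 + 0) ^ 4 * integral {0..2 * pi} (\<lambda>t. (f t) ^ 4 - 2 * (f t)\<^sup>2 * (f' t)\<^sup>2)"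
    by (intro tendsto_mult tendsto_power tendsto_add tendsto_const e)
  then show ?thesis using step by (auto intro: LIMSEQ_le_const)
qed

end

subsection \<open>Projections onto closed convex cones\<close>

type_synonym vec = "nat \<Rightarrow> real"

definition ip :: "nat \<Rightarrow> vec \<Rightarrow> vec \<Rightarrow> real"
  where "ip n x y = (\<Sum>i<n. x i * y i)"

lemma ip_commute: "ip n x y = ip n y x"
  by (simp add: ip_def mult.commute)

lemma ip_add_left: "ip n (x + y) z = ip n x z + ip n y z"
  by (simp add: ip_def sum.distrib algebra_simps)

lemma ip_diff_left: "ip n (x - y) z = ip n x z - ip n y z"
  by (simp add: ip_def sum_subtractf algebra_simps)

lemma ip_scaleR_left: "ip n (c *\<^sub>R x) z = c * ip n x z"
  by (simp add: ip_def sum_distrib_left scaleR_fun_def mult.assoc)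

lemma ip_add_right: "ip n z (x + y) = ip n z x + ip n z y"
  by (simp add: ip_def sum.distrib algebra_simps)

lemma ip_diff_right: "ip n z (x - y) = ip n z x - ip n z y"
  by (simp add: ip_def sum_subtractf algebra_simps)

lemma ip_scaleR_right: "ip n z (c *\<^sub>R x) = c * ip n z x"
  by (simp add: ip_def sum_distrib_left scaleR_fun_def algebra_simps)

lemma ip_minus_left: "ip n (- x) z = - ip n x z"
  by (simp add: ip_def sum_negf)

lemma ip_minus_right: "ip n z (- x) = - ip n z x"
  by (simp add: ip_def sum_negf)

lemma ip_zero [simp]: "ip n 0 x = 0" "ip n x 0 = 0"
  by (simp_all add: ip_def)

lemmas ip_bilinear = ip_add_left ip_diff_left ip_scaleR_left ip_add_right ip_diff_right
  ip_scaleR_right ip_minus_left ip_minus_right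

lemma ip_self_nonneg [simp]: "0 \<le> ip n x x"
  by (simp add: ip_def sum_nonneg)

lemma L2_set_eq_sqrt_ip: "L2_set x {..<n} = sqrt (ip n x x)"
  by (simp add: L2_set_def ip_def power2_eq_square)

lemma ip_Cauchy_Schwarz: "\<bar>ip n x y\<bar> \<le> sqrt (ip n x x) * sqrt (ip n y y)"
proof -
  have "\<bar>ip n x y\<bar> \<le> (\<Sum>i<n. \<bar>x i\<bar> * \<bar>y i\<bar>)"
    unfolding ip_def by (rule order_trans[OF sum_abs]) (simp add: abs_mult)
  also have "\<dots> \<le> L2_set x {..<n} * L2_set y {..<n}"
    by (rule L2_set_mult_ineq)
  finally show ?thesis by (simp add: L2_set_eq_sqrt_ip)
qed

lemma ip_square_le: "(ip n x y)\<^sup>2 \<le> ip n x x * ip n y y"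
proof -
  have "\<bar>ip n x y\<bar>\<^sup>2 \<le> (sqrt (ip n x x) * sqrt (ip n y y))\<^sup>2"
    using ip_Cauchy_Schwarz by (rule power_mono) simp
  then show ?thesis by (simp add: power_mult_distrib)
qed

lemma ip_cong: "(\<And>i. i < n \<Longrightarrow> x i = x' i) \<Longrightarrow> (\<And>i. i < n \<Longrightarrow> y i = y' i) \<Longrightarrow> ip n x y = ip n x' y'"
  by (simp add: ip_def)

lemma component_square_le_ip: "i < n \<Longrightarrow> (x i)\<^sup>2 \<le> ip n x x"
  unfolding ip_def power2_eq_square[symmetric] by (rule member_le_sum) auto

lemma continuous_on_ip [continuous_intros]:
  assumes "continuous_on S f" "continuous_on S g"
  shows "continuous_on S (\<lambda>x. ip n (f x) (g x))"
  unfolding ip_def using assms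
  by (intro continuous_intros) (auto intro: continuous_on_product_then_coordinatewise)

text \<open>This is \<phi>. For a closed convex cone it is the squared support function, at h, of C
  intersected with the unit ball, and also the maximum of 2<h,x> - |x|^2 over x in C.\<close>

definition sqn_proj :: "nat \<Rightarrow> vec set \<Rightarrow> vec \<Rightarrow> real"
  where "sqn_proj n C h = ip n (metric_proj n C h) (metric_proj n C h)"

lemma sqn_proj_eq: "(L2_set (metric_proj n C h) {..<n})\<^sup>2 = sqn_proj n C h"
  by (simp add: sqn_proj_def L2_set_eq_sqrt_ip)

lemma quadratic_perturbation:
  fixes a b :: real
  assumes "\<And>t. 0 < t \<Longrightarrow> t < 1 \<Longrightarrow> 2 * t * a \<le> t\<^sup>2 * b"
  shows "a \<le> 0"
proof (rule ccontr)
  assume "\<not> a \<le> 0"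
  define t where "t = min (1/2) (a / (\<bar>b\<bar> + 1))"
  have t: "0 < t" "t < 1" using \<open>\<not> a \<le> 0\<close> by (auto simp: t_def)
  have "t * \<bar>b\<bar> \<le> a"
  proof -
    have "t * \<bar>b\<bar> \<le> a / (\<bar>b\<bar> + 1) * (\<bar>b\<bar> + 1)"
      using \<open>\<not> a \<le> 0\<close> by (intro mult_mono) (auto simp: t_def)
    then show ?thesis by simp
  qed
  moreover have "2 * a \<le> t * b"
    using assms[OF t] t by (simp add: power2_eq_square)
  moreover have "t * b \<le> t * \<bar>b\<bar>" using t by simp
  ultimately show False using \<open>\<not> a \<le> 0\<close> by linarith
qed

locale closed_convex_cone =
  fixes n :: nat and C :: "vec set"
  assumes nonempty: "C \<noteq> {}"
    and closedin_C: "closedin (Euclidean_space n) C"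
    and convex_C: "convex C"
    and cone_C: "cone C"
begin

lemma closed_C: "closed C"
  by (rule closedin_Euclidean_imp_closed[OF closedin_C])

lemma C_vanish: "x \<in> C \<Longrightarrow> n \<le> i \<Longrightarrow> x i = 0"
  using closedin_subset[OF closedin_C] by (auto simp: topspace_Euclidean_space)

lemma scaleR_C: "x \<in> C \<Longrightarrow> 0 \<le> c \<Longrightarrow> c *\<^sub>R x \<in> C"
  using cone_C by (auto simp: cone_def)

lemma zero_C: "0 \<in> C"
  using nonempty scaleR_C[of _ 0] by auto

lemma add_C: "x \<in> C \<Longrightarrow> y \<in> C \<Longrightarrow> x + y \<in> C"
  using convex_C cone_C convex_cone[of C] by blast

text \<open>The topology is that of all functions on the naturals. Points of C vanish from n on, so
  a bounded part of C sits in a product of compact intervals whose sides beyond n are the singleton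
  of 0.\<close>

lemma compact_C_bounded: "compact {x \<in> C. ip n x x \<le> r}"
proof -
  let ?B = "PiE UNIV (\<lambda>i. if i < n then {- sqrt r..sqrt r} else {0})"
  have "compact ?B"
    using compactin_PiE[of "\<lambda>_. euclidean" UNIV "\<lambda>i. if i < n then {- sqrt r..sqrt r} else {0}"]
    by (auto simp: euclidean_product_topology)
  moreover have "closed {x \<in> C. ip n x x \<le> r}"
  proof -
    have "closed (C \<inter> {x. ip n x x \<le> r})"
      by (intro closed_Int closed_C closed_Collect_le continuous_on_ip continuous_on_id continuous_on_const)
    moreover have "C \<inter> {x. ip n x x \<le> r} = {x \<in> C. ip n x x \<le> r}" by auto
    ultimately show ?thesis by simp
  qed
  moreover have "{x \<in> C. ip n x x \<le> r} \<subseteq> ?B"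
  proof (intro subsetI PiE_I)
    fix x i assume "x \<in> {x \<in> C. ip n x x \<le> r}"
    then have x: "x \<in> C" "ip n x x \<le> r" by auto
    show "x i \<in> (if i < n then {- sqrt r..sqrt r} else {0})"
    proof (cases "i < n")
      case True
      then have "\<bar>x i\<bar> \<le> sqrt r"
        using component_square_le_ip[of i n x] x real_le_rsqrt by fastforce
      then show ?thesis using True by auto
    qed (use C_vanish[of x i] x in auto)
  qed simp
  ultimately show ?thesis
    using compact_Int_closed[of ?B "{x \<in> C. ip n x x \<le> r}"] by (simp add: inf.absorb2)
qed

abbreviation proj :: "vec \<Rightarrow> vec" where "proj \<equiv> metric_proj n C"

lemma is_arg_min_proj: "is_arg_min (\<lambda>p. L2_set (h - p) {..<n}) (\<lambda>p. p \<in> C) (proj h)"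
proof -
  \<comment> \<open>Outside of B one has |y| > 2|h|, hence |h - y| > |h|, so y loses against the
    competitor 0 and minimizing over B is enough.\<close>
  define B where "B = {x \<in> C. ip n x x \<le> 4 * ip n h h}"
  have coord: "continuous_on B (\<lambda>p. p i)" for i
    by (rule continuous_on_product_then_coordinatewise) auto
  have "compact B" unfolding B_def by (rule compact_C_bounded)
  moreover have "0 \<in> B" using zero_C by (simp add: B_def)
  moreover have "continuous_on B (\<lambda>p. ip n (h - p) (h - p))"
    unfolding ip_def by (simp, intro continuous_intros coord)
  ultimately obtain p where p: "p \<in> B" and min: "\<And>y. y \<in> B \<Longrightarrow> ip n (h - p) (h - p) \<le> ip n (h - y) (h - y)"
    using continuous_attains_inf[of B "\<lambda>p. ip n (h - p) (h - p)"] by blast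
  have le0: "ip n (h - p) (h - p) \<le> ip n h h"
    using min[OF \<open>0 \<in> B\<close>] by simp
  have "ip n (h - p) (h - p) \<le> ip n (h - y) (h - y)" if y: "y \<in> C" for y
  proof (cases "y \<in> B")
    case False
    then have big: "4 * ip n h h < ip n y y" using y by (auto simp: B_def)
    have "ip n y y \<le> 2 * ip n h h + 2 * ip n (h - y) (h - y)"
      using ip_self_nonneg[of n "2 *\<^sub>R h - y"]
      by (simp add: ip_bilinear ip_commute[of n y h] algebra_simps)
    then show ?thesis using big le0 by linarith
  qed (use min in auto)
  then have "is_arg_min (\<lambda>p. L2_set (h - p) {..<n}) (\<lambda>p. p \<in> C) p"
    using p by (auto simp: is_arg_min_linorder L2_set_eq_sqrt_ip B_def)
  then show ?thesis
    unfolding metric_proj_def arg_min_on_def arg_min_def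
    using someI[of "is_arg_min (\<lambda>p. L2_set (h - p) {..<n}) (\<lambda>p. p \<in> C)" p] by simp
qed

lemma proj_in: "proj h \<in> C"
  using is_arg_min_proj[of h] by (simp add: is_arg_min_linorder)

lemma proj_min: "x \<in> C \<Longrightarrow> ip n (h - proj h) (h - proj h) \<le> ip n (h - x) (h - x)"
  using is_arg_min_proj[of h] by (simp add: is_arg_min_linorder L2_set_eq_sqrt_ip)

lemma proj_variational:
  assumes x: "x \<in> C" shows "ip n (h - proj h) (x - proj h) \<le> 0"
proof (rule quadratic_perturbation[where b = "ip n (x - proj h) (x - proj h)"])
  fix t :: real assume t: "0 < t" "t < 1"
  have "(1 - t) *\<^sub>R proj h + t *\<^sub>R x \<in> C"
    using t x by (intro add_C scaleR_C proj_in) auto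
  from proj_min[OF this, of h] show "2 * t * ip n (h - proj h) (x - proj h) \<le> t\<^sup>2 * ip n (x - proj h) (x - proj h)"
    by (simp add: ip_bilinear ip_commute[of n x h] ip_commute[of n x "proj h"] ip_commute[of n "proj h" h] algebra_simps power2_eq_square)
qed

text \<open>Test the variational inequality with 0 and with twice the projection.\<close>

lemma ip_proj_self: "ip n h (proj h) = ip n (proj h) (proj h)"
  using proj_variational[OF zero_C, of h] proj_variational[OF scaleR_C[OF proj_in[of h], of 2], of h]
  by (simp add: ip_bilinear)

lemma ip_le_ip_proj: "x \<in> C \<Longrightarrow> ip n h x \<le> ip n (proj h) x"
  using proj_variational[of x h] ip_proj_self[of h] by (simp add: ip_bilinear)

abbreviation sqn :: "vec \<Rightarrow> real" where "sqn \<equiv> sqn_proj n C"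

lemmas sqn_def = sqn_proj_def[of n C]

lemma sqn_nonneg [simp]: "0 \<le> sqn h"
  by (simp add: sqn_def)

lemma sqn_le: "sqn h \<le> ip n h h"
  using ip_self_nonneg[of n "h - proj h"] ip_proj_self[of h]
  by (simp add: sqn_def ip_bilinear ip_commute[of n "proj h" h])

lemma ip_le_sqrt_sqn: "x \<in> C \<Longrightarrow> ip n h x \<le> sqrt (sqn h) * sqrt (ip n x x)"
  using ip_le_ip_proj[of x h] ip_Cauchy_Schwarz[of n "proj h" x] by (simp add: sqn_def)

text \<open>Each x in C gives a lower bound that is affine in h, with equality at
  \<open>x = proj h\<close>. Convexity of sqn, its gradient and its monotonicity in the cone all
  come from testing with projections of other points.\<close>

lemma sqn_ge: "x \<in> C \<Longrightarrow> 2 * ip n h x - ip n x x \<le> sqn h"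
  using ip_le_ip_proj[of x h] ip_self_nonneg[of n "proj h - x"]
  by (simp add: sqn_def ip_bilinear ip_commute[of n x "proj h"])

lemma proj_nonexpansive:
  "ip n (proj h - proj h') (proj h - proj h') \<le> ip n (h - h') (h - h')"
proof -
  have "ip n (proj h - proj h') (proj h - proj h') \<le> ip n (h - h') (proj h - proj h')"
    using proj_variational[OF proj_in[of h'], of h] proj_variational[OF proj_in[of h], of h']
    by (simp add: ip_bilinear ip_commute[of n "proj h" "proj h'"])
  moreover have "0 \<le> ip n (h - h' - (proj h - proj h')) (h - h' - (proj h - proj h'))" by (rule ip_self_nonneg)
  ultimately show ?thesis
    by (simp only: ip_diff_left[of n "h - h'"] ip_diff_right[of n _ "h - h'"] ip_commute[of n "proj h - proj h'" "h - h'"])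
qed

text \<open>The gradient of sqn at h is \<open>2 * proj h\<close>, with a quadratic remainder:
  testing \<open>sqn_ge\<close> crosswise with the two projections bounds it on both sides, and
  nonexpansiveness makes the upper bound quadratic.\<close>

lemma sqn_first_order:
  "0 \<le> sqn h' - sqn h - 2 * ip n (h' - h) (proj h)"
  "sqn h' - sqn h - 2 * ip n (h' - h) (proj h) \<le> 2 * ip n (h' - h) (h' - h)"
proof -
  show "0 \<le> sqn h' - sqn h - 2 * ip n (h' - h) (proj h)"
    using sqn_ge[OF proj_in[of h], of h'] ip_proj_self[of h] by (simp add: sqn_def ip_bilinear)
  have "sqn h' - sqn h - 2 * ip n (h' - h) (proj h) \<le> 2 * ip n (h' - h) (proj h' - proj h)"
    using sqn_ge[OF proj_in[of h'], of h] ip_proj_self[of h'] by (simp add: sqn_def ip_bilinear)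
  also have "\<dots> \<le> 2 * (sqrt (ip n (h' - h) (h' - h)) * sqrt (ip n (h' - h) (h' - h)))"
    using ip_Cauchy_Schwarz[of n "h' - h" "proj h' - proj h"]
      mult_left_mono[OF real_sqrt_le_mono[OF proj_nonexpansive[of h' h]], of "sqrt (ip n (h' - h) (h' - h))"]
    by simp
  finally show "sqn h' - sqn h - 2 * ip n (h' - h) (proj h) \<le> 2 * ip n (h' - h) (h' - h)" by simp
qed

text \<open>Positive sqn means that h lies outside the polar cone. Nontriviality of a section and
  the signs taken by a row on it are all expressed in this form.\<close>

lemma sqn_pos_iff: "0 < sqn h \<longleftrightarrow> (\<exists>x\<in>C. 0 < ip n h x)"
proof
  assume "0 < sqn h"
  then show "\<exists>x\<in>C. 0 < ip n h x"
    using ip_proj_self[of h] proj_in[of h] by (metis sqn_def)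
next
  assume "\<exists>x\<in>C. 0 < ip n h x"
  then obtain x where "x \<in> C" "0 < ip n h x" by blast
  then have "0 < sqrt (sqn h) * sqrt (ip n x x)" using ip_le_sqrt_sqn[of x h] by linarith
  then have "sqn h \<noteq> 0" by auto
  then show "0 < sqn h" using sqn_nonneg[of h] by linarith
qed

lemma continuous_on_sqn: "continuous_on UNIV sqn"
  unfolding continuous_on_def
proof
  fix h :: vec
  have lim: "((\<lambda>h'. ip n (h' - h) y) \<longlongrightarrow> 0) (at h)" for y
  proof -
    have "continuous_on UNIV (\<lambda>h'. ip n h' y - ip n h y)"
      by (intro continuous_on_ip continuous_intros)
    then have "((\<lambda>h'. ip n h' y - ip n h y) \<longlongrightarrow> ip n h y - ip n h y) (at h)"
      unfolding continuous_on_def by blast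
    then show ?thesis by (simp add: ip_bilinear)
  qed
  have lim2: "((\<lambda>h'. ip n (h' - h) (h' - h)) \<longlongrightarrow> 0) (at h)"
  proof -
    have "continuous_on UNIV (\<lambda>h'. ip n h' h' - 2 * ip n h' h + ip n h h)"
      by (intro continuous_on_ip continuous_intros)
    then have "((\<lambda>h'. ip n h' h' - 2 * ip n h' h + ip n h h) \<longlongrightarrow> ip n h h - 2 * ip n h h + ip n h h) (at h)"
      unfolding continuous_on_def by blast
    moreover have "ip n h' h' - 2 * ip n h' h + ip n h h = ip n (h' - h) (h' - h)" for h'
      by (simp add: ip_bilinear ip_commute[of n h h'])
    ultimately show ?thesis by simp
  qed
  show "(sqn \<longlongrightarrow> sqn h) (at h within UNIV)"
  proof (rule tendsto_sandwich)
    show "\<forall>\<^sub>F h' in at h within UNIV. sqn h + 2 * ip n (h' - h) (proj h) \<le> sqn h'"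
      using sqn_first_order(1)[of _ h] by (intro always_eventually allI) (simp add: algebra_simps)
    show "\<forall>\<^sub>F h' in at h within UNIV. sqn h' \<le> sqn h + 2 * ip n (h' - h) (proj h) + 2 * ip n (h' - h) (h' - h)"
      using sqn_first_order(2)[of _ h] by (intro always_eventually allI) (simp add: algebra_simps)
    show "((\<lambda>h'. sqn h + 2 * ip n (h' - h) (proj h)) \<longlongrightarrow> sqn h) (at h within UNIV)"
      using tendsto_add[OF tendsto_const tendsto_mult[OF tendsto_const lim], of "sqn h" 2] by simp
    show "((\<lambda>h'. sqn h + 2 * ip n (h' - h) (proj h) + 2 * ip n (h' - h) (h' - h)) \<longlongrightarrow> sqn h) (at h within UNIV)"
      using tendsto_add[OF tendsto_add[OF tendsto_const tendsto_mult[OF tendsto_const lim]] tendsto_mult[OF tendsto_const lim2], of "sqn h" 2 _ 2]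
      by simp
  qed
qed

lemma continuous_on_proj: "continuous_on UNIV proj"
proof (rule continuous_on_coordinatewise_then_product)
  fix i show "continuous_on UNIV (\<lambda>h. proj h i)"
  proof (cases "i < n")
    case True
    show ?thesis unfolding continuous_on_def
    proof
      fix h :: vec
      have "continuous_on UNIV (\<lambda>h'. sqrt (ip n h' h' - 2 * ip n h' h + ip n h h))"
        by (intro continuous_on_ip continuous_intros)
      then have "((\<lambda>h'. sqrt (ip n h' h' - 2 * ip n h' h + ip n h h)) \<longlongrightarrow> sqrt (ip n h h - 2 * ip n h h + ip n h h)) (at h)"
        unfolding continuous_on_def by blast
      moreover have "ip n h' h' - 2 * ip n h' h + ip n h h = ip n (h' - h) (h' - h)" for h'
        by (simp add: ip_bilinear ip_commute[of n h h'])
      ultimately have lim: "((\<lambda>h'. sqrt (ip n (h' - h) (h' - h))) \<longlongrightarrow> 0) (at h)" by simp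
      have le: "\<bar>proj h' i - proj h i\<bar> \<le> sqrt (ip n (h' - h) (h' - h))" for h'
        using component_square_le_ip[OF True, of "proj h' - proj h"] proj_nonexpansive[of h' h]
        by (intro real_le_rsqrt) simp
      show "((\<lambda>h. proj h i) \<longlongrightarrow> proj h i) (at h within UNIV)"
        by (rule LIM_zero_cancel, rule tendsto_rabs_zero_cancel,
            rule tendsto_sandwich[where f = "\<lambda>_. 0"]) (use lim le in auto)
    qed
  next
    case False
    then have "proj h i = 0" for h using C_vanish[OF proj_in] by simp
    then show ?thesis by simp
  qed
qed

lemma proj_cong:
  assumes "\<And>i. i < n \<Longrightarrow> h i = h' i" shows "proj h = proj h'"
proof -
  have "L2_set (h - p) {..<n} = L2_set (h' - p) {..<n}" for p
    using assms by (simp add: L2_set_def)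
  then show ?thesis by (simp add: metric_proj_def)
qed

lemma sqn_cong: "(\<And>i. i < n \<Longrightarrow> h i = h' i) \<Longrightarrow> sqn h = sqn h'"
  by (simp add: sqn_def proj_cong[of h h'])

end

abbreviation slice :: "nat \<Rightarrow> vec set \<Rightarrow> vec \<Rightarrow> vec set"
  where "slice n C g \<equiv> {x \<in> C. ip n g x = 0}"

lemma closed_convex_cone_slice:
  assumes "closed_convex_cone n C"
  shows "closed_convex_cone n (slice n C g)"
proof -
  interpret closed_convex_cone n C by fact
  have "closed {x. ip n g x = 0}"
    by (intro closed_Collect_eq continuous_intros)
  then have "closedin (Euclidean_space n) (C \<inter> {x. ip n g x = 0})"
    using closedin_C unfolding closedin_Euclidean_space_iff by (auto intro: closed_Int)
  moreover have "C \<inter> {x. ip n g x = 0} = slice n C g" by auto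
  ultimately show ?thesis
    using zero_C add_C scaleR_C
    by unfold_locales (auto simp: ip_bilinear cone_def convex_def)
qed

subsection \<open>Rotating a pair of vectors\<close>

definition rotv :: "real \<Rightarrow> vec \<Rightarrow> vec \<Rightarrow> vec"
  where "rotv x h g = cos x *\<^sub>R h + sin x *\<^sub>R g"

text \<open>A further quarter turn is the derivative of \<open>rotv\<close> in x, and
  \<open>rotv x\<close>, \<open>rotd x\<close> together form the pair rotated by the angle
  x.\<close>

abbreviation rotd :: "real \<Rightarrow> vec \<Rightarrow> vec \<Rightarrow> vec"
  where "rotd x h g \<equiv> rotv (x + pi / 2) h g"

lemma rotd_eq: "rotd x h g = (- sin x) *\<^sub>R h + cos x *\<^sub>R g"
  by (simp add: rotv_def cos_add sin_add)

lemma rotv_0 [simp]: "rotv 0 h g = h"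
  by (simp add: rotv_def)

lemma rotv_periodic: "rotv (x + 2 * pi) h g = rotv x h g"
  by (simp add: rotv_def)

lemma rotv_rotv: "rotv x (rotv y h g) (rotd y h g) = rotv (x + y) h g"
  unfolding rotd_eq unfolding rotv_def
  by (simp add: scaleR_add_right scaleR_fun_def fun_eq_iff cos_add sin_add algebra_simps)

lemma rotv_split: "rotv y h g = cos (y - x) *\<^sub>R rotv x h g + sin (y - x) *\<^sub>R rotd x h g"
  using rotv_rotv[of "y - x" x h g] by (simp add: rotv_def[of "y - x"])

lemma continuous_on_rotv: "continuous_on S (\<lambda>x. rotv x h g)"
  unfolding rotv_def scaleR_fun_def plus_fun_def
  by (intro continuous_on_coordinatewise_then_product continuous_intros)

lemma DERIV_zero_squeeze:
  fixes u v :: "real \<Rightarrow> real"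
  assumes v: "(v has_real_derivative 0) (at x)" and vx: "v x = 0"
    and u: "\<And>y. 0 \<le> u y" "\<And>y. u y \<le> v y"
  shows "(u has_real_derivative 0) (at x)"
proof -
  have ux: "u x = 0" using u[of x] vx by simp
  have "((\<lambda>k. (v (x + k) - v x) / k) \<longlongrightarrow> 0) (at 0)" using v by (simp add: DERIV_def)
  then have "((\<lambda>k. \<bar>v (x + k) / k\<bar>) \<longlongrightarrow> 0) (at 0)" using vx tendsto_rabs_zero by fastforce
  then have "((\<lambda>k. \<bar>u (x + k) / k\<bar>) \<longlongrightarrow> 0) (at 0)"
  proof (rule tendsto_sandwich[where f = "\<lambda>_. 0", rotated -1])
    show "\<forall>\<^sub>F k in at 0. \<bar>u (x + k) / k\<bar> \<le> \<bar>v (x + k) / k\<bar>"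
    proof (intro always_eventually allI)
      fix k
      have "\<bar>u (x + k)\<bar> \<le> \<bar>v (x + k)\<bar>" using u[of "x + k"] by simp
      then show "\<bar>u (x + k) / k\<bar> \<le> \<bar>v (x + k) / k\<bar>" by (simp add: abs_divide divide_right_mono)
    qed
  qed auto
  then show ?thesis using ux by (simp add: DERIV_def tendsto_rabs_zero_cancel)
qed

section \<open>The squared projection norm along a rotating pair\<close>

context closed_convex_cone
begin

text \<open>Half the angular derivative of sqn. At angle 0 it is <g, \<Pi>(h)>, so under rotation
  averages its square becomes E <g, \<Pi>(h)>^2, which is the statistical dimension.\<close>

abbreviation turn :: "real \<Rightarrow> vec \<Rightarrow> vec \<Rightarrow> real"
  where "turn x h g \<equiv> ip n (rotd x h g) (proj (rotv x h g))"

text \<open>Along the rotation the linear part a is differentiated explicitly, and the remainder is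
  squeezed between 0 and b, which vanishes to second order at x.\<close>

lemma DERIV_sqn_rotv:
  "((\<lambda>x. sqn (rotv x h g)) has_real_derivative 2 * turn x h g) (at x)"
proof -
  define p where "p = proj (rotv x h g)"
  define a where "a y = ip n (rotv y h g) p" for y
  define b where "b y = 2 * ip n (rotv y h g - rotv x h g) (rotv y h g - rotv x h g)" for y
  have a': "(a has_real_derivative ip n (rotd y h g) p) (at y)" for y
  proof -
    have "a = (\<lambda>y. cos y * ip n h p + sin y * ip n g p)"
      by (simp add: a_def fun_eq_iff rotv_def ip_bilinear)
    then show ?thesis
      by (auto simp: rotd_eq ip_bilinear intro!: derivative_eq_intros)
  qed
  have b': "(b has_real_derivative 0) (at x)"
  proof -
    have "b = (\<lambda>y. 2 * ((cos y - cos x)\<^sup>2 * ip n h h + 2 * (cos y - cos x) * (sin y - sin x) * ip n h g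
       + (sin y - sin x)\<^sup>2 * ip n g g))"
      by (simp add: b_def fun_eq_iff rotv_def ip_bilinear ip_commute[of n g h] power2_eq_square algebra_simps)
    then show ?thesis by (auto intro!: derivative_eq_intros)
  qed
  have "((\<lambda>y. sqn (rotv y h g) - sqn (rotv x h g) - 2 * (a y - a x)) has_real_derivative 0) (at x)"
  proof (rule DERIV_zero_squeeze[OF b'])
    show "b x = 0" by (simp add: b_def)
    fix y
    show "0 \<le> sqn (rotv y h g) - sqn (rotv x h g) - 2 * (a y - a x)"
      using sqn_first_order(1)[where h' = "rotv y h g" and h = "rotv x h g"] by (simp add: a_def p_def ip_diff_left)
    show "sqn (rotv y h g) - sqn (rotv x h g) - 2 * (a y - a x) \<le> b y"
      using sqn_first_order(2)[where h' = "rotv y h g" and h = "rotv x h g"] by (simp add: a_def b_def p_def ip_diff_left)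
  qed
  from DERIV_add[OF this DERIV_add[OF DERIV_cmult[OF a', of 2 x] DERIV_const[of "sqn (rotv x h g) - 2 * a x"]]]
  show ?thesis by (simp add: p_def algebra_simps)
qed

text \<open>Keeps s positive and its square root differentiable. It is what s becomes for the cone C
  x R^2 when h and g are extended by two orthogonal vectors of length \<open>\<epsilon>\<close>,
  which is why the support inequality persists.\<close>

definition supp_reg :: "real \<Rightarrow> vec \<Rightarrow> vec \<Rightarrow> real \<Rightarrow> real"
  where "supp_reg \<epsilon> h g x = sqrt (sqn (rotv x h g) + \<epsilon>\<^sup>2)"

lemma continuous_on_sqn_rotv: "continuous_on S (\<lambda>x. sqn (rotv x h g))"
  by (rule continuous_on_compose2[OF continuous_on_sqn continuous_on_rotv]) simp

lemma continuous_on_ip_rotd_proj: "continuous_on S (\<lambda>x. turn x h g)"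
  by (intro continuous_on_ip continuous_on_compose2[OF continuous_on_proj continuous_on_rotv]
      continuous_on_compose2[OF continuous_on_rotv[of UNIV]] continuous_intros) auto

lemma supp_reg_square: "(supp_reg \<epsilon> h g x)\<^sup>2 = sqn (rotv x h g) + \<epsilon>\<^sup>2"
  by (simp add: supp_reg_def)

lemma supp_reg_pos: "0 < \<epsilon> \<Longrightarrow> 0 < supp_reg \<epsilon> h g x"
  by (simp add: supp_reg_def add_nonneg_pos)

text \<open>Multiplied by its value at t, the support inequality reads <rotv x, p> + \<epsilon>^2
  cos(x - t) \<le> s(x) s(t) with p the projection at t. It follows from Cauchy-Schwarz, once for
  <rotv x, p> and once for the planar vectors formed by a projection norm and
  \<open>\<epsilon>\<close>.\<close>

lemma supp_reg_support_fun:
  assumes \<epsilon>: "0 < \<epsilon>"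
  shows "support_fun_C1 (supp_reg \<epsilon> h g)
    (\<lambda>x. turn x h g / supp_reg \<epsilon> h g x)"
proof
  show cf: "continuous_on UNIV (supp_reg \<epsilon> h g)"
    unfolding supp_reg_def by (intro continuous_intros continuous_on_sqn_rotv)
  show "supp_reg \<epsilon> h g (x + 2 * pi) = supp_reg \<epsilon> h g x" for x
    by (simp add: supp_reg_def rotv_periodic)
  show "0 < supp_reg \<epsilon> h g x" for x using supp_reg_pos[OF \<epsilon>] .
  show "(supp_reg \<epsilon> h g has_real_derivative turn x h g / supp_reg \<epsilon> h g x) (at x)" for x
  proof -
    have "0 < sqn (rotv x h g) + \<epsilon>\<^sup>2" using \<epsilon> by (simp add: add_nonneg_pos)
    from DERIV_chain2[OF DERIV_real_sqrt[OF this] DERIV_add[OF DERIV_sqn_rotv DERIV_const]]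
    show ?thesis unfolding supp_reg_def by (simp add: field_simps)
  qed
  show "continuous_on UNIV (\<lambda>x. turn x h g / supp_reg \<epsilon> h g x)"
    using supp_reg_pos[OF \<epsilon>, THEN less_imp_neq, THEN not_sym]
    by (intro continuous_intros continuous_on_ip_rotd_proj cf) auto
  fix x t
  define p where "p = proj (rotv t h g)"
  have "supp_reg \<epsilon> h g t * (supp_reg \<epsilon> h g t * cos (x - t) + ip n (rotd t h g) p / supp_reg \<epsilon> h g t * sin (x - t))
     = (sqn (rotv t h g) + \<epsilon>\<^sup>2) * cos (x - t) + ip n (rotd t h g) p * sin (x - t)"
    using supp_reg_pos[OF \<epsilon>, of h g t] supp_reg_square[of \<epsilon> h g t]
    by (simp add: distrib_left power2_eq_square[of "supp_reg \<epsilon> h g t"] mult.assoc[symmetric])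
  also have "\<dots> = ip n (rotv x h g) p + \<epsilon> * (\<epsilon> * cos (x - t))"
    unfolding rotv_split[of x h g t] ip_add_left ip_scaleR_left p_def ip_proj_self sqn_def[of "rotv t h g"]
    by (simp add: algebra_simps power2_eq_square)
  also have "\<dots> \<le> sqrt (sqn (rotv x h g)) * sqrt (sqn (rotv t h g)) + \<epsilon> * \<epsilon>"
    using ip_le_sqrt_sqn[OF proj_in, of "rotv x h g" "rotv t h g"] \<epsilon>
    by (intro add_mono mult_left_mono) (auto simp: p_def sqn_def)
  also have "\<dots> \<le> supp_reg \<epsilon> h g x * supp_reg \<epsilon> h g t"
  proof (rule power2_le_imp_le)
    let ?a = "sqrt (sqn (rotv x h g))" and ?b = "sqrt (sqn (rotv t h g))"
    \<comment> \<open>Lagrange's identity for the planar vectors (a, \<epsilon>) and (b,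
      \<epsilon>).\<close>
    have "(?a * ?b + \<epsilon> * \<epsilon>)\<^sup>2 + \<epsilon>\<^sup>2 * (?a - ?b)\<^sup>2 = (?a\<^sup>2 + \<epsilon>\<^sup>2) * (?b\<^sup>2 + \<epsilon>\<^sup>2)"
      by (simp add: algebra_simps power2_eq_square del: real_sqrt_mult_self)
    then have "(?a * ?b + \<epsilon> * \<epsilon>)\<^sup>2 \<le> (?a\<^sup>2 + \<epsilon>\<^sup>2) * (?b\<^sup>2 + \<epsilon>\<^sup>2)"
      by (smt (verit) mult_nonneg_nonneg zero_le_power2)
    then show "(?a * ?b + \<epsilon> * \<epsilon>)\<^sup>2 \<le> (supp_reg \<epsilon> h g x * supp_reg \<epsilon> h g t)\<^sup>2"
      by (simp add: power_mult_distrib supp_reg_square)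
    show "0 \<le> supp_reg \<epsilon> h g x * supp_reg \<epsilon> h g t"
      using supp_reg_pos[OF \<epsilon>, of h g] by (simp add: less_imp_le)
  qed
  finally show "supp_reg \<epsilon> h g t * cos (x - t) + turn t h g / supp_reg \<epsilon> h g t * sin (x - t)
       \<le> supp_reg \<epsilon> h g x"
    using supp_reg_pos[OF \<epsilon>, of h g t] unfolding p_def by (simp add: mult.commute)
qed

text \<open>By homogeneity this is the infimum over t of
  \<open>sqn (h + t g) + \<epsilon>^2 (1 + t^2)\<close> with t = tan x, a regularized dual value for
  the section by g.\<close>

definition reg :: "real \<Rightarrow> vec \<Rightarrow> vec \<Rightarrow> real"
  where "reg \<epsilon> h g = (rad (supp_reg \<epsilon> h g) 0)\<^sup>2"

text \<open>Rotating the pair translates the support function along the circle. Thus integrals of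
  the radial function over all directions are averages of \<open>reg\<close> over rotated
  pairs.\<close>

lemma reg_rot: "reg \<epsilon> (rotv \<psi> h g) (rotd \<psi> h g) = (rad (supp_reg \<epsilon> h g) \<psi>)\<^sup>2"
proof -
  have "range (\<lambda>x. cos (x - 0) / supp_reg \<epsilon> (rotv \<psi> h g) (rotd \<psi> h g) x)
     = range (\<lambda>x. cos (x - \<psi>) / supp_reg \<epsilon> h g x)"
  proof -
    have "range (\<lambda>x. cos (x - \<psi>) / supp_reg \<epsilon> h g x)
      = (\<lambda>x. cos (x - \<psi>) / supp_reg \<epsilon> h g x) ` range (\<lambda>x. x + \<psi>)"
      by (simp only: surj_plus_right)
    then show ?thesis by (simp only: image_image supp_reg_def rotv_rotv) simp
  qed
  then show ?thesis by (simp add: reg_def rad_def)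
qed

lemma circle_average_reg_ge:
  assumes \<epsilon>: "0 < \<epsilon>"
  shows "integral {0..2 * pi} (\<lambda>\<psi>. sqn (rotv \<psi> h g) + \<epsilon>\<^sup>2
        - (turn \<psi> h g)\<^sup>2 / (sqn (rotv \<psi> h g) + \<epsilon>\<^sup>2))
    \<le> integral {0..2 * pi} (\<lambda>\<psi>. reg \<epsilon> (rotv \<psi> h g) (rotd \<psi> h g))"
  using support_fun_C1.integral_rad_square_ge[OF supp_reg_support_fun[OF \<epsilon>], of h g]
  by (simp add: reg_rot supp_reg_square power_divide)

text \<open>The product f f' is half the derivative of f^2, that is \<open>turn\<close>, so
  \<open>\<epsilon>\<close> disappears from the subtracted term.\<close>

lemma circle_average_reg_square_le:
  assumes \<epsilon>: "0 < \<epsilon>"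
  shows "integral {0..2 * pi} (\<lambda>\<psi>. (reg \<epsilon> (rotv \<psi> h g) (rotd \<psi> h g))\<^sup>2)
    \<le> integral {0..2 * pi} (\<lambda>\<psi>. (sqn (rotv \<psi> h g) + \<epsilon>\<^sup>2)\<^sup>2 - 2 * (turn \<psi> h g)\<^sup>2)"
proof -
  have "(supp_reg \<epsilon> h g t) ^ 4 = (sqn (rotv t h g) + \<epsilon>\<^sup>2)\<^sup>2" for t
    using power_mult[of "supp_reg \<epsilon> h g t" 2 2] by (simp add: supp_reg_square)
  moreover have "2 * (supp_reg \<epsilon> h g t)\<^sup>2 * (turn t h g / supp_reg \<epsilon> h g t)\<^sup>2
     = 2 * (turn t h g)\<^sup>2" for t
    using supp_reg_pos[OF \<epsilon>, of h g t] by (simp add: power_divide)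
  ultimately show ?thesis
    using support_fun_C1.integral_rad_power4_le[OF supp_reg_support_fun[OF \<epsilon>], of h g]
    by (simp only: reg_rot power_mult[symmetric]) simp
qed

lemma continuous_on_reg_rot: "0 < \<epsilon> \<Longrightarrow> continuous_on S (\<lambda>\<psi>. reg \<epsilon> (rotv \<psi> h g) (rotd \<psi> h g))"
  using supp_reg_support_fun[of \<epsilon> h g] unfolding reg_rot
  by (intro continuous_intros)
    (auto simp: support_fun_C1_def support_fun_def intro: continuous_on_subset[OF periodic_pos.continuous_rad])

lemma reg_nonneg [simp]: "0 \<le> reg \<epsilon> h g"
  by (simp add: reg_def)

lemma reg_le: "0 < \<epsilon> \<Longrightarrow> reg \<epsilon> h g \<le> sqn h + \<epsilon>\<^sup>2"
proof -
  assume \<epsilon>: "0 < \<epsilon>"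
  interpret support_fun_C1 "supp_reg \<epsilon> h g" "\<lambda>x. turn x h g / supp_reg \<epsilon> h g x"
    by (rule supp_reg_support_fun[OF \<epsilon>])
  have "reg \<epsilon> h g \<le> (supp_reg \<epsilon> h g 0)\<^sup>2"
    unfolding reg_def using rad_le[of 0] rad_pos[of 0] by (intro power_mono) auto
  then show ?thesis by (simp add: supp_reg_square)
qed

text \<open>A crude Poincare inequality: the oscillation of q over the whole circle is at most the
  square root of 2 pi I, with I the integral of q'^2. Squaring and integrating over length 2 pi
  gives 4 pi^2 I, and q' = 2 turn contributes another factor 4.\<close>

lemma circle_variation:
  "integral {0..2 * pi} (\<lambda>\<psi>. (sqn (rotv \<psi> h g) - sqn (rotd \<psi> h g))\<^sup>2)
    \<le> integral {0..2 * pi} (\<lambda>\<psi>. 16 * pi\<^sup>2 * (turn \<psi> h g)\<^sup>2)"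
proof -
  define q where "q x = sqn (rotv x h g)" for x
  define q' where "q' x = 2 * turn x h g" for x
  have dq: "(q has_real_derivative q' x) (at x)" for x
    unfolding q_def q'_def by (rule DERIV_sqn_rotv)
  have cq: "continuous_on S q" for S unfolding q_def by (rule continuous_on_sqn_rotv)
  have cq': "continuous_on S q'" for S unfolding q'_def by (intro continuous_intros continuous_on_ip_rotd_proj)
  have qper: "q (x + 2 * pi) = q x" for x by (simp add: q_def rotv_periodic)
  define I where "I = integral {0..2 * pi} (\<lambda>x. (q' x)\<^sup>2)"
  have I0: "0 \<le> I" unfolding I_def by (intro integral_nonneg integrable_continuous_real continuous_intros cq') auto
  have bound: "\<bar>q b - q a\<bar> \<le> pi * c + I / (2 * c)" if c: "0 < c" and ab: "a \<in> {0..2 * pi}" "b \<in> {0..2 * pi}" "a \<le> b" for a b c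
  proof -
    have "(q' has_integral (q b - q a)) {a..b}"
      using ab dq by (intro fundamental_theorem_of_calculus)
        (auto simp: has_real_derivative_iff_has_vector_derivative[symmetric] intro: has_field_derivative_at_within)
    then have "\<bar>q b - q a\<bar> = \<bar>integral {a..b} q'\<bar>" by (simp add: integral_unique)
    also have "\<dots> \<le> integral {a..b} (\<lambda>x. c / 2 + (q' x)\<^sup>2 / (2 * c))"
    proof (rule integral_norm_bound_integral[where f = q', unfolded real_norm_def])
      fix x
      have "0 \<le> (c - \<bar>q' x\<bar>)\<^sup>2" by simp
      then have "2 * c * \<bar>q' x\<bar> \<le> c\<^sup>2 + (q' x)\<^sup>2" by (simp add: power2_diff)
      then have "\<bar>q' x\<bar> \<le> (c\<^sup>2 + (q' x)\<^sup>2) / (2 * c)" using c by (simp add: field_simps)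
      also have "\<dots> = c / 2 + (q' x)\<^sup>2 / (2 * c)" using c by (simp add: field_simps power2_eq_square)
      finally show "\<bar>q' x\<bar> \<le> c / 2 + (q' x)\<^sup>2 / (2 * c)" .
    qed (use c in \<open>auto intro!: integrable_continuous_real continuous_intros cq'\<close>)
    also have "\<dots> \<le> integral {0..2 * pi} (\<lambda>x. c / 2 + (q' x)\<^sup>2 / (2 * c))"
      using ab c by (intro integral_subset_le) (auto intro!: integrable_continuous_real continuous_intros cq')
    also have "\<dots> = integral {0..2 * pi} (\<lambda>x. c / 2) + integral {0..2 * pi} (\<lambda>x. (q' x)\<^sup>2 / (2 * c))"
      using c by (intro Henstock_Kurzweil_Integration.integral_add integrable_continuous_real continuous_intros cq') auto
    also have "\<dots> = pi * c + I / (2 * c)" by (simp add: I_def)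
    finally show ?thesis .
  qed
  have bound2: "\<bar>q b - q a\<bar> \<le> pi * c + I / (2 * c)" if c: "0 < c" for a b c
  proof -
    obtain a' k where a': "a' \<in> {0..2 * pi}" "a = a' + of_int k * (2 * pi)" using periodic_reduce by metis
    obtain b' l where b': "b' \<in> {0..2 * pi}" "b = b' + of_int l * (2 * pi)" using periodic_reduce by metis
    have "q a = q a'" "q b = q b'" using periodic_int[of q, OF qper] a' b' by auto
    then show ?thesis using bound[OF c a'(1) b'(1)] bound[OF c b'(1) a'(1)] by (cases "a' \<le> b'") auto
  qed
  have sq: "(q a - q b)\<^sup>2 \<le> 2 * pi * I" for a b
  proof -
    define D where "D = \<bar>q a - q b\<bar>"
    have D: "D \<le> pi * c + I / (2 * c)" if "0 < c" for c using bound2[OF that, of a b] by (simp add: D_def)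
    have "D\<^sup>2 \<le> 2 * pi * I"
    proof (cases "D = 0")
      case False
      then have "0 < D" by (simp add: D_def)
      \<comment> \<open>The weight c = D / (2 pi) makes the first term half of D, so it can be
        absorbed on the left.\<close>
      then have "D \<le> D / 2 + pi * I / D"
        using D[of "D / (2 * pi)"] by (simp add: field_simps)
      then show ?thesis using \<open>0 < D\<close> by (simp add: field_simps power2_eq_square)
    qed (use I0 in simp)
    then show ?thesis by (simp add: D_def)
  qed
  have "integral {0..2 * pi} (\<lambda>\<psi>. (q \<psi> - q (\<psi> + pi / 2))\<^sup>2) \<le> integral {0..2 * pi} (\<lambda>\<psi>. 2 * pi * I)"
    using sq by (intro integral_le integrable_continuous_real continuous_intros cq
        continuous_on_compose2[OF cq[of UNIV], of _ "\<lambda>\<psi>. \<psi> + pi / 2"]) auto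
  also have "\<dots> = 4 * pi\<^sup>2 * I" by (simp add: power2_eq_square)
  also have "\<dots> = integral {0..2 * pi} (\<lambda>\<psi>. 16 * pi\<^sup>2 * (turn \<psi> h g)\<^sup>2)"
    unfolding I_def q'_def by (simp add: power_mult_distrib)
  finally show ?thesis by (simp add: q_def)
qed

end

subsection \<open>Hyperplane sections\<close>

context closed_convex_cone
begin

text \<open>Weak duality: z in the section is orthogonal to g, so its inner product with
  \<open>rotv \<theta> h g\<close> is cos \<theta> <h,z>. For z the projection this bounds |z| cos
  \<theta> by the support function, so the radial function at 0 is at least |z|.\<close>

lemma slice_sqn_le_reg:
  assumes \<epsilon>: "0 < \<epsilon>"
  shows "sqn_proj n (slice n C g) h \<le> reg \<epsilon> h g"
proof -
  interpret S: closed_convex_cone n "slice n C g"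
    by (rule closed_convex_cone_slice) unfold_locales
  interpret F: support_fun_C1 "supp_reg \<epsilon> h g" "\<lambda>x. turn x h g / supp_reg \<epsilon> h g x"
    by (rule supp_reg_support_fun[OF \<epsilon>])
  obtain \<theta> where t: "0 < cos (\<theta> - 0)" "rad (supp_reg \<epsilon> h g) 0 = supp_reg \<epsilon> h g \<theta> / cos (\<theta> - 0)"
    using F.rad_attained by metis
  define z where "z = S.proj h"
  define r where "r = sqrt (S.sqn h)"
  have z: "z \<in> C" "ip n g z = 0" using S.proj_in[of h] by (auto simp: z_def)
  have "cos \<theta> * (r * r) = ip n (rotv \<theta> h g) z"
    using z S.ip_proj_self[of h] by (simp add: rotv_def ip_bilinear z_def r_def S.sqn_def)
  also have "\<dots> \<le> sqrt (sqn (rotv \<theta> h g)) * r"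
    using ip_le_sqrt_sqn[OF z(1), of "rotv \<theta> h g"] by (simp add: r_def S.sqn_def z_def)
  also have "\<dots> \<le> supp_reg \<epsilon> h g \<theta> * r"
    by (intro mult_right_mono) (auto simp: supp_reg_def r_def)
  finally have le: "(cos \<theta> * r) * r \<le> supp_reg \<epsilon> h g \<theta> * r" by simp
  have "r \<le> rad (supp_reg \<epsilon> h g) 0"
  proof (cases "r = 0")
    case False
    then have "0 < r" using S.sqn_nonneg[of h] by (simp add: r_def order_le_neq_trans)
    then have "cos \<theta> * r \<le> supp_reg \<epsilon> h g \<theta>" using le by simp
    then show ?thesis using t by (simp add: pos_le_divide_eq mult.commute)
  qed (use F.rad_pos[of 0] in simp)
  then have "r\<^sup>2 \<le> reg \<epsilon> h g" unfolding reg_def by (intro power_mono) (auto simp: r_def)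
  then show ?thesis by (simp add: r_def)
qed

text \<open>
  The witness is the projection of the minimizer of \<open>t \<mapsto> sqn (h + t g) + \<epsilon>\<^sup>2 (1 + t\<^sup>2)\<close>, and the
  first-order condition makes it almost orthogonal to \<open>g\<close>.
\<close>

lemma reg_almost_feasible:
  assumes \<epsilon>: "0 < \<epsilon>"
  obtains y where "y \<in> C" "(ip n g y)\<^sup>2 \<le> \<epsilon>\<^sup>2 * reg \<epsilon> h g" "ip n y y \<le> reg \<epsilon> h g"
    "reg \<epsilon> h g - \<epsilon>\<^sup>2 \<le> 2 * ip n h y - ip n y y"
proof -
  define f where "f = supp_reg \<epsilon> h g"
  interpret F: support_fun_C1 f "\<lambda>x. turn x h g / f x"
    unfolding f_def by (rule supp_reg_support_fun[OF \<epsilon>])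
  obtain \<theta> where t: "0 < cos (\<theta> - 0)" "rad f 0 = f \<theta> / cos (\<theta> - 0)"
    "\<And>x. cos (x - 0) / f x \<le> cos (\<theta> - 0) / f \<theta>"
    using F.rad_attained by metis
  define p where "p = proj (rotv \<theta> h g)"
  define c where "c = cos \<theta>"
  define s where "s = sin \<theta>"
  define q where "q = ip n p p"
  have c0: "0 < c" using t by (simp add: c_def)
  have cs: "s\<^sup>2 + c\<^sup>2 = 1" by (simp add: c_def s_def)
  have f0: "0 < f \<theta>" by (rule F.pos)
  have f2: "(f \<theta>)\<^sup>2 = q + \<epsilon>\<^sup>2" by (simp add: f_def supp_reg_square q_def p_def sqn_def)
  \<comment> \<open>The ratio is maximal at \<open>\<theta>\<close>; setting its derivative to 0
    determines <rotd, p>, and <rotv, p> = |p|^2 is known. These two numbers give the components of p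
    along h and g.\<close>
  have "((\<lambda>x. cos x / f x) has_real_derivative
      (- sin \<theta> * f \<theta> - cos \<theta> * (ip n (rotd \<theta> h g) p / f \<theta>)) / (f \<theta> * f \<theta>)) (at \<theta>)"
    unfolding p_def using f0 by (intro DERIV_divide DERIV_cos F.f') simp
  from DERIV_local_max[OF this zero_less_one] t(3)
  have "(- sin \<theta> * f \<theta> - cos \<theta> * (ip n (rotd \<theta> h g) p / f \<theta>)) / (f \<theta> * f \<theta>) = 0" by simp
  then have "s * f \<theta> + c * (ip n (rotd \<theta> h g) p / f \<theta>) = 0" using f0 by (simp add: c_def s_def)
  then have "s * (f \<theta>)\<^sup>2 + c * ip n (rotd \<theta> h g) p = 0" using f0 by (simp add: field_simps power2_eq_square)
  then have d: "c * ip n (rotd \<theta> h g) p = - s * (q + \<epsilon>\<^sup>2)" using f2 by simp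
  have e: "ip n (rotv \<theta> h g) p = q" using ip_proj_self by (simp add: p_def q_def)
  have hp: "c * ip n h p = q + s\<^sup>2 * \<epsilon>\<^sup>2"
  proof -
    have hp0: "ip n h p = c * ip n (rotv \<theta> h g) p - s * ip n (rotd \<theta> h g) p"
      using arg_cong[OF rotv_split[of 0 h g \<theta>], of "\<lambda>v. ip n v p"]
      by (simp add: ip_add_left ip_diff_left ip_scaleR_left c_def s_def)
    have "c * ip n h p = c\<^sup>2 * q - s * (c * ip n (rotd \<theta> h g) p)"
      unfolding hp0 e by (simp add: algebra_simps power2_eq_square)
    also have "\<dots> = (s\<^sup>2 + c\<^sup>2) * q + s\<^sup>2 * \<epsilon>\<^sup>2" unfolding d by (simp add: algebra_simps power2_eq_square)
    finally show ?thesis by (simp add: cs)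
  qed
  \<comment> \<open>Rotating back, the contributions of |p|^2 cancel and only the regularization is
    left along g.\<close>
  have gp: "ip n g p = - s * \<epsilon>\<^sup>2"
  proof -
    have "(s\<^sup>2 + c\<^sup>2) * ip n g p = s * ip n (rotv \<theta> h g) p + c * ip n (rotd \<theta> h g) p"
      by (simp add: rotd_eq rotv_def[of \<theta>] c_def[symmetric] s_def[symmetric] ip_add_left
          ip_diff_left ip_scaleR_left algebra_simps power2_eq_square)
    then have "ip n g p = s * ip n (rotv \<theta> h g) p + c * ip n (rotd \<theta> h g) p"
      by (simp add: cs)
    then show ?thesis unfolding d e by (simp add: algebra_simps)
  qed
  have reg: "reg \<epsilon> h g = (q + \<epsilon>\<^sup>2) / c\<^sup>2"
    using t(2) f2 by (simp add: reg_def f_def[symmetric] power_divide c_def)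
  have q0: "0 \<le> q" by (simp add: q_def)
  \<comment> \<open>By homogeneity of the projection this is the projection of h + tan \<theta>
    g.\<close>
  define y where "y = (1 / c) *\<^sub>R p"
  show thesis
  proof (rule that[of y])
    show "y \<in> C" unfolding y_def using c0 by (intro scaleR_C) (auto simp: p_def proj_in)
    have yy: "ip n y y = q / c\<^sup>2" by (simp add: y_def ip_bilinear q_def power2_eq_square)
    then show "ip n y y \<le> reg \<epsilon> h g" unfolding reg by (simp add: divide_right_mono)
    have s1: "s\<^sup>2 \<le> 1" using cs zero_le_power2[of c] by linarith
    have "(ip n g y)\<^sup>2 = s\<^sup>2 * \<epsilon>\<^sup>2 * \<epsilon>\<^sup>2 / c\<^sup>2"
      by (simp add: y_def ip_bilinear gp power_divide power_mult_distrib power2_eq_square)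
    also have "\<dots> \<le> 1 * \<epsilon>\<^sup>2 * (q + \<epsilon>\<^sup>2) / c\<^sup>2"
      using s1 q0 by (intro divide_right_mono mult_mono) auto
    finally show "(ip n g y)\<^sup>2 \<le> \<epsilon>\<^sup>2 * reg \<epsilon> h g" by (simp add: reg)
    have "ip n h y = (q + s\<^sup>2 * \<epsilon>\<^sup>2) / c\<^sup>2"
      using hp c0 by (simp add: y_def ip_bilinear field_simps power2_eq_square)
    then have "2 * ip n h y - ip n y y = (q + 2 * s\<^sup>2 * \<epsilon>\<^sup>2) / c\<^sup>2"
      unfolding yy by (simp add: diff_divide_distrib[symmetric])
    moreover have "(q + 2 * s\<^sup>2 * \<epsilon>\<^sup>2) / c\<^sup>2 - (reg \<epsilon> h g - \<epsilon>\<^sup>2) = (2 * s\<^sup>2 * \<epsilon>\<^sup>2 - \<epsilon>\<^sup>2 + c\<^sup>2 * \<epsilon>\<^sup>2) / c\<^sup>2"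
      unfolding reg using c0 by (simp add: field_simps)
    moreover have "2 * s\<^sup>2 * \<epsilon>\<^sup>2 - \<epsilon>\<^sup>2 + c\<^sup>2 * \<epsilon>\<^sup>2 = s\<^sup>2 * \<epsilon>\<^sup>2 + (s\<^sup>2 + c\<^sup>2 - 1) * \<epsilon>\<^sup>2"
      by (simp add: algebra_simps)
    ultimately show "reg \<epsilon> h g - \<epsilon>\<^sup>2 \<le> 2 * ip n h y - ip n y y"
      by (simp add: cs) (smt (verit) divide_nonneg_nonneg mult_nonneg_nonneg zero_le_power2)
  qed
qed

lemma reg_mono:
  assumes "0 < \<epsilon>" "\<epsilon> \<le> \<epsilon>'" shows "reg \<epsilon> h g \<le> reg \<epsilon>' h g"
proof -
  have p: "periodic_pos (supp_reg \<epsilon> h g)" "periodic_pos (supp_reg \<epsilon>' h g)"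
    using supp_reg_support_fun[of \<epsilon> h g] supp_reg_support_fun[of \<epsilon>' h g] assms
    by (auto simp: support_fun_C1_def support_fun_def)
  have "supp_reg \<epsilon> h g x \<le> 1 * supp_reg \<epsilon>' h g x" for x
    using assms by (simp add: supp_reg_def)
  from rad_mono[OF p this, of 0] show ?thesis
    unfolding reg_def using periodic_pos.rad_pos[OF p(1), of 0] by (intro power_mono) auto
qed

text \<open>Strong duality by compactness. Were \<open>reg\<close> to stay above the section's value
  by \<open>\<eta>\<close>, the almost feasible witnesses would have a limit point in C that is
  orthogonal to g and beats the section's maximum of 2<h,x> - |x|^2. Monotonicity in
  \<open>\<epsilon>\<close> then turns one good index into all later ones.\<close>

lemma reg_tendsto_slice:
  "(\<lambda>k. reg (inverse (real (Suc k))) h g) \<longlonglongrightarrow> sqn_proj n (slice n C g) h"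
proof -
  interpret S: closed_convex_cone n "slice n C g"
    by (rule closed_convex_cone_slice) unfold_locales
  define e where "e k = inverse (real (Suc k))" for k
  have e: "0 < e k" "e k \<le> 1" for k by (auto simp: e_def divide_simps)
  have e0: "e \<longlonglongrightarrow> 0" unfolding e_def by (rule LIMSEQ_inverse_real_of_nat)
  have weak: "S.sqn h \<le> reg (e k) h g" for k by (rule slice_sqn_le_reg[OF e(1)])
  have small: "\<exists>k. reg (e k) h g < S.sqn h + \<eta>" if \<eta>: "0 < \<eta>" for \<eta>
  proof (rule ccontr)
    assume "\<not> ?thesis"
    then have big: "S.sqn h + \<eta> \<le> reg (e k) h g" for k by (meson not_less)
    define R where "R = sqn h + 1"
    have R: "reg (e k) h g \<le> R" for k
    proof -
      have "(e k)\<^sup>2 \<le> 1\<^sup>2" using e[of k] by (intro power_mono) auto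
      then show ?thesis using reg_le[OF e(1), of k h g] by (simp add: R_def)
    qed
    have "\<exists>y. y \<in> C \<and> (ip n g y)\<^sup>2 \<le> (e k)\<^sup>2 * reg (e k) h g \<and> ip n y y \<le> reg (e k) h g
        \<and> reg (e k) h g - (e k)\<^sup>2 \<le> 2 * ip n h y - ip n y y" for k
      by (rule reg_almost_feasible[OF e(1)[of k], of g h]) blast
    then obtain y where y: "\<And>k. y k \<in> C" "\<And>k. (ip n g (y k))\<^sup>2 \<le> (e k)\<^sup>2 * reg (e k) h g"
      "\<And>k. ip n (y k) (y k) \<le> reg (e k) h g"
      "\<And>k. reg (e k) h g - (e k)\<^sup>2 \<le> 2 * ip n h (y k) - ip n (y k) (y k)"
      by metis
    have "seq_compact {x \<in> C. ip n x x \<le> R}"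
      by (rule compact_imp_seq_compact[OF compact_C_bounded])
    moreover have "\<forall>k. y k \<in> {x \<in> C. ip n x x \<le> R}" using y R order_trans by blast
    ultimately obtain l r where l: "l \<in> {x \<in> C. ip n x x \<le> R}" and r: "strict_mono r" and yl: "(y \<circ> r) \<longlonglongrightarrow> l"
      by (rule seq_compactE)
    have lim: "(\<lambda>k. F (y (r k))) \<longlonglongrightarrow> F l" if "continuous_on UNIV F" for F :: "vec \<Rightarrow> real"
      using continuous_on_tendsto_compose[OF that yl] by simp
    have er: "(\<lambda>k. e (r k)) \<longlonglongrightarrow> 0" using LIMSEQ_subseq_LIMSEQ[OF e0 r] by (simp add: o_def)
    have "(ip n g l)\<^sup>2 \<le> 0\<^sup>2 * R"
    proof (rule LIMSEQ_le)
      show "(\<lambda>k. (ip n g (y (r k)))\<^sup>2) \<longlonglongrightarrow> (ip n g l)\<^sup>2"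
        by (rule lim) (intro continuous_intros)
      show "(\<lambda>k. (e (r k))\<^sup>2 * R) \<longlonglongrightarrow> 0\<^sup>2 * R" by (intro tendsto_intros er)
      show "\<exists>N. \<forall>k\<ge>N. (ip n g (y (r k)))\<^sup>2 \<le> (e (r k))\<^sup>2 * R"
        using y(2) R by (meson mult_left_mono order_trans zero_le_power2)
    qed
    then have "l \<in> slice n C g" using l by simp
    then have "2 * ip n h l - ip n l l \<le> S.sqn h" by (rule S.sqn_ge)
    moreover have "S.sqn h + \<eta> - 0\<^sup>2 \<le> 2 * ip n h l - ip n l l"
    proof (rule LIMSEQ_le)
      show "(\<lambda>k. S.sqn h + \<eta> - (e (r k))\<^sup>2) \<longlonglongrightarrow> S.sqn h + \<eta> - 0\<^sup>2" by (intro tendsto_intros er)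
      show "(\<lambda>k. 2 * ip n h (y (r k)) - ip n (y (r k)) (y (r k))) \<longlonglongrightarrow> 2 * ip n h l - ip n l l"
        by (rule lim) (intro continuous_intros)
      show "\<exists>N. \<forall>k\<ge>N. S.sqn h + \<eta> - (e (r k))\<^sup>2 \<le> 2 * ip n h (y (r k)) - ip n (y (r k)) (y (r k))"
        using y(4) big by (smt (verit))
    qed
    ultimately show False using \<eta> by simp
  qed
  have "(\<lambda>k. reg (e k) h g) \<longlonglongrightarrow> S.sqn h"
  proof (rule LIMSEQ_I)
    fix \<eta> :: real assume "0 < \<eta>"
    then obtain k0 where k0: "reg (e k0) h g < S.sqn h + \<eta>" using small by blast
    have "norm (reg (e k) h g - S.sqn h) < \<eta>" if "k0 \<le> k" for k
    proof -
      have "e k \<le> e k0" using that by (simp add: e_def)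
      from reg_mono[OF e(1) this, of h g] weak[of k] k0 show ?thesis by simp
    qed
    then show "\<exists>no. \<forall>k\<ge>no. norm (reg (e k) h g - S.sqn h) < \<eta>" by blast
  qed
  then show ?thesis by (simp add: e_def)
qed

end

section \<open>Sections by several rows, and exact interpolation\<close>

definition kcone :: "nat \<Rightarrow> vec set \<Rightarrow> (nat \<Rightarrow> vec) \<Rightarrow> nat \<Rightarrow> vec set"
  where "kcone n K A j = {x \<in> K. \<forall>i<j. ip n (A i) x = 0}"

lemma kcone_0 [simp]: "kcone n K A 0 = K"
  by (simp add: kcone_def)

text \<open>The section that row j cuts involves the rows below j only, so for independent rows it
  is independent of row j.\<close>

lemma kcone_Suc: "kcone n K A (Suc j) = slice n (kcone n K A j) (A j)"
  by (auto simp: kcone_def less_Suc_eq)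

lemma kcone_cong: "(\<And>i. i < j \<Longrightarrow> A i = B i) \<Longrightarrow> kcone n K A j = kcone n K B j"
  by (auto simp: kcone_def)

lemma kcone_scaleR: "c \<noteq> 0 \<Longrightarrow> kcone n K (\<lambda>i. c *\<^sub>R A i) j = kcone n K A j"
  by (auto simp: kcone_def ip_bilinear)

lemma closed_convex_cone_kcone: "closed_convex_cone n K \<Longrightarrow> closed_convex_cone n (kcone n K A j)"
  by (induction j) (auto simp: kcone_Suc intro: closed_convex_cone_slice)

lemma mat_vec_eq_ip: "mat_vec n A x i = ip n (A i) x"
  by (simp add: mat_vec_def ip_def)

context closed_convex_cone
begin

text \<open>Equations are solved one at a time. A correction taken from the section by the previous
  rows leaves the solved equations intact, and since row k takes both signs there, scaling reaches
  any residual d.\<close>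

lemma rows_surjective:
  assumes "\<And>j. j < m \<Longrightarrow> 0 < sqn_proj n (kcone n C A j) (A j)"
    and "\<And>j. j < m \<Longrightarrow> 0 < sqn_proj n (kcone n C A j) (- A j)"
  obtains x where "x \<in> C" "\<And>i. i < m \<Longrightarrow> ip n (A i) x = y i"
proof -
  have "k \<le> m \<Longrightarrow> \<exists>x\<in>C. \<forall>i<k. ip n (A i) x = y i" for k
  proof (induction k)
    case 0
    then show ?case using zero_C by auto
  next
    case (Suc k)
    then obtain x where x: "x \<in> C" "\<And>i. i < k \<Longrightarrow> ip n (A i) x = y i" by auto
    interpret k: closed_convex_cone n "kcone n C A k"
      by (rule closed_convex_cone_kcone) unfold_locales
    obtain u where u: "u \<in> kcone n C A k" "0 < ip n (A k) u"
      using assms(1)[of k] Suc.prems k.sqn_pos_iff by auto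
    obtain v where v: "v \<in> kcone n C A k" "0 < ip n (- A k) v"
      using assms(2)[of k] Suc.prems k.sqn_pos_iff by auto
    define d where "d = y k - ip n (A k) x"
    have "\<exists>w\<in>kcone n C A k. ip n (A k) w = d"
    proof (cases "0 \<le> d")
      case True
      then have "(d / ip n (A k) u) *\<^sub>R u \<in> kcone n C A k" using u by (intro k.scaleR_C) auto
      then show ?thesis using u by (intro bexI[of _ "(d / ip n (A k) u) *\<^sub>R u"]) (auto simp: ip_bilinear)
    next
      case False
      then have "(d / ip n (A k) v) *\<^sub>R v \<in> kcone n C A k"
        using v by (intro k.scaleR_C) (auto simp: ip_bilinear divide_nonpos_neg)
      then show ?thesis using v by (intro bexI[of _ "(d / ip n (A k) v) *\<^sub>R v"]) (auto simp: ip_bilinear)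
    qed
    then obtain w where w: "w \<in> kcone n C A k" "ip n (A k) w = d" by blast
    have "x + w \<in> C" using x w by (intro add_C) (auto simp: kcone_def)
    moreover have "ip n (A i) (x + w) = y i" if "i < Suc k" for i
      using that x w by (cases "i = k") (auto simp: ip_bilinear d_def kcone_def)
    ultimately show ?case by blast
  qed
  then show thesis using that by blast
qed

text \<open>A point x of C with zero residual plus any nonnegative multiple of a kernel vector v in
  C again has zero residual. The minimizers therefore contain a ray, along which the distance to any
  \<open>\<mu>\<^sub>0\<close> is unbounded.\<close>

lemma least_squares_unbounded:
  assumes surj: "\<And>j. j < m \<Longrightarrow> 0 < sqn_proj n (kcone n C A j) (A j)"
     "\<And>j. j < m \<Longrightarrow> 0 < sqn_proj n (kcone n C A j) (- A j)"
    and ker: "0 < sqn_proj n (kcone n C A m) h"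
  shows "(SUP \<mu> \<in> least_squares m n A y C. ereal ((L2_set (\<mu> - \<mu>\<^sub>0) {..<n})\<^sup>2 / real n)) = \<infinity>"
proof (rule SUP_PInfty)
  fix b :: nat
  interpret k: closed_convex_cone n "kcone n C A m"
    by (rule closed_convex_cone_kcone) unfold_locales
  obtain x where x: "x \<in> C" "\<And>i. i < m \<Longrightarrow> ip n (A i) x = y i"
    using rows_surjective[OF surj] by blast
  obtain v where v: "v \<in> kcone n C A m" "0 < ip n h v" using ker k.sqn_pos_iff by auto
  define a where "a = ip n v v"
  have "0 < \<bar>ip n h v\<bar>" using v by simp
  then have "a \<noteq> 0" using ip_Cauchy_Schwarz[of n h v] by (auto simp: a_def)
  then have "0 < a" using ip_self_nonneg[of n v] unfolding a_def by linarith
  then have n0: "0 < n" by (cases n) (auto simp: a_def ip_def)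
  define p where "p = x - \<mu>\<^sub>0"
  \<comment> \<open>Solves t^2 a / 2 - |p|^2 = n b, where the left side bounds |p + t v|^2 from
    below because |2 p + t v|^2 \<ge> 0.\<close>
  define t where "t = sqrt (2 * (real n * real b + ip n p p) / a)"
  have t: "0 \<le> t" "t\<^sup>2 * a / 2 = real n * real b + ip n p p"
    using \<open>0 < a\<close> by (auto simp: t_def)
  define \<mu> where "\<mu> = x + t *\<^sub>R v"
  have \<mu>: "\<mu> \<in> C" "\<And>i. i < m \<Longrightarrow> mat_vec n A \<mu> i = y i"
    using x v t by (auto simp: \<mu>_def kcone_def mat_vec_eq_ip ip_bilinear intro!: add_C scaleR_C)
  have "\<mu> \<in> least_squares m n A y C"
  proof -
    have "L2_set (y - mat_vec n A \<mu>) {..<m} = 0"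
      using \<mu>(2) by (auto simp: L2_set_def intro!: sum.neutral)
    then show ?thesis using \<mu>(1) by (auto simp: least_squares_def is_arg_min_linorder)
  qed
  moreover have "real b \<le> (L2_set (\<mu> - \<mu>\<^sub>0) {..<n})\<^sup>2 / real n"
  proof -
    have eq: "\<mu> - \<mu>\<^sub>0 = p + t *\<^sub>R v" by (simp add: \<mu>_def p_def)
    have "0 \<le> ip n (2 *\<^sub>R p + t *\<^sub>R v) (2 *\<^sub>R p + t *\<^sub>R v)" by simp
    then have "t\<^sup>2 * a / 2 \<le> ip n (p + t *\<^sub>R v) (p + t *\<^sub>R v) + ip n p p"
      by (simp add: ip_bilinear ip_commute[of n v p] a_def power2_eq_square algebra_simps)
    then have "real n * real b \<le> ip n (p + t *\<^sub>R v) (p + t *\<^sub>R v)" using t by simp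
    then show ?thesis using n0 unfolding eq by (simp add: L2_set_eq_sqrt_ip field_simps)
  qed
  ultimately show "\<exists>\<mu>\<in>least_squares m n A y C. ereal (real b) \<le> ereal ((L2_set (\<mu> - \<mu>\<^sub>0) {..<n})\<^sup>2 / real n)"
    by auto
qed

end

subsection \<open>Rotation invariance of Gaussian pairs\<close>

abbreviation gauss :: "real measure" where "gauss \<equiv> density lborel std_normal_density"

lemma prob_space_gauss: "prob_space gauss"
  by (rule prob_space_normal_density) simp

interpretation gauss: prob_space gauss
  by (rule prob_space_gauss)

interpretation gauss_PiM: product_prob_space "\<lambda>_::nat. gauss" I for I
  by unfold_locales

lemma gauss_moment:
  "integrable gauss (\<lambda>x. x ^ k)"
  "integral\<^sup>L gauss (\<lambda>x. x ^ k) = (\<integral>x. std_normal_density x * x ^ k \<partial>lborel)"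
  using integrable_std_normal_moment[of k] by (simp_all add: integrable_density integral_density)

lemma gauss_first_moments:
  "integral\<^sup>L gauss (\<lambda>x. x) = 0" "integral\<^sup>L gauss (\<lambda>x. x\<^sup>2) = 1"
proof -
  show "integral\<^sup>L gauss (\<lambda>x. x) = 0"
    using gauss_moment(2)[of 1] integral_std_normal_moment_odd[of 0] by simp
  show "integral\<^sup>L gauss (\<lambda>x. x\<^sup>2) = 1"
    using gauss_moment(2)[of 2] integral_std_normal_moment_even[of 1] by simp
qed

lemma nn_integral_gauss:
  "f \<in> borel_measurable borel \<Longrightarrow> (\<integral>\<^sup>+x. f x \<partial>gauss) = (\<integral>\<^sup>+x. ennreal (std_normal_density x) * f x \<partial>lborel)"
  by (simp add: nn_integral_density)

text \<open>Two affine substitutions in one variable, first x at fixed y and then y at fixed u, have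
  the Jacobians 1/|c| and |c|, which cancel. Dividing by c excludes the quarter turns at this
  stage.\<close>

lemma nn_integral_lborel_rotation:
  fixes c s :: real and F :: "real \<times> real \<Rightarrow> ennreal"
  assumes [measurable]: "F \<in> borel_measurable (borel \<Otimes>\<^sub>M borel)" and cs: "c\<^sup>2 + s\<^sup>2 = 1" and c: "c \<noteq> 0"
  shows "(\<integral>\<^sup>+x. \<integral>\<^sup>+y. F (c * x + s * y, - s * x + c * y) \<partial>lborel \<partial>lborel) = (\<integral>\<^sup>+x. \<integral>\<^sup>+y. F (x, y) \<partial>lborel \<partial>lborel)"
proof -
  have cancel: "ennreal (1 / \<bar>c\<bar>) * (ennreal \<bar>c\<bar> * a) = a" for a
    using c by (simp add: mult.assoc[symmetric] ennreal_mult'[symmetric])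
  have "(\<integral>\<^sup>+x. \<integral>\<^sup>+y. F (c * x + s * y, - s * x + c * y) \<partial>lborel \<partial>lborel)
      = (\<integral>\<^sup>+y. \<integral>\<^sup>+x. F (c * x + s * y, - s * x + c * y) \<partial>lborel \<partial>lborel)"
    by (rule lborel_pair.Fubini') measurable
  also have "\<dots> = (\<integral>\<^sup>+y. \<integral>\<^sup>+u. ennreal \<bar>1 / c\<bar> * F (u, (y - s * u) / c) \<partial>lborel \<partial>lborel)"
  proof (rule nn_integral_cong)
    fix y :: real
    have "(\<integral>\<^sup>+x. F (c * x + s * y, - s * x + c * y) \<partial>lborel)
       = ennreal \<bar>1 / c\<bar> * (\<integral>\<^sup>+u. F (c * (- s * y / c + 1 / c * u) + s * y, - s * (- s * y / c + 1 / c * u) + c * y) \<partial>lborel)"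
      using c by (intro nn_integral_real_affine) auto
    also have "\<dots> = ennreal \<bar>1 / c\<bar> * (\<integral>\<^sup>+u. F (u, (y - s * u) / c) \<partial>lborel)"
    proof -
      have "c * (- s * y / c + 1 / c * u) + s * y = u" for u using c by (simp add: field_simps)
      moreover have "- s * (- s * y / c + 1 / c * u) + c * y = (y - s * u) / c" for u
      proof -
        have "- s * (- s * y / c + 1 / c * u) + c * y = ((c\<^sup>2 + s\<^sup>2) * y - s * u) / c"
          using c by (simp add: field_simps power2_eq_square)
        then show ?thesis by (simp add: cs)
      qed
      ultimately show ?thesis by simp
    qed
    finally show "(\<integral>\<^sup>+x. F (c * x + s * y, - s * x + c * y) \<partial>lborel) = (\<integral>\<^sup>+u. ennreal \<bar>1 / c\<bar> * F (u, (y - s * u) / c) \<partial>lborel)"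
      by (simp add: nn_integral_cmult)
  qed
  also have "\<dots> = (\<integral>\<^sup>+u. \<integral>\<^sup>+y. ennreal \<bar>1 / c\<bar> * F (u, (y - s * u) / c) \<partial>lborel \<partial>lborel)"
    by (rule lborel_pair.Fubini') measurable
  also have "\<dots> = (\<integral>\<^sup>+u. \<integral>\<^sup>+v. F (u, v) \<partial>lborel \<partial>lborel)"
  proof (rule nn_integral_cong)
    fix u :: real
    have "(\<integral>\<^sup>+y. ennreal \<bar>1 / c\<bar> * F (u, (y - s * u) / c) \<partial>lborel)
       = ennreal \<bar>1 / c\<bar> * (\<integral>\<^sup>+y. F (u, (y - s * u) / c) \<partial>lborel)"
      by (simp add: nn_integral_cmult)
    also have "(\<integral>\<^sup>+y. F (u, (y - s * u) / c) \<partial>lborel) = ennreal \<bar>c\<bar> * (\<integral>\<^sup>+v. F (u, (s * u + c * v - s * u) / c) \<partial>lborel)"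
      using c by (intro nn_integral_real_affine) auto
    finally show "(\<integral>\<^sup>+y. ennreal \<bar>1 / c\<bar> * F (u, (y - s * u) / c) \<partial>lborel) = (\<integral>\<^sup>+v. F (u, v) \<partial>lborel)"
      using c by (simp add: cancel)
  qed
  finally show ?thesis .
qed

lemma nn_integral_gauss_rotation:
  fixes c s :: real and F :: "real \<times> real \<Rightarrow> ennreal"
  assumes [measurable]: "F \<in> borel_measurable (borel \<Otimes>\<^sub>M borel)" and cs: "c\<^sup>2 + s\<^sup>2 = 1" and c: "c \<noteq> 0"
  shows "(\<integral>\<^sup>+x. \<integral>\<^sup>+y. F (c * x + s * y, - s * x + c * y) \<partial>gauss \<partial>gauss) = (\<integral>\<^sup>+x. \<integral>\<^sup>+y. F (x, y) \<partial>gauss \<partial>gauss)"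
proof -
  let ?d = "\<lambda>x y. ennreal (std_normal_density x * std_normal_density y)"
  have nest: "(\<integral>\<^sup>+x. \<integral>\<^sup>+y. G (x, y) \<partial>gauss \<partial>gauss) = (\<integral>\<^sup>+x. \<integral>\<^sup>+y. ?d x y * G (x, y) \<partial>lborel \<partial>lborel)"
    if [measurable]: "G \<in> borel_measurable (borel \<Otimes>\<^sub>M borel)" for G :: "real \<times> real \<Rightarrow> ennreal"
    by (simp add: nn_integral_gauss nn_integral_cmult[symmetric] ennreal_mult' mult.assoc)
  have inv: "std_normal_density (c * x + s * y) * std_normal_density (- s * x + c * y)
     = std_normal_density x * std_normal_density y" for x y
  proof -
    have "(c * x + s * y)\<^sup>2 + (- s * x + c * y)\<^sup>2 = (c\<^sup>2 + s\<^sup>2) * (x\<^sup>2 + y\<^sup>2)"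
      by (simp add: algebra_simps power2_eq_square)
    then have "- (c * x + s * y)\<^sup>2 / 2 + - (- s * x + c * y)\<^sup>2 / 2 = - x\<^sup>2 / 2 + - y\<^sup>2 / 2"
      using cs by simp
    then show ?thesis by (simp add: std_normal_density_def exp_add[symmetric] mult.assoc mult.left_commute)
  qed
  have "(\<integral>\<^sup>+x. \<integral>\<^sup>+y. F (c * x + s * y, - s * x + c * y) \<partial>gauss \<partial>gauss)
     = (\<integral>\<^sup>+x. \<integral>\<^sup>+y. ?d x y * F (c * x + s * y, - s * x + c * y) \<partial>lborel \<partial>lborel)"
    using nest[of "\<lambda>(x, y). F (c * x + s * y, - s * x + c * y)"] by simp
  also have "\<dots> = (\<integral>\<^sup>+x. \<integral>\<^sup>+y. (case (c * x + s * y, - s * x + c * y) of (u, v) \<Rightarrow> ?d u v * F (u, v)) \<partial>lborel \<partial>lborel)"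
    by (simp only: split inv)
  also have "\<dots> = (\<integral>\<^sup>+x. \<integral>\<^sup>+y. (case (x, y) of (u, v) \<Rightarrow> ?d u v * F (u, v)) \<partial>lborel \<partial>lborel)"
    by (rule nn_integral_lborel_rotation[OF _ cs c]) measurable
  also have "\<dots> = (\<integral>\<^sup>+x. \<integral>\<^sup>+y. F (x, y) \<partial>gauss \<partial>gauss)"
    by (simp add: nest)
  finally show ?thesis .
qed

section \<open>Rotations of pairs of Gaussian vectors\<close>

definition rot_pair :: "nat set \<Rightarrow> real \<Rightarrow> real \<Rightarrow> vec \<times> vec \<Rightarrow> vec \<times> vec"
  where "rot_pair I c s = (\<lambda>(h, g). (\<lambda>i\<in>I. c * h i + s * g i, \<lambda>i\<in>I. - s * h i + c * g i))"

abbreviation gaussn :: "nat set \<Rightarrow> vec measure" where "gaussn I \<equiv> PiM I (\<lambda>_. gauss)"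

lemma sets_gaussn: "sets (gaussn I) = sets (PiM I (\<lambda>_. borel))"
  by (rule sets_PiM_cong) auto

lemma measurable_rot_pair [measurable]:
  "rot_pair I c s \<in> gaussn I \<Otimes>\<^sub>M gaussn I \<rightarrow>\<^sub>M gaussn I \<Otimes>\<^sub>M gaussn I"
  unfolding rot_pair_def by measurable

text \<open>Induction over the coordinates: Tonelli moves the i-th coordinates of both vectors to
  the innermost place, where the planar invariance applies, while the rest is handled by the
  induction hypothesis for G.\<close>

lemma nn_integral_gaussn_rotation:
  assumes "finite I" and F: "F \<in> borel_measurable (gaussn I \<Otimes>\<^sub>M gaussn I)"
    and cs: "c\<^sup>2 + s\<^sup>2 = 1" and c: "c \<noteq> 0"
  shows "(\<integral>\<^sup>+h. \<integral>\<^sup>+g. F (rot_pair I c s (h, g)) \<partial>gaussn I \<partial>gaussn I) = (\<integral>\<^sup>+h. \<integral>\<^sup>+g. (F (h, g) :: ennreal) \<partial>gaussn I \<partial>gaussn I)"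
  using assms(1) F
proof (induction I arbitrary: F rule: finite_induct)
  case empty
  have *: "F (rot_pair {} c s (h, g)) = F (h, g)" if "h \<in> space (gaussn {})" "g \<in> space (gaussn {})" for h g
    using that by (auto simp: space_PiM rot_pair_def restrict_def)
  show ?case by (intro nn_integral_cong) (simp add: *)
next
  case (insert i I)
  note [measurable] = insert.prems
  interpret GI: prob_space "gaussn I" by (intro prob_space_PiM prob_space_gauss)
  interpret P: pair_sigma_finite "gaussn I" gauss by unfold_locales
  have split: "(\<integral>\<^sup>+h. \<integral>\<^sup>+g. F (h, g) \<partial>gaussn (insert i I) \<partial>gaussn (insert i I))
     = (\<integral>\<^sup>+h. \<integral>\<^sup>+g. \<integral>\<^sup>+x. \<integral>\<^sup>+y. F (h(i := x), g(i := y)) \<partial>gauss \<partial>gauss \<partial>gaussn I \<partial>gaussn I)"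
    if [measurable]: "F \<in> borel_measurable (gaussn (insert i I) \<Otimes>\<^sub>M gaussn (insert i I))" for F :: "_ \<Rightarrow> ennreal"
  proof -
    have "(\<integral>\<^sup>+h. \<integral>\<^sup>+g. F (h, g) \<partial>gaussn (insert i I) \<partial>gaussn (insert i I))
      = (\<integral>\<^sup>+h. \<integral>\<^sup>+x. \<integral>\<^sup>+g. F (h(i := x), g) \<partial>gaussn (insert i I) \<partial>gauss \<partial>gaussn I)"
      using insert.hyps by (intro gauss_PiM.product_nn_integral_insert) auto
    also have "\<dots> = (\<integral>\<^sup>+h. \<integral>\<^sup>+x. \<integral>\<^sup>+g. \<integral>\<^sup>+y. F (h(i := x), g(i := y)) \<partial>gauss \<partial>gaussn I \<partial>gauss \<partial>gaussn I)"
      using insert.hyps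
      by (intro nn_integral_cong gauss_PiM.product_nn_integral_insert) (auto simp: space_PiM PiE_def extensional_def intro!: measurable_compose[OF _ that] measurable_Pair1')
    also have "\<dots> = (\<integral>\<^sup>+h. \<integral>\<^sup>+g. \<integral>\<^sup>+x. \<integral>\<^sup>+y. F (h(i := x), g(i := y)) \<partial>gauss \<partial>gauss \<partial>gaussn I \<partial>gaussn I)"
      by (intro nn_integral_cong P.Fubini') measurable
    finally show ?thesis .
  qed
  have rot_insert: "rot_pair (insert i I) c s (h(i := x), g(i := y))
    = ((fst (rot_pair I c s (h, g)))(i := c * x + s * y), (snd (rot_pair I c s (h, g)))(i := - s * x + c * y))" for h g x y
    using insert.hyps by (auto simp: rot_pair_def fun_eq_iff restrict_def)
  define G where "G = (\<lambda>(h, g). \<integral>\<^sup>+x. \<integral>\<^sup>+y. F (h(i := x), g(i := y)) \<partial>gauss \<partial>gauss)"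
  have [measurable]: "G \<in> borel_measurable (gaussn I \<Otimes>\<^sub>M gaussn I)"
    unfolding G_def by measurable
  have "(\<integral>\<^sup>+h. \<integral>\<^sup>+g. F (rot_pair (insert i I) c s (h, g)) \<partial>gaussn (insert i I) \<partial>gaussn (insert i I))
     = (\<integral>\<^sup>+h. \<integral>\<^sup>+g. \<integral>\<^sup>+x. \<integral>\<^sup>+y. F (rot_pair (insert i I) c s (h(i := x), g(i := y))) \<partial>gauss \<partial>gauss \<partial>gaussn I \<partial>gaussn I)"
    by (rule split) measurable
  also have "\<dots> = (\<integral>\<^sup>+h. \<integral>\<^sup>+g. G (rot_pair I c s (h, g)) \<partial>gaussn I \<partial>gaussn I)"
  proof (intro nn_integral_cong)
    fix h g assume hg: "h \<in> space (gaussn I)" "g \<in> space (gaussn I)"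
    obtain H K where HK: "rot_pair I c s (h, g) = (H, K)" by fastforce
    then have HK_sp: "H \<in> space (gaussn I)" "K \<in> space (gaussn I)"
      using measurable_space[OF measurable_rot_pair, of "(h, g)" I c s] hg by (auto simp: space_pair_measure)
    have [measurable]: "(\<lambda>x. H(i := x)) \<in> borel \<rightarrow>\<^sub>M gaussn (insert i I)" "(\<lambda>x. K(i := x)) \<in> borel \<rightarrow>\<^sub>M gaussn (insert i I)"
      using measurable_component_update[OF HK_sp(1) insert.hyps(2)] measurable_component_update[OF HK_sp(2) insert.hyps(2)]
      by auto
    have "(\<integral>\<^sup>+x. \<integral>\<^sup>+y. (\<lambda>(x, y). F (H(i := x), K(i := y))) (c * x + s * y, - s * x + c * y) \<partial>gauss \<partial>gauss)
      = (\<integral>\<^sup>+x. \<integral>\<^sup>+y. (\<lambda>(x, y). F (H(i := x), K(i := y))) (x, y) \<partial>gauss \<partial>gauss)"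
      by (rule nn_integral_gauss_rotation[OF _ cs c]) measurable
    then show "(\<integral>\<^sup>+x. \<integral>\<^sup>+y. F (rot_pair (insert i I) c s (h(i := x), g(i := y))) \<partial>gauss \<partial>gauss) = G (rot_pair I c s (h, g))"
      by (simp add: rot_insert HK G_def)
  qed
  also have "\<dots> = (\<integral>\<^sup>+h. \<integral>\<^sup>+g. G (h, g) \<partial>gaussn I \<partial>gaussn I)"
    by (rule insert.IH) measurable
  also have "\<dots> = (\<integral>\<^sup>+h. \<integral>\<^sup>+g. F (h, g) \<partial>gaussn (insert i I) \<partial>gaussn (insert i I))"
    by (simp add: split G_def)
  finally show ?case .
qed

lemma distr_rot_pair:
  assumes I: "finite I" and cs: "c\<^sup>2 + s\<^sup>2 = 1" and c: "c \<noteq> 0"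
  shows "distr (gaussn I \<Otimes>\<^sub>M gaussn I) (gaussn I \<Otimes>\<^sub>M gaussn I) (rot_pair I c s) = gaussn I \<Otimes>\<^sub>M gaussn I"
proof (rule measure_eqI)
  have sf: "sigma_finite_measure (gaussn I)"
    by (intro prob_space_imp_sigma_finite prob_space_PiM prob_space_gauss)
  fix A assume "A \<in> sets (distr (gaussn I \<Otimes>\<^sub>M gaussn I) (gaussn I \<Otimes>\<^sub>M gaussn I) (rot_pair I c s))"
  then have [measurable]: "A \<in> sets (gaussn I \<Otimes>\<^sub>M gaussn I)" by simp
  have "emeasure (distr (gaussn I \<Otimes>\<^sub>M gaussn I) (gaussn I \<Otimes>\<^sub>M gaussn I) (rot_pair I c s)) A
      = (\<integral>\<^sup>+w. indicator A (rot_pair I c s w) \<partial>(gaussn I \<Otimes>\<^sub>M gaussn I))"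
    by (simp add: nn_integral_indicator[symmetric] nn_integral_distr del: nn_integral_indicator)
  also have "\<dots> = (\<integral>\<^sup>+h. \<integral>\<^sup>+g. indicator A (rot_pair I c s (h, g)) \<partial>gaussn I \<partial>gaussn I)"
    by (rule sigma_finite_measure.nn_integral_fst[OF sf, symmetric]) measurable
  also have "\<dots> = (\<integral>\<^sup>+h. \<integral>\<^sup>+g. indicator A (h, g) \<partial>gaussn I \<partial>gaussn I)"
    by (rule nn_integral_gaussn_rotation[OF I _ cs c]) measurable
  also have "\<dots> = (\<integral>\<^sup>+w. indicator A w \<partial>(gaussn I \<Otimes>\<^sub>M gaussn I))"
    by (rule sigma_finite_measure.nn_integral_fst[OF sf]) measurable
  finally show "emeasure (distr (gaussn I \<Otimes>\<^sub>M gaussn I) (gaussn I \<Otimes>\<^sub>M gaussn I) (rot_pair I c s)) A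
      = emeasure (gaussn I \<Otimes>\<^sub>M gaussn I) A" by simp
qed simp

abbreviation std2 :: "nat \<Rightarrow> (vec \<times> vec) measure"
  where "std2 n \<equiv> std_gaussian n \<Otimes>\<^sub>M std_gaussian n"

definition rotp :: "nat \<Rightarrow> real \<Rightarrow> vec \<times> vec \<Rightarrow> vec \<times> vec"
  where "rotp n \<psi> = rot_pair {..<n} (cos \<psi>) (sin \<psi>)"

lemma rotp_eq: "rotp n \<psi> (h, g) = (restrict (rotv \<psi> h g) {..<n}, restrict (rotd \<psi> h g) {..<n})"
  unfolding rotd_eq by (simp add: rotp_def rot_pair_def rotv_def scaleR_fun_def plus_fun_def)

lemma prob_space_std_gaussian: "prob_space (std_gaussian n)"
  unfolding std_gaussian_def by (intro prob_space_PiM prob_space_gauss)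

lemma sets_std_gaussian [measurable_cong]: "sets (std_gaussian n) = sets (PiM {..<n} (\<lambda>_. borel))"
  unfolding std_gaussian_def by (rule sets_gaussn)

lemma measurable_rotp:
  "(\<lambda>(w, \<psi>). rotp n \<psi> w) \<in> std2 n \<Otimes>\<^sub>M borel \<rightarrow>\<^sub>M std2 n"
  unfolding rotp_def rot_pair_def std_gaussian_def by measurable

lemma measurable_rotp1 [measurable]: "rotp n \<psi> \<in> std2 n \<rightarrow>\<^sub>M std2 n"
  unfolding rotp_def std_gaussian_def by (rule measurable_rot_pair)

lemma distr_rotp: "distr (std2 n) (std2 n) (rotp n \<psi>) = std2 n"
proof (cases "cos \<psi> = 0")
  case False
  then show ?thesis unfolding std_gaussian_def rotp_def by (intro distr_rot_pair) auto
next
  case True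
  \<comment> \<open>An odd multiple of a quarter turn is done as two rotations by half the angle,
    whose cosine does not vanish.\<close>
  have c: "cos (\<psi> / 2) \<noteq> 0"
  proof
    assume "cos (\<psi> / 2) = 0"
    then have "cos \<psi> = -1" using cos_double_cos[of "\<psi> / 2"] by simp
    then show False using True by simp
  qed
  have half: "distr (std2 n) (std2 n) (rotp n (\<psi> / 2)) = std2 n"
    using c unfolding std_gaussian_def rotp_def by (intro distr_rot_pair) auto
  have comp: "rotp n \<psi> w = (rotp n (\<psi> / 2) \<circ> rotp n (\<psi> / 2)) w" for w
  proof (cases w)
    case (Pair h g)
    have cd: "cos \<psi> = cos (\<psi>/2) * cos (\<psi>/2) - sin (\<psi>/2) * sin (\<psi>/2)" "sin \<psi> = 2 * (sin (\<psi>/2) * cos (\<psi>/2))"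
      using cos_double[of "\<psi> / 2"] sin_double[of "\<psi> / 2"] by (simp_all add: power2_eq_square)
    show ?thesis unfolding Pair o_def rotp_def rot_pair_def cd
      by (auto simp: restrict_def fun_eq_iff algebra_simps)
  qed
  have "distr (std2 n) (std2 n) (rotp n \<psi>) = distr (std2 n) (std2 n) (rotp n (\<psi> / 2) \<circ> rotp n (\<psi> / 2))"
    by (intro distr_cong) (use comp in auto)
  also have "\<dots> = distr (distr (std2 n) (std2 n) (rotp n (\<psi> / 2))) (std2 n) (rotp n (\<psi> / 2))"
    by (rule distr_distr[symmetric]) measurable
  finally show ?thesis by (simp add: half)
qed

section \<open>Averaging over the circle\<close>

definition circle :: "real measure"
  where "circle = density lborel (\<lambda>x. ennreal (indicator {0..2 * pi} x / (2 * pi)))"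

lemma sets_circle [measurable_cong, simp]: "sets circle = sets borel"
  by (simp add: circle_def)

lemma prob_space_circle: "prob_space circle"
proof
  have "emeasure circle (space circle) = (\<integral>\<^sup>+x. ennreal (1 / (2 * pi)) * indicator {0..2 * pi} x \<partial>lborel)"
    unfolding circle_def by (subst emeasure_density) (auto intro!: nn_integral_cong simp: indicator_def)
  also have "\<dots> = ennreal (1 / (2 * pi)) * ennreal (2 * pi)"
    by (simp add: nn_integral_cmult)
  also have "\<dots> = 1" by (simp add: ennreal_mult'[symmetric])
  finally show "emeasure circle (space circle) = 1" .
qed

lemma integral_circle:
  fixes f :: "real \<Rightarrow> real"
  assumes f: "continuous_on UNIV f"
  shows "integral\<^sup>L circle f = integral {0..2 * pi} f / (2 * pi)"
proof -
  have [measurable]: "f \<in> borel_measurable borel" using f by (rule borel_measurable_continuous_onI)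
  have "set_integrable lborel {0..2 * pi} f"
    using f by (intro borel_integrable_atLeastAtMost') (rule continuous_on_subset, auto)
  then have "(LINT x:{0..2 * pi}|lborel. f x) = integral {0..2 * pi} f"
    by (rule set_borel_integral_eq_integral)
  moreover have "integral\<^sup>L circle f = (\<integral>x. (indicator {0..2 * pi} x / (2 * pi)) *\<^sub>R f x \<partial>lborel)"
    unfolding circle_def by (intro integral_density) auto
  ultimately show ?thesis by (simp add: set_lebesgue_integral_def)
qed

text \<open>At each fixed angle the rotation preserves the law of the pair, so the mean does not
  depend on the angle. The rotation invariant majorant B gives the joint integrability in angle and
  pair that Fubini requires.\<close>

lemma rot_average:
  fixes H B :: "vec \<times> vec \<Rightarrow> real"
  assumes H[measurable]: "H \<in> borel_measurable (std2 n)" and B: "integrable (std2 n) B"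
    and HB: "\<And>w. w \<in> space (std2 n) \<Longrightarrow> \<bar>H w\<bar> \<le> B w" and Brot: "\<And>\<psi> w. B (rotp n \<psi> w) = B w"
  shows "integrable (std2 n) (\<lambda>w. \<integral>\<psi>. H (rotp n \<psi> w) \<partial>circle)"
    and "(\<integral>w. \<integral>\<psi>. H (rotp n \<psi> w) \<partial>circle \<partial>std2 n) = integral\<^sup>L (std2 n) H"
proof -
  interpret G: prob_space "std_gaussian n" by (rule prob_space_std_gaussian)
  interpret GG: pair_prob_space "std_gaussian n" "std_gaussian n" ..
  interpret U: prob_space circle by (rule prob_space_circle)
  interpret P: pair_prob_space "std2 n" circle ..
  have meas: "(\<lambda>(w, \<psi>). rotp n \<psi> w) \<in> std2 n \<Otimes>\<^sub>M circle \<rightarrow>\<^sub>M std2 n"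
    using measurable_rotp[of n] measurable_cong_sets[OF sets_pair_measure_cong[OF refl sets_circle] refl] by blast
  have [measurable]: "(\<lambda>(w, \<psi>). H (rotp n \<psi> w)) \<in> borel_measurable (std2 n \<Otimes>\<^sub>M circle)"
    using measurable_compose[OF meas H] by (simp add: split_def)
  have intB: "integrable (std2 n \<Otimes>\<^sub>M circle) (\<lambda>z. B (fst z))"
  proof -
    have "integrable (distr (std2 n \<Otimes>\<^sub>M circle) (std2 n) fst) B"
      using B by (simp add: U.distr_pair_fst)
    then show ?thesis by (rule integrable_distr[rotated]) measurable
  qed
  have int: "integrable (std2 n \<Otimes>\<^sub>M circle) (\<lambda>(w, \<psi>). H (rotp n \<psi> w))"
  proof (rule Bochner_Integration.integrable_bound[OF intB])
    show "AE z in std2 n \<Otimes>\<^sub>M circle. norm (case z of (w, \<psi>) \<Rightarrow> H (rotp n \<psi> w)) \<le> norm (B (fst z))"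
    proof (rule AE_I2)
      fix z assume z: "z \<in> space (std2 n \<Otimes>\<^sub>M circle)"
      then have "rotp n (snd z) (fst z) \<in> space (std2 n)"
        using measurable_space[OF measurable_rotp1] by (auto simp: space_pair_measure[of "std2 n"])
      from HB[OF this] show "norm (case z of (w, \<psi>) \<Rightarrow> H (rotp n \<psi> w)) \<le> norm (B (fst z))"
        by (simp add: Brot split_def)
    qed
  qed measurable
  show "integrable (std2 n) (\<lambda>w. \<integral>\<psi>. H (rotp n \<psi> w) \<partial>circle)"
    using P.integrable_fst'[OF int] by simp
  have "(\<integral>w. \<integral>\<psi>. H (rotp n \<psi> w) \<partial>circle \<partial>std2 n) = (\<integral>\<psi>. \<integral>w. H (rotp n \<psi> w) \<partial>std2 n \<partial>circle)"
    using P.Fubini_integral[OF int] by simp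
  also have "\<dots> = (\<integral>\<psi>. integral\<^sup>L (std2 n) H \<partial>circle)"
  proof (rule Bochner_Integration.integral_cong[OF refl])
    fix \<psi>
    have "integral\<^sup>L (std2 n) H = integral\<^sup>L (distr (std2 n) (std2 n) (rotp n \<psi>)) H" by (simp add: distr_rotp)
    also have "\<dots> = (\<integral>w. H (rotp n \<psi> w) \<partial>std2 n)" by (rule integral_distr) measurable
    finally show "(\<integral>w. H (rotp n \<psi> w) \<partial>std2 n) = integral\<^sup>L (std2 n) H" by simp
  qed
  also have "\<dots> = integral\<^sup>L (std2 n) H" by (simp add: U.prob_space)
  finally show "(\<integral>w. \<integral>\<psi>. H (rotp n \<psi> w) \<partial>circle \<partial>std2 n) = integral\<^sup>L (std2 n) H" .
qed

lemma ip_square_sum_rotp: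
  "ip n (fst (rotp n \<psi> w)) (fst (rotp n \<psi> w)) + ip n (snd (rotp n \<psi> w)) (snd (rotp n \<psi> w))
    = ip n (fst w) (fst w) + ip n (snd w) (snd w)"
proof -
  obtain h g where w: "w = (h, g)" by fastforce
  have "ip n (restrict (rotv \<psi> h g) {..<n}) (restrict (rotv \<psi> h g) {..<n})
     + ip n (restrict (rotd \<psi> h g) {..<n}) (restrict (rotd \<psi> h g) {..<n})
    = ip n (rotv \<psi> h g) (rotv \<psi> h g) + ip n (rotd \<psi> h g) (rotd \<psi> h g)"
    by (intro arg_cong2[where f = "(+)"] ip_cong) auto
  also have "\<dots> = ((sin \<psi>)\<^sup>2 + (cos \<psi>)\<^sup>2) * ip n h h + ((sin \<psi>)\<^sup>2 + (cos \<psi>)\<^sup>2) * ip n g g"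
    unfolding rotd_eq unfolding rotv_def ip_add_left ip_scaleR_left ip_add_right ip_scaleR_right
    by (simp only: power2_eq_square ip_commute[of n g h]) algebra
  finally show ?thesis by (simp add: w rotp_eq)
qed

section \<open>Gaussian moments and a rotation invariant majorant\<close>

lemma gaussn_product_moment:
  fixes a b :: nat
  assumes "finite I" "i \<in> I" "j \<in> I"
  shows "integrable (gaussn I) (\<lambda>x. x i ^ a * x j ^ b)"
    and "i \<noteq> j \<Longrightarrow> (\<integral>x. x i ^ a * x j ^ b \<partial>gaussn I) = (\<integral>x. x ^ a \<partial>gauss) * (\<integral>x. x ^ b \<partial>gauss)"
    and "(\<integral>x. x i ^ a \<partial>gaussn I) = (\<integral>x. x ^ a \<partial>gauss)"
proof -
  define f where "f k = (\<lambda>x::real. (if k = i then x ^ a else 1) * (if k = j then x ^ b else 1))" for k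
  have f: "(\<lambda>x. \<Prod>k\<in>I. f k (x k)) = (\<lambda>x. x i ^ a * x j ^ b)"
    using assms by (simp add: f_def fun_eq_iff prod.distrib prod.delta)
  have fi: "integrable gauss (f k)" for k
    using gauss_moment(1)[of "a + b"] gauss_moment(1)[of a] gauss_moment(1)[of b]
    by (cases "k = i"; cases "k = j") (simp_all add: f_def power_add)
  show "integrable (gaussn I) (\<lambda>x. x i ^ a * x j ^ b)"
    using gauss_PiM.product_integrable_prod[of I f] assms(1) fi by (simp add: f)
  have fint: "integral\<^sup>L gauss (f k) = (if k = i then (\<integral>x. x ^ a \<partial>gauss) else 1) * (if k = j then (\<integral>x. x ^ b \<partial>gauss) else 1)"
    if "i \<noteq> j" for k
    using that gauss.prob_space by (auto simp: f_def)
  show "i \<noteq> j \<Longrightarrow> (\<integral>x. x i ^ a * x j ^ b \<partial>gaussn I) = (\<integral>x. x ^ a \<partial>gauss) * (\<integral>x. x ^ b \<partial>gauss)"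
    using gauss_PiM.product_integral_prod[of I f] fi assms by (simp add: f fint prod.distrib prod.delta)
  have "(\<integral>x. x i ^ a \<partial>gaussn I) = (\<integral>x. x ^ a \<partial>distr (gaussn I) gauss (\<lambda>x. x i))"
    using assms by (subst integral_distr) auto
  then show "(\<integral>x. x i ^ a \<partial>gaussn I) = (\<integral>x. x ^ a \<partial>gauss)"
    using assms distr_PiM_component[of I "\<lambda>_. gauss" i] by (simp add: prob_space_gauss)
qed

lemma std_gaussian_component_moments:
  assumes "i < n" "j < n"
  shows "integrable (std_gaussian n) (\<lambda>x. x i ^ a * x j ^ b)"
    and "(\<integral>x. x i * x j \<partial>std_gaussian n) = (if i = j then 1 else 0)"
  using gaussn_product_moment(1)[where I = "{..<n}" and i = i and j = j and a = a and b = b]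
    gaussn_product_moment(2)[where I = "{..<n}" and i = i and j = j and a = 1 and b = 1]
    gaussn_product_moment(3)[where I = "{..<n}" and i = i and j = i and a = 2] assms gauss_first_moments
  by (auto simp: std_gaussian_def power2_eq_square)

lemma std_gaussian_ip_square:
  "integrable (std_gaussian n) (\<lambda>g. (ip n g x)\<^sup>2)" "(\<integral>g. (ip n g x)\<^sup>2 \<partial>std_gaussian n) = ip n x x"
proof -
  have eq: "(ip n g x)\<^sup>2 = (\<Sum>i<n. \<Sum>j<n. x i * x j * (g i * g j))" for g
    by (simp add: ip_def power2_eq_square sum_product algebra_simps)
  have i: "integrable (std_gaussian n) (\<lambda>g. g i * g j)" if "i < n" "j < n" for i j
    using std_gaussian_component_moments(1)[OF that, of 1 1] by simp
  show "integrable (std_gaussian n) (\<lambda>g. (ip n g x)\<^sup>2)"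
    unfolding eq using i by (intro Bochner_Integration.integrable_sum integrable_mult_right) auto
  have "(\<integral>g. (ip n g x)\<^sup>2 \<partial>std_gaussian n) = (\<Sum>i<n. \<Sum>j<n. x i * x j * (\<integral>g. g i * g j \<partial>std_gaussian n))"
    unfolding eq using i by (subst Bochner_Integration.integral_sum; (intro Bochner_Integration.integrable_sum integrable_mult_right)?) (auto intro!: sum.cong)
  also have "\<dots> = (\<Sum>i<n. \<Sum>j<n. x i * x j * (if i = j then 1 else 0))"
    by (intro sum.cong) (auto simp: std_gaussian_component_moments)
  also have "\<dots> = ip n x x" by (simp add: ip_def if_distrib[of "(*) _"] cong: if_cong)
  finally show "(\<integral>g. (ip n g x)\<^sup>2 \<partial>std_gaussian n) = ip n x x" .
qed

lemma integrable_ip_self_square: "integrable (std_gaussian n) (\<lambda>h. (ip n h h)\<^sup>2)"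
proof -
  have "(ip n h h)\<^sup>2 = (\<Sum>i<n. \<Sum>j<n. h i ^ 2 * h j ^ 2)" for h
    by (simp add: ip_def power2_eq_square sum_product algebra_simps)
  then show ?thesis
    by (auto intro!: Bochner_Integration.integrable_sum std_gaussian_component_moments)
qed

lemma borel_measurable_ip [measurable]:
  "f \<in> M \<rightarrow>\<^sub>M PiM {..<n} (\<lambda>_. borel) \<Longrightarrow> g \<in> M \<rightarrow>\<^sub>M PiM {..<n} (\<lambda>_. borel) \<Longrightarrow>
    (\<lambda>x. ip n (f x) (g x)) \<in> borel_measurable M"
  unfolding ip_def by (intro borel_measurable_sum borel_measurable_times) (auto dest: measurable_component_singleton[THEN measurable_compose[rotated]])

text \<open>One majorant for everything that is averaged: |h|^2 + |g|^2 is invariant under rotating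
  the pair, the square accommodates second moments of sqn, and the summand 1 absorbs
  \<open>\<epsilon>^2\<close>.\<close>

definition dom2 :: "nat \<Rightarrow> vec \<times> vec \<Rightarrow> real"
  where "dom2 n w = (1 + ip n (fst w) (fst w) + ip n (snd w) (snd w))\<^sup>2"

lemma integrable_dom2: "integrable (std2 n) (dom2 n)"
proof (rule Bochner_Integration.integrable_bound)
  interpret G: prob_space "std_gaussian n" by (rule prob_space_std_gaussian)
  interpret GG: pair_prob_space "std_gaussian n" "std_gaussian n" ..
  have 1: "integrable (std2 n) (\<lambda>w. (ip n (fst w) (fst w))\<^sup>2)"
  proof -
    have "integrable (distr (std2 n) (std_gaussian n) fst) (\<lambda>h. (ip n h h)\<^sup>2)"
      using integrable_ip_self_square by (simp add: G.distr_pair_fst)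
    then show ?thesis by (rule integrable_distr[rotated]) measurable
  qed
  have 2: "integrable (std2 n) (\<lambda>w. (ip n (snd w) (snd w))\<^sup>2)"
    using GG.integrable_product_swap[OF 1] by (simp add: split_def)
  show "integrable (std2 n) (\<lambda>w. 3 * (1 + (ip n (fst w) (fst w))\<^sup>2 + (ip n (snd w) (snd w))\<^sup>2))"
    by (intro integrable_mult_right Bochner_Integration.integrable_add 1 2) simp
  show "dom2 n \<in> borel_measurable (std2 n)" unfolding dom2_def by measurable
  have "(1 + a + b)\<^sup>2 \<le> 3 * (1 + a\<^sup>2 + b\<^sup>2)" for a b :: real
  proof -
    have "0 \<le> (1 - a)\<^sup>2 + (1 - b)\<^sup>2 + (a - b)\<^sup>2" by simp
    then show ?thesis by (simp add: power2_eq_square algebra_simps)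
  qed
  then show "AE w in std2 n. norm (dom2 n w) \<le> norm (3 * (1 + (ip n (fst w) (fst w))\<^sup>2 + (ip n (snd w) (snd w))\<^sup>2))"
    by (intro AE_I2) (simp add: dom2_def)
qed

lemma dom2_rotp: "dom2 n (rotp n \<psi> w) = dom2 n w"
  unfolding dom2_def using ip_square_sum_rotp[of n \<psi> w] by (simp add: add.assoc)

text \<open>The inequality is only available after averaging along each orbit of rotations, not
  pointwise. The assumptions on \<open>restrict\<close> identify the values at \<open>rotp\<close>,
  which cuts to n coordinates, with those at \<open>rotv\<close> and \<open>rotd\<close>.\<close>

lemma rot_compare:
  fixes H1 H2 :: "vec \<Rightarrow> vec \<Rightarrow> real"
  assumes meas: "case_prod H1 \<in> borel_measurable (std2 n)" "case_prod H2 \<in> borel_measurable (std2 n)"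
    and bound: "\<And>h g. \<bar>H1 h g\<bar> \<le> b * dom2 n (h, g)" "\<And>h g. \<bar>H2 h g\<bar> \<le> b * dom2 n (h, g)"
    and cong: "\<And>h g. H1 (restrict h {..<n}) (restrict g {..<n}) = H1 h g"
      "\<And>h g. H2 (restrict h {..<n}) (restrict g {..<n}) = H2 h g"
    and cont: "\<And>h g. continuous_on UNIV (\<lambda>\<psi>. H1 (rotv \<psi> h g) (rotd \<psi> h g))"
      "\<And>h g. continuous_on UNIV (\<lambda>\<psi>. H2 (rotv \<psi> h g) (rotd \<psi> h g))"
    and le: "\<And>h g. integral {0..2 * pi} (\<lambda>\<psi>. H1 (rotv \<psi> h g) (rotd \<psi> h g))
        \<le> integral {0..2 * pi} (\<lambda>\<psi>. H2 (rotv \<psi> h g) (rotd \<psi> h g))"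
  shows "integral\<^sup>L (std2 n) (case_prod H1) \<le> integral\<^sup>L (std2 n) (case_prod H2)"
proof -
  have B: "integrable (std2 n) (\<lambda>w. b * dom2 n w)" by (intro integrable_mult_right integrable_dom2)
  have R1: "\<bar>case_prod H1 w\<bar> \<le> b * dom2 n w" for w using bound(1) by (cases w) auto
  have R2: "\<bar>case_prod H2 w\<bar> \<le> b * dom2 n w" for w using bound(2) by (cases w) auto
  note A1 = rot_average[OF meas(1) B R1] and A2 = rot_average[OF meas(2) B R2]
  have "integral\<^sup>L (std2 n) (case_prod H1) = (\<integral>w. \<integral>\<psi>. case_prod H1 (rotp n \<psi> w) \<partial>circle \<partial>std2 n)"
    using A1(2) by (simp add: dom2_rotp)
  also have "\<dots> \<le> (\<integral>w. \<integral>\<psi>. case_prod H2 (rotp n \<psi> w) \<partial>circle \<partial>std2 n)"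
  proof (rule integral_mono)
    show "integrable (std2 n) (\<lambda>w. \<integral>\<psi>. case_prod H1 (rotp n \<psi> w) \<partial>circle)"
      "integrable (std2 n) (\<lambda>w. \<integral>\<psi>. case_prod H2 (rotp n \<psi> w) \<partial>circle)"
      using A1(1) A2(1) by (simp_all add: dom2_rotp)
    fix w :: "vec \<times> vec"
    obtain h g where w: "w = (h, g)" by fastforce
    show "(\<integral>\<psi>. case_prod H1 (rotp n \<psi> w) \<partial>circle) \<le> (\<integral>\<psi>. case_prod H2 (rotp n \<psi> w) \<partial>circle)"
      unfolding w rotp_eq split cong integral_circle[OF cont(1)] integral_circle[OF cont(2)]
      using le[of h g] by (simp add: divide_right_mono)
  qed
  also have "\<dots> = integral\<^sup>L (std2 n) (case_prod H2)"
    using A2(2) by (simp add: dom2_rotp)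
  finally show "integral\<^sup>L (std2 n) (case_prod H1) \<le> integral\<^sup>L (std2 n) (case_prod H2)" .
qed

subsection \<open>Moments of a random hyperplane section\<close>

text \<open>Points of the product space are undefined from n on. Filling in zeros maps them
  measurably into the space where F is continuous, and F does not notice the change.\<close>

lemma borel_measurable_PiM_of_continuous:
  fixes F :: "vec \<Rightarrow> real"
  assumes F: "continuous_on UNIV F" and cong: "\<And>h h'. (\<And>i. i < n \<Longrightarrow> h i = h' i) \<Longrightarrow> F h = F h'"
  shows "F \<in> borel_measurable (PiM {..<n} (\<lambda>_. borel))"
proof -
  have "(\<lambda>h::vec. \<lambda>i. if i < n then h i else 0) \<in> PiM {..<n} (\<lambda>_. borel) \<rightarrow>\<^sub>M borel"
  proof (rule measurable_coordinatewise_then_product)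
    fix i show "(\<lambda>h::vec. if i < n then h i else 0) \<in> borel_measurable (PiM {..<n} (\<lambda>_. borel))"
      by (cases "i < n") auto
  qed
  from measurable_compose[OF this borel_measurable_continuous_onI[OF F]]
  have "(\<lambda>h. F (\<lambda>i. if i < n then h i else 0)) \<in> borel_measurable (PiM {..<n} (\<lambda>_. borel))" .
  moreover have "F (\<lambda>i. if i < n then h i else 0) = F h" for h by (rule cong) simp
  ultimately show ?thesis by simp
qed

text \<open>Makes the supremum inside \<open>rad\<close> countable, which yields measurability of
  \<open>reg\<close> in the pair.\<close>

lemma SUP_eq_SUP_Rats:
  fixes c :: "real \<Rightarrow> real"
  assumes c: "continuous_on UNIV c" and bdd: "bdd_above (range c)"
  shows "(SUP x. c x) = (SUP x\<in>\<rat>. c x)"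
proof (rule antisym)
  have b: "bdd_above (c ` \<rat>)" using bdd by (rule bdd_above_mono) auto
  show "(SUP x\<in>\<rat>. c x) \<le> (SUP x. c x)"
    by (rule cSUP_subset_mono) (use bdd in \<open>auto intro: Rats_0\<close>)
  have "closed {x. c x \<le> (SUP x\<in>\<rat>. c x)}"
    by (intro closed_Collect_le c continuous_on_const)
  moreover have "\<rat> \<subseteq> {x. c x \<le> (SUP x\<in>\<rat>. c x)}" using b by (auto intro: cSUP_upper)
  ultimately have "closure \<rat> \<subseteq> {x. c x \<le> (SUP x\<in>\<rat>. c x)}" by (simp add: closure_minimal)
  then have "c x \<le> (SUP x\<in>\<rat>. c x)" for x by (auto simp: Rats_closure_real)
  then show "(SUP x. c x) \<le> (SUP x\<in>\<rat>. c x)" by (intro cSUP_least) auto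
qed

lemma ip_restrict_left [simp]: "ip n (restrict g {..<n}) x = ip n g x"
  by (rule ip_cong) auto

lemma one_le_dom2: "1 + ip n h h + ip n g g \<le> dom2 n (h, g)"
  using ip_self_nonneg[of n h] ip_self_nonneg[of n g]
    self_le_power[of "1 + ip n h h + ip n g g" 2] by (simp add: dom2_def)

lemma square_le_dom2: "(1 + ip n h h)\<^sup>2 + 2 * (ip n h h * ip n g g) \<le> dom2 n (h, g)"
proof -
  have "dom2 n (h, g) = (1 + ip n h h)\<^sup>2 + 2 * (ip n h h * ip n g g) + (2 * ip n g g + (ip n g g)\<^sup>2)"
    by (simp add: dom2_def power2_eq_square algebra_simps)
  then show ?thesis by simp
qed

lemma integrable_std_gaussianI:
  fixes F :: "vec \<Rightarrow> real"
  assumes "F \<in> borel_measurable (std_gaussian n)" "\<And>h. \<bar>F h\<bar> \<le> (1 + ip n h h)\<^sup>2"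
  shows "integrable (std_gaussian n) F"
proof (rule Bochner_Integration.integrable_bound[OF _ assms(1)])
  interpret G: prob_space "std_gaussian n" by (rule prob_space_std_gaussian)
  show "integrable (std_gaussian n) (\<lambda>h. 2 + 2 * (ip n h h)\<^sup>2)"
    by (intro Bochner_Integration.integrable_add integrable_mult_right integrable_ip_self_square) simp
  have "(1 + a)\<^sup>2 \<le> 2 + 2 * a\<^sup>2" for a :: real
    using zero_le_power2[of "1 - a"] by (simp add: power2_eq_square algebra_simps)
  then show "AE h in std_gaussian n. norm (F h) \<le> norm (2 + 2 * (ip n h h)\<^sup>2)"
    using assms(2) by (intro AE_I2) (simp, meson order_trans)
qed

lemma one_le_square: "1 + ip n h h \<le> (1 + ip n h h)\<^sup>2"
  by (rule self_le_power) auto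

lemma integral_std2:
  fixes F :: "vec \<Rightarrow> real"
  assumes [measurable]: "F \<in> borel_measurable (std_gaussian n)"
  shows "(\<integral>w. F (fst w) \<partial>std2 n) = (\<integral>h. F h \<partial>std_gaussian n)"
    and "(\<integral>w. F (snd w) \<partial>std2 n) = (\<integral>h. F h \<partial>std_gaussian n)"
proof -
  interpret G: prob_space "std_gaussian n" by (rule prob_space_std_gaussian)
  interpret GG: pair_prob_space "std_gaussian n" "std_gaussian n" ..
  have "(\<integral>h. F h \<partial>distr (std2 n) (std_gaussian n) fst) = (\<integral>w. F (fst w) \<partial>std2 n)"
    by (rule integral_distr) measurable
  then show 1: "(\<integral>w. F (fst w) \<partial>std2 n) = (\<integral>h. F h \<partial>std_gaussian n)" by (simp add: G.distr_pair_fst)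
  have "(\<integral>w. F (snd w) \<partial>std2 n) = (\<integral>w. F (fst w) \<partial>std2 n)"
    using GG.integral_product_swap[of "\<lambda>w. F (fst w)"] by (simp add: split_def)
  then show "(\<integral>w. F (snd w) \<partial>std2 n) = (\<integral>h. F h \<partial>std_gaussian n)" using 1 by simp
qed

context closed_convex_cone
begin

lemma sqn_restrict [simp]: "sqn (restrict h {..<n}) = sqn h"
  by (rule sqn_cong) simp

lemma proj_restrict [simp]: "proj (restrict h {..<n}) = proj h"
  by (rule proj_cong) simp

lemma sqn_measurable [measurable]: "sqn \<in> borel_measurable (PiM {..<n} (\<lambda>_. borel))"
  by (rule borel_measurable_PiM_of_continuous[OF continuous_on_sqn sqn_cong])

lemma sqn_measurable': "sqn \<in> borel_measurable (std_gaussian n)"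
  using sqn_measurable measurable_cong_sets[OF sets_std_gaussian refl] by blast

lemma proj_component_measurable [measurable]: "(\<lambda>h. proj h i) \<in> borel_measurable (PiM {..<n} (\<lambda>_. borel))"
proof (rule borel_measurable_PiM_of_continuous)
  fix h h' :: vec assume "\<And>i. i < n \<Longrightarrow> h i = h' i"
  then show "proj h i = proj h' i" using proj_cong[of h h'] by simp
qed (rule continuous_on_product_then_coordinatewise[OF continuous_on_proj])

lemma reg_eq_SUP_Rats:
  assumes "0 < \<epsilon>"
  shows "reg \<epsilon> h g = (inverse (SUP x\<in>\<rat>. cos x / sqrt (sqn (restrict (rotv x h g) {..<n}) + \<epsilon>\<^sup>2)))\<^sup>2"
proof -
  interpret F: support_fun_C1 "supp_reg \<epsilon> h g" "\<lambda>x. turn x h g / supp_reg \<epsilon> h g x"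
    by (rule supp_reg_support_fun[OF assms])
  have "continuous_on UNIV (\<lambda>x. cos x / supp_reg \<epsilon> h g x)"
    using F.pos[THEN less_imp_neq, THEN not_sym] by (intro continuous_intros F.cont) auto
  from SUP_eq_SUP_Rats[OF this] F.bdd_above_ratio[of 0]
  show ?thesis by (simp add: reg_def rad_def supp_reg_def)
qed

lemma bdd_above_ratio_Rats:
  assumes "0 < \<epsilon>"
  shows "bdd_above ((\<lambda>x. cos x / sqrt (sqn (restrict (rotv x h g) {..<n}) + \<epsilon>\<^sup>2)) ` \<rat>)"
proof -
  interpret F: support_fun_C1 "supp_reg \<epsilon> h g" "\<lambda>x. turn x h g / supp_reg \<epsilon> h g x"
    by (rule supp_reg_support_fun[OF assms])
  show ?thesis using F.bdd_above_ratio[of 0] by (rule bdd_above_mono) (auto simp: supp_reg_def)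
qed

lemma reg_measurable [measurable]:
  assumes "0 < \<epsilon>" shows "(\<lambda>(h, g). reg \<epsilon> h g) \<in> borel_measurable (std2 n)"
proof -
  have "(\<lambda>w. sqn (restrict (rotv x (fst w) (snd w)) {..<n})) \<in> borel_measurable (std2 n)" for x
  proof -
    have "(\<lambda>w. sqn (fst (rotp n x w))) \<in> borel_measurable (std2 n)"
      by (rule measurable_compose[OF measurable_compose[OF measurable_rotp1 measurable_fst] sqn_measurable'])
    moreover have "fst (rotp n x w) = restrict (rotv x (fst w) (snd w)) {..<n}" for w
      using rotp_eq[of n x "fst w" "snd w"] by simp
    ultimately show ?thesis by simp
  qed
  then have [measurable]: "(\<lambda>w. cos x / sqrt (sqn (restrict (rotv x (fst w) (snd w)) {..<n}) + \<epsilon>\<^sup>2)) \<in> borel_measurable (std2 n)" for x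
    by measurable
  have "(\<lambda>w. SUP x\<in>\<rat>. cos x / sqrt (sqn (restrict (rotv x (fst w) (snd w)) {..<n}) + \<epsilon>\<^sup>2)) \<in> borel_measurable (std2 n)"
  proof (rule borel_measurable_cSUP)
    show "countable (\<rat>::real set)" by (rule countable_rat)
    show "bdd_above ((\<lambda>x. cos x / sqrt (sqn (restrict (rotv x (fst w) (snd w)) {..<n}) + \<epsilon>\<^sup>2)) ` \<rat>)" for w
      by (rule bdd_above_ratio_Rats[OF assms])
  qed measurable
  then show ?thesis by (simp add: reg_eq_SUP_Rats[OF assms] split_def)
qed

text \<open>Here g enters through the cone; measurability in it is inherited from the approximations
  \<open>reg\<close>, which only evaluate sqn of the fixed cone.\<close>

lemma slice_measurable [measurable]:
  "(\<lambda>(h, g). sqn_proj n (slice n C g) h) \<in> borel_measurable (std2 n)"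
proof (rule borel_measurable_LIMSEQ_metric)
  fix k show "(\<lambda>(h, g). reg (inverse (real (Suc k))) h g) \<in> borel_measurable (std2 n)"
    by (rule reg_measurable) simp
qed (auto simp: split_def intro: reg_tendsto_slice[unfolded of_nat_Suc])

lemma supp_reg_cong: "supp_reg \<epsilon> (restrict h {..<n}) (restrict g {..<n}) = supp_reg \<epsilon> h g"
proof
  fix x show "supp_reg \<epsilon> (restrict h {..<n}) (restrict g {..<n}) x = supp_reg \<epsilon> h g x"
    unfolding supp_reg_def by (intro arg_cong[where f = sqrt] arg_cong2[where f = "(+)"] sqn_cong refl)
      (simp add: rotv_def scaleR_fun_def)
qed

lemma reg_restrict: "reg \<epsilon> (restrict h {..<n}) (restrict g {..<n}) = reg \<epsilon> h g"
  by (simp add: reg_def supp_reg_cong)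

definition delta :: real where "delta = (\<integral>h. sqn h \<partial>std_gaussian n)"
definition delta2 :: real where "delta2 = (\<integral>h. (sqn h)\<^sup>2 \<partial>std_gaussian n)"

lemma ip_proj_square_le: "(ip n g (proj h))\<^sup>2 \<le> ip n g g * sqn h"
  using ip_square_le[of n g "proj h"] by (simp add: sqn_def)

lemma integrable_sqn: "integrable (std_gaussian n) sqn" "integrable (std_gaussian n) (\<lambda>h. (sqn h)\<^sup>2)"
proof -
  show "integrable (std_gaussian n) sqn"
  proof (rule integrable_std_gaussianI)
    show "\<bar>sqn h\<bar> \<le> (1 + ip n h h)\<^sup>2" for h using sqn_le[of h] one_le_square[of n h] sqn_nonneg[of h] by linarith
  qed measurable
  show "integrable (std_gaussian n) (\<lambda>h. (sqn h)\<^sup>2)"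
  proof (rule integrable_std_gaussianI)
    show "\<bar>(sqn h)\<^sup>2\<bar> \<le> (1 + ip n h h)\<^sup>2" for h using sqn_le[of h] power_mono[of "sqn h" "1 + ip n h h" 2] by simp
  qed measurable
qed

lemma ip_proj_measurable [measurable]: "(\<lambda>w. ip n (snd w) (proj (fst w))) \<in> borel_measurable (std2 n)"
  unfolding ip_def by measurable

text \<open>Given h, the variable <g, \<Pi>(h)> has second moment |\<Pi>(h)|^2.\<close>

lemma integral_ip_proj_square:
  "integrable (std2 n) (\<lambda>w. (ip n (snd w) (proj (fst w)))\<^sup>2)"
  "(\<integral>w. (ip n (snd w) (proj (fst w)))\<^sup>2 \<partial>std2 n) = delta"
proof -
  interpret G: prob_space "std_gaussian n" by (rule prob_space_std_gaussian)
  interpret GG: pair_prob_space "std_gaussian n" "std_gaussian n" ..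
  show int: "integrable (std2 n) (\<lambda>w. (ip n (snd w) (proj (fst w)))\<^sup>2)"
  proof (rule Bochner_Integration.integrable_bound[OF integrable_dom2])
    have "(ip n (snd w) (proj (fst w)))\<^sup>2 \<le> dom2 n w" for w :: "vec \<times> vec"
    proof -
      have "ip n (snd w) (snd w) * sqn (fst w) \<le> ip n (fst w) (fst w) * ip n (snd w) (snd w)"
        using mult_left_mono[OF sqn_le[of "fst w"], of "ip n (snd w) (snd w)"] by (simp add: mult.commute)
      moreover have "0 \<le> (1 + ip n (fst w) (fst w))\<^sup>2" "0 \<le> ip n (fst w) (fst w) * ip n (snd w) (snd w)" by simp_all
      ultimately show ?thesis
        using ip_proj_square_le[of "snd w" "fst w"] square_le_dom2[of n "fst w" "snd w", unfolded prod.collapse] by linarith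
    qed
    then show "AE w in std2 n. norm ((ip n (snd w) (proj (fst w)))\<^sup>2) \<le> norm (dom2 n w)"
      by (intro AE_I2) (simp add: dom2_def)
  qed measurable
  have "(\<integral>w. (ip n (snd w) (proj (fst w)))\<^sup>2 \<partial>std2 n) = (\<integral>h. \<integral>g. (ip n g (proj h))\<^sup>2 \<partial>std_gaussian n \<partial>std_gaussian n)"
    using GG.integral_fst'[OF int] by simp
  then show "(\<integral>w. (ip n (snd w) (proj (fst w)))\<^sup>2 \<partial>std2 n) = delta"
    by (simp add: std_gaussian_ip_square delta_def sqn_def)
qed

text \<open>Integrating over g first leaves sqn / (sqn + \<epsilon>^2) \<le> 1. This is the loss of
  at most one dimension per hyperplane.\<close>

lemma integral_ip_proj_normalized_le:
  assumes \<epsilon>: "0 < \<epsilon>"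
  shows "integrable (std2 n) (\<lambda>w. (ip n (snd w) (proj (fst w)))\<^sup>2 / (sqn (fst w) + \<epsilon>\<^sup>2))"
    "(\<integral>w. (ip n (snd w) (proj (fst w)))\<^sup>2 / (sqn (fst w) + \<epsilon>\<^sup>2) \<partial>std2 n) \<le> 1"
proof -
  interpret G: prob_space "std_gaussian n" by (rule prob_space_std_gaussian)
  interpret GG: pair_prob_space "std_gaussian n" "std_gaussian n" ..
  have p: "0 < sqn h + \<epsilon>\<^sup>2" for h using \<epsilon> by (simp add: add_nonneg_pos)
  have le: "(ip n g (proj h))\<^sup>2 / (sqn h + \<epsilon>\<^sup>2) \<le> ip n g g" for g h
  proof -
    have "(ip n g (proj h))\<^sup>2 \<le> ip n g g * (sqn h + \<epsilon>\<^sup>2)"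
      using ip_proj_square_le[of g h] mult_left_mono[of "sqn h" "sqn h + \<epsilon>\<^sup>2" "ip n g g"] by simp
    then show ?thesis using p by (simp add: pos_divide_le_eq)
  qed
  show int: "integrable (std2 n) (\<lambda>w. (ip n (snd w) (proj (fst w)))\<^sup>2 / (sqn (fst w) + \<epsilon>\<^sup>2))"
  proof (rule Bochner_Integration.integrable_bound[OF integrable_dom2])
    have "(ip n (snd w) (proj (fst w)))\<^sup>2 / (sqn (fst w) + \<epsilon>\<^sup>2) \<le> dom2 n w" for w :: "vec \<times> vec"
      using le[of "snd w" "fst w"] one_le_dom2[of n "fst w" "snd w", unfolded prod.collapse]
        ip_self_nonneg[of n "fst w"] by linarith
    moreover have "0 \<le> (ip n (snd w) (proj (fst w)))\<^sup>2 / (sqn (fst w) + \<epsilon>\<^sup>2)" for w :: "vec \<times> vec"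
      using p[of "fst w"] by (simp add: less_imp_le)
    ultimately show "AE w in std2 n. norm ((ip n (snd w) (proj (fst w)))\<^sup>2 / (sqn (fst w) + \<epsilon>\<^sup>2)) \<le> norm (dom2 n w)"
      by (intro AE_I2) (simp add: dom2_def)
  qed measurable
  have "(\<integral>w. (ip n (snd w) (proj (fst w)))\<^sup>2 / (sqn (fst w) + \<epsilon>\<^sup>2) \<partial>std2 n)
     = (\<integral>h. \<integral>g. (ip n g (proj h))\<^sup>2 / (sqn h + \<epsilon>\<^sup>2) \<partial>std_gaussian n \<partial>std_gaussian n)"
    using GG.integral_fst'[OF int] by simp
  also have "\<dots> = (\<integral>h. sqn h / (sqn h + \<epsilon>\<^sup>2) \<partial>std_gaussian n)"
    by (simp add: std_gaussian_ip_square sqn_def)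
  also have "\<dots> \<le> 1"
  proof (rule G.integral_le_const)
    show "integrable (std_gaussian n) (\<lambda>h. sqn h / (sqn h + \<epsilon>\<^sup>2))"
      using p by (intro G.integrable_const_bound[where B = 1]) (auto simp: divide_le_eq_1 less_imp_le)
    show "AE h in std_gaussian n. sqn h / (sqn h + \<epsilon>\<^sup>2) \<le> 1" using p by (intro AE_I2) (simp add: divide_le_eq_1)
  qed
  finally show "(\<integral>w. (ip n (snd w) (proj (fst w)))\<^sup>2 / (sqn (fst w) + \<epsilon>\<^sup>2) \<partial>std2 n) \<le> 1" .
qed

lemma reg_le_dom2:
  assumes "0 < \<epsilon>" "\<epsilon> \<le> 1"
  shows "reg \<epsilon> h g \<le> 1 + ip n h h" "\<bar>reg \<epsilon> h g\<bar> \<le> 1 * dom2 n (h, g)" "\<bar>(reg \<epsilon> h g)\<^sup>2\<bar> \<le> 1 * dom2 n (h, g)"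
proof -
  have "\<epsilon>\<^sup>2 \<le> 1" using assms by (simp add: power_le_one)
  then show le: "reg \<epsilon> h g \<le> 1 + ip n h h" using reg_le[OF assms(1), of h g] sqn_le[of h] by simp
  show "\<bar>reg \<epsilon> h g\<bar> \<le> 1 * dom2 n (h, g)"
    using le one_le_dom2[of n h g] ip_self_nonneg[of n g] reg_nonneg[of \<epsilon> h g] by linarith
  have "(reg \<epsilon> h g)\<^sup>2 \<le> (1 + ip n h h)\<^sup>2" using le by (intro power_mono) auto
  moreover have "0 \<le> ip n h h * ip n g g" by simp
  ultimately have "(reg \<epsilon> h g)\<^sup>2 \<le> dom2 n (h, g)" using square_le_dom2[of n h g] by linarith
  then show "\<bar>(reg \<epsilon> h g)\<^sup>2\<bar> \<le> 1 * dom2 n (h, g)" by simp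
qed

lemma integral_reg_ge:
  assumes \<epsilon>: "0 < \<epsilon>" "\<epsilon> \<le> 1"
  shows "delta - 1 \<le> (\<integral>w. reg \<epsilon> (fst w) (snd w) \<partial>std2 n)"
proof -
  interpret G: prob_space "std_gaussian n" by (rule prob_space_std_gaussian)
  interpret GG: pair_prob_space "std_gaussian n" "std_gaussian n" ..
  have p: "0 < sqn h + \<epsilon>\<^sup>2" for h using \<epsilon> by (simp add: add_nonneg_pos)
  have e1: "\<epsilon>\<^sup>2 \<le> 1" using \<epsilon> by (simp add: power_le_one)
  \<comment> \<open>The integrand s^2 - s'^2 of the circle inequality at angle 0; at the rotated
    pair it is the integrand at angle \<open>\<psi>\<close>.\<close>
  define H where "H h g = sqn h + \<epsilon>\<^sup>2 - (ip n g (proj h))\<^sup>2 / (sqn h + \<epsilon>\<^sup>2)" for h g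
  have meas_H: "case_prod H \<in> borel_measurable (std2 n)"
    unfolding H_def split_def by measurable
  have meas_reg: "(\<lambda>(h, g). reg \<epsilon> h g) \<in> borel_measurable (std2 n)" by (rule reg_measurable[OF \<epsilon>(1)])
  have bound_H: "\<bar>H h g\<bar> \<le> 1 * dom2 n (h, g)" for h g
  proof -
    have "(ip n g (proj h))\<^sup>2 \<le> ip n g g * (sqn h + \<epsilon>\<^sup>2)"
      using ip_proj_square_le[of g h] mult_left_mono[of "sqn h" "sqn h + \<epsilon>\<^sup>2" "ip n g g"] by simp
    then have "(ip n g (proj h))\<^sup>2 / (sqn h + \<epsilon>\<^sup>2) \<le> ip n g g" using p by (simp add: pos_divide_le_eq)
    moreover have "0 \<le> (ip n g (proj h))\<^sup>2 / (sqn h + \<epsilon>\<^sup>2)" using p[of h] by (simp add: less_imp_le)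
    moreover have "sqn h + \<epsilon>\<^sup>2 \<le> 1 + ip n h h" using e1 sqn_le[of h] by simp
    ultimately show ?thesis
      using one_le_dom2[of n h g] ip_self_nonneg[of n g] ip_self_nonneg[of n h] p[of h]
      unfolding H_def abs_le_iff by linarith
  qed
  have cont_H: "continuous_on UNIV (\<lambda>\<psi>. H (rotv \<psi> h g) (rotd \<psi> h g))" for h g
    unfolding H_def using p[THEN less_imp_neq, THEN not_sym]
    by (intro continuous_intros continuous_on_sqn_rotv continuous_on_ip_rotd_proj) auto
  have cong_H: "H (restrict h {..<n}) (restrict g {..<n}) = H h g" for h g
    by (simp add: H_def)
  have avg: "integral {0..2 * pi} (\<lambda>\<psi>. H (rotv \<psi> h g) (rotd \<psi> h g))
      \<le> integral {0..2 * pi} (\<lambda>\<psi>. reg \<epsilon> (rotv \<psi> h g) (rotd \<psi> h g))" for h g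
    unfolding H_def by (rule circle_average_reg_ge[OF \<epsilon>(1)])
  have "integral\<^sup>L (std2 n) (case_prod H) \<le> (\<integral>w. case_prod (reg \<epsilon>) w \<partial>std2 n)"
    by (rule rot_compare[OF meas_H meas_reg bound_H reg_le_dom2(2)[OF \<epsilon>] cong_H reg_restrict cont_H
        continuous_on_reg_rot[OF \<epsilon>(1)] avg])
  moreover have "integral\<^sup>L (std2 n) (case_prod H) =
      (\<integral>w. sqn (fst w) + \<epsilon>\<^sup>2 \<partial>std2 n) - (\<integral>w. (ip n (snd w) (proj (fst w)))\<^sup>2 / (sqn (fst w) + \<epsilon>\<^sup>2) \<partial>std2 n)"
    unfolding H_def split_def
  proof (rule Bochner_Integration.integral_diff)
    show "integrable (std2 n) (\<lambda>w. sqn (fst w) + \<epsilon>\<^sup>2)"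
    proof -
      have "integrable (distr (std2 n) (std_gaussian n) fst) sqn"
        using integrable_sqn(1) by (simp add: G.distr_pair_fst)
      then have "integrable (std2 n) (\<lambda>w. sqn (fst w))" by (rule integrable_distr[rotated]) measurable
      then show ?thesis by simp
    qed
  qed (rule integral_ip_proj_normalized_le[OF \<epsilon>(1)])
  moreover have "(\<integral>w. sqn (fst w) + \<epsilon>\<^sup>2 \<partial>std2 n) = delta + \<epsilon>\<^sup>2"
  proof -
    have "(\<integral>w. sqn (fst w) + \<epsilon>\<^sup>2 \<partial>std2 n) = (\<integral>h. sqn h + \<epsilon>\<^sup>2 \<partial>std_gaussian n)"
      by (rule integral_std2) measurable
    also have "\<dots> = delta + \<epsilon>\<^sup>2" using integrable_sqn(1) by (simp add: delta_def G.prob_space)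
    finally show ?thesis .
  qed
  ultimately show ?thesis using integral_ip_proj_normalized_le(2)[OF \<epsilon>(1)] zero_le_power2[of \<epsilon>]
    unfolding split_def by linarith
qed

lemma integral_reg_square_le:
  assumes \<epsilon>: "0 < \<epsilon>" "\<epsilon> \<le> 1"
  shows "(\<integral>w. (reg \<epsilon> (fst w) (snd w))\<^sup>2 \<partial>std2 n) \<le> delta2 + 2 * \<epsilon>\<^sup>2 * delta + \<epsilon> ^ 4 - 2 * delta"
proof -
  interpret G: prob_space "std_gaussian n" by (rule prob_space_std_gaussian)
  interpret GG: pair_prob_space "std_gaussian n" "std_gaussian n" ..
  have e1: "\<epsilon>\<^sup>2 \<le> 1" using \<epsilon> by (simp add: power_le_one)
  define H where "H h g = (sqn h + \<epsilon>\<^sup>2)\<^sup>2 - 2 * (ip n g (proj h))\<^sup>2" for h g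
  have meas_H: "case_prod H \<in> borel_measurable (std2 n)"
    unfolding H_def split_def by measurable
  have meas_reg: "(\<lambda>(h, g). (reg \<epsilon> h g)\<^sup>2) \<in> borel_measurable (std2 n)"
    using reg_measurable[OF \<epsilon>(1)] by (simp add: split_def)
  have bound_H: "\<bar>H h g\<bar> \<le> 1 * dom2 n (h, g)" for h g
  proof -
    have "(sqn h + \<epsilon>\<^sup>2)\<^sup>2 \<le> (1 + ip n h h)\<^sup>2" using e1 sqn_le[of h] by (intro power_mono) auto
    moreover have "(ip n g (proj h))\<^sup>2 \<le> ip n h h * ip n g g"
      using ip_proj_square_le[of g h] mult_left_mono[OF sqn_le[of h], of "ip n g g"] by (simp add: mult.commute)
    moreover have "0 \<le> (sqn h + \<epsilon>\<^sup>2)\<^sup>2" "0 \<le> (ip n g (proj h))\<^sup>2" by simp_all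
    ultimately show ?thesis using square_le_dom2[of n h g] unfolding H_def abs_le_iff by linarith
  qed
  have cont_H: "continuous_on UNIV (\<lambda>\<psi>. H (rotv \<psi> h g) (rotd \<psi> h g))" for h g
    unfolding H_def by (intro continuous_intros continuous_on_sqn_rotv continuous_on_ip_rotd_proj)
  have cong_H: "H (restrict h {..<n}) (restrict g {..<n}) = H h g" for h g
    by (simp add: H_def)
  have avg: "integral {0..2 * pi} (\<lambda>\<psi>. (reg \<epsilon> (rotv \<psi> h g) (rotd \<psi> h g))\<^sup>2)
      \<le> integral {0..2 * pi} (\<lambda>\<psi>. H (rotv \<psi> h g) (rotd \<psi> h g))" for h g
    unfolding H_def by (rule circle_average_reg_square_le[OF \<epsilon>(1)])
  have "(\<integral>w. case_prod (\<lambda>h g. (reg \<epsilon> h g)\<^sup>2) w \<partial>std2 n) \<le> integral\<^sup>L (std2 n) (case_prod H)"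
    by (rule rot_compare[OF meas_reg meas_H reg_le_dom2(3)[OF \<epsilon>] bound_H _ cong_H
        continuous_on_power[OF continuous_on_reg_rot[OF \<epsilon>(1)]] cont_H avg]) (simp only: reg_restrict)
  moreover have "integral\<^sup>L (std2 n) (case_prod H) =
      (\<integral>w. (sqn (fst w) + \<epsilon>\<^sup>2)\<^sup>2 \<partial>std2 n) - (\<integral>w. 2 * (ip n (snd w) (proj (fst w)))\<^sup>2 \<partial>std2 n)"
    unfolding H_def split_def
  proof (rule Bochner_Integration.integral_diff)
    show "integrable (std2 n) (\<lambda>w. (sqn (fst w) + \<epsilon>\<^sup>2)\<^sup>2)"
    proof -
      have "integrable (std_gaussian n) (\<lambda>h. (sqn h + \<epsilon>\<^sup>2)\<^sup>2)"
      proof (rule integrable_std_gaussianI)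
        show "\<bar>(sqn h + \<epsilon>\<^sup>2)\<^sup>2\<bar> \<le> (1 + ip n h h)\<^sup>2" for h
          using e1 sqn_le[of h] power_mono[of "sqn h + \<epsilon>\<^sup>2" "1 + ip n h h" 2] by simp
      qed measurable
      then have "integrable (distr (std2 n) (std_gaussian n) fst) (\<lambda>h. (sqn h + \<epsilon>\<^sup>2)\<^sup>2)"
        by (simp add: G.distr_pair_fst)
      then show ?thesis by (rule integrable_distr[rotated]) measurable
    qed
  qed (intro integrable_mult_right integral_ip_proj_square)
  moreover have "(\<integral>w. (sqn (fst w) + \<epsilon>\<^sup>2)\<^sup>2 \<partial>std2 n) = delta2 + 2 * \<epsilon>\<^sup>2 * delta + \<epsilon> ^ 4"
  proof -
    have "(\<integral>w. (sqn (fst w) + \<epsilon>\<^sup>2)\<^sup>2 \<partial>std2 n) = (\<integral>h. (sqn h + \<epsilon>\<^sup>2)\<^sup>2 \<partial>std_gaussian n)"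
      by (rule integral_std2) measurable
    also have "\<dots> = (\<integral>h. (sqn h)\<^sup>2 + 2 * \<epsilon>\<^sup>2 * sqn h + \<epsilon> ^ 4 \<partial>std_gaussian n)"
      by (simp add: power2_eq_square power4_eq_xxxx algebra_simps)
    also have "\<dots> = delta2 + 2 * \<epsilon>\<^sup>2 * delta + \<epsilon> ^ 4"
      using integrable_sqn by (simp add: delta_def delta2_def G.prob_space)
    finally show ?thesis .
  qed
  ultimately show ?thesis using integral_ip_proj_square(2)
    by (simp add: split_def)
qed

text \<open>In terms of intrinsic volumes, a random hyperplane section shifts the index by one.\<close>

lemma slice_moments:
  "integrable (std2 n) (\<lambda>w. sqn_proj n (slice n C (snd w)) (fst w))"
  "integrable (std2 n) (\<lambda>w. (sqn_proj n (slice n C (snd w)) (fst w))\<^sup>2)"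
  "delta - 1 \<le> (\<integral>w. sqn_proj n (slice n C (snd w)) (fst w) \<partial>std2 n)"
  "(\<integral>w. (sqn_proj n (slice n C (snd w)) (fst w))\<^sup>2 \<partial>std2 n) \<le> delta2 - 2 * delta"
proof -
  define Z where "Z w = sqn_proj n (slice n C (snd w)) (fst w)" for w :: "vec \<times> vec"
  define e where "e k = inverse (real (Suc k))" for k
  have e: "0 < e k" "e k \<le> 1" for k by (auto simp: e_def divide_simps)
  have e0: "e \<longlonglongrightarrow> 0" unfolding e_def by (rule LIMSEQ_inverse_real_of_nat)
  have Zlim: "(\<lambda>k. reg (e k) (fst w) (snd w)) \<longlonglongrightarrow> Z w" for w
    unfolding e_def Z_def by (rule reg_tendsto_slice)
  have mZ[measurable]: "Z \<in> borel_measurable (std2 n)"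
    using slice_measurable by (simp add: Z_def[abs_def] split_def)
  have mreg[measurable]: "(\<lambda>w. reg (e k) (fst w) (snd w)) \<in> borel_measurable (std2 n)" for k
    using reg_measurable[OF e(1)] by (simp add: split_def)
  have bnd: "norm (reg (e k) (fst w) (snd w)) \<le> dom2 n w" "norm ((reg (e k) (fst w) (snd w))\<^sup>2) \<le> dom2 n w" for k w
    using reg_le_dom2(2,3)[OF e, of k "fst w" "snd w"] by simp_all
  have 1: "integrable (std2 n) Z" "(\<lambda>k. \<integral>w. reg (e k) (fst w) (snd w) \<partial>std2 n) \<longlonglongrightarrow> integral\<^sup>L (std2 n) Z"
    using integrable_dominated_convergence[OF mZ mreg integrable_dom2 AE_I2[OF Zlim] AE_I2[OF bnd(1)]]
      integral_dominated_convergence[OF mZ mreg integrable_dom2 AE_I2[OF Zlim] AE_I2[OF bnd(1)]] by auto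
  have mZ2: "(\<lambda>w. (Z w)\<^sup>2) \<in> borel_measurable (std2 n)"
    and mreg2: "(\<lambda>w. (reg (e k) (fst w) (snd w))\<^sup>2) \<in> borel_measurable (std2 n)" for k
    by measurable
  have 2: "integrable (std2 n) (\<lambda>w. (Z w)\<^sup>2)" "(\<lambda>k. \<integral>w. (reg (e k) (fst w) (snd w))\<^sup>2 \<partial>std2 n) \<longlonglongrightarrow> (\<integral>w. (Z w)\<^sup>2 \<partial>std2 n)"
    using integrable_dominated_convergence[OF mZ2 mreg2 integrable_dom2 AE_I2[OF tendsto_power[OF Zlim]] AE_I2[OF bnd(2)]]
      integral_dominated_convergence[OF mZ2 mreg2 integrable_dom2 AE_I2[OF tendsto_power[OF Zlim]] AE_I2[OF bnd(2)]] by auto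
  show "integrable (std2 n) (\<lambda>w. sqn_proj n (slice n C (snd w)) (fst w))"
    using 1 by (simp add: Z_def[abs_def])
  show "integrable (std2 n) (\<lambda>w. (sqn_proj n (slice n C (snd w)) (fst w))\<^sup>2)"
    using 2 by (simp add: Z_def[abs_def])
  have "delta - 1 \<le> integral\<^sup>L (std2 n) Z"
    using integral_reg_ge[OF e] by (intro LIMSEQ_le_const[OF 1(2)]) auto
  then show "delta - 1 \<le> (\<integral>w. sqn_proj n (slice n C (snd w)) (fst w) \<partial>std2 n)"
    by (simp add: Z_def[abs_def])
  have "(\<integral>w. (Z w)\<^sup>2 \<partial>std2 n) \<le> delta2 + 2 * 0\<^sup>2 * delta + 0 ^ 4 - 2 * delta"
  proof (rule LIMSEQ_le[OF 2(2)])
    show "(\<lambda>k. delta2 + 2 * (e k)\<^sup>2 * delta + (e k) ^ 4 - 2 * delta) \<longlonglongrightarrow> delta2 + 2 * 0\<^sup>2 * delta + 0 ^ 4 - 2 * delta"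
      by (intro tendsto_intros e0)
  qed (use integral_reg_square_le[OF e] in auto)
  then show "(\<integral>w. (sqn_proj n (slice n C (snd w)) (fst w))\<^sup>2 \<partial>std2 n) \<le> delta2 - 2 * delta"
    by (simp add: Z_def)
qed

text \<open>For independent h and g the mean of (sqn h - sqn g)^2 is twice the variance, and g is h
  after a quarter turn of the pair. \<open>circle_variation\<close> bounds this mean by 16 pi^2 E
  <g, \<Pi>(h)>^2 = 16 pi^2 delta.\<close>

lemma second_moment_le: "delta2 \<le> delta\<^sup>2 + 8 * pi\<^sup>2 * delta"
proof -
  interpret G: prob_space "std_gaussian n" by (rule prob_space_std_gaussian)
  interpret GG: pair_prob_space "std_gaussian n" "std_gaussian n" ..
  define H1 where "H1 h g = (sqn h - sqn g)\<^sup>2" for h g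
  define H2 where "H2 h g = 16 * pi\<^sup>2 * (ip n g (proj h))\<^sup>2" for h g
  have m1: "case_prod H1 \<in> borel_measurable (std2 n)" unfolding H1_def split_def by measurable
  have m2: "case_prod H2 \<in> borel_measurable (std2 n)" unfolding H2_def split_def by measurable
  have pi1: "1 \<le> 16 * pi\<^sup>2" using pi_gt3 power_mono[of 1 pi 2] unfolding one_power2 by linarith
  have d0: "0 \<le> dom2 n w" for w by (simp add: dom2_def)
  have b1: "\<bar>H1 h g\<bar> \<le> (16 * pi\<^sup>2) * dom2 n (h, g)" for h g
  proof -
    have "\<bar>sqn h - sqn g\<bar> \<le> 1 + ip n h h + ip n g g"
      using sqn_le[of h] sqn_le[of g] sqn_nonneg[of h] sqn_nonneg[of g] by linarith
    then have "(sqn h - sqn g)\<^sup>2 \<le> dom2 n (h, g)" using power_mono[of "\<bar>sqn h - sqn g\<bar>" _ 2] by (simp add: dom2_def)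
    also have "\<dots> \<le> (16 * pi\<^sup>2) * dom2 n (h, g)" using mult_right_mono[OF pi1 d0] by simp
    finally show ?thesis by (simp add: H1_def)
  qed
  have b2: "\<bar>H2 h g\<bar> \<le> (16 * pi\<^sup>2) * dom2 n (h, g)" for h g
  proof -
    have "(ip n g (proj h))\<^sup>2 \<le> ip n h h * ip n g g"
      using ip_proj_square_le[of g h] mult_left_mono[OF sqn_le[of h], of "ip n g g"] by (simp add: mult.commute)
    moreover have "0 \<le> (1 + ip n h h)\<^sup>2" "0 \<le> ip n h h * ip n g g" by simp_all
    ultimately have "(ip n g (proj h))\<^sup>2 \<le> dom2 n (h, g)" using square_le_dom2[of n h g] by linarith
    then show ?thesis by (simp add: H2_def mult_left_mono)
  qed
  have c1: "continuous_on UNIV (\<lambda>\<psi>. H1 (rotv \<psi> h g) (rotd \<psi> h g))" for h g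
    unfolding H1_def
    by (intro continuous_intros continuous_on_sqn_rotv continuous_on_compose2[OF continuous_on_sqn_rotv[of UNIV h g]]) auto
  have c2: "continuous_on UNIV (\<lambda>\<psi>. H2 (rotv \<psi> h g) (rotd \<psi> h g))" for h g
    unfolding H2_def by (intro continuous_intros continuous_on_ip_rotd_proj)
  have avg: "integral {0..2 * pi} (\<lambda>\<psi>. H1 (rotv \<psi> h g) (rotd \<psi> h g)) \<le> integral {0..2 * pi} (\<lambda>\<psi>. H2 (rotv \<psi> h g) (rotd \<psi> h g))" for h g
    unfolding H1_def H2_def by (rule circle_variation)
  have "integral\<^sup>L (std2 n) (case_prod H1) \<le> integral\<^sup>L (std2 n) (case_prod H2)"
    by (rule rot_compare[OF m1 m2 b1 b2 _ _ c1 c2 avg])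
      (simp_all only: H1_def H2_def sqn_restrict ip_restrict_left proj_restrict)
  also have "\<dots> = 16 * pi\<^sup>2 * delta"
    using integral_ip_proj_square(2) by (simp add: H2_def split_def)
  finally have upper: "integral\<^sup>L (std2 n) (case_prod H1) \<le> 16 * pi\<^sup>2 * delta" .
  have i1: "integrable (std2 n) (\<lambda>w. F (fst w))" "integrable (std2 n) (\<lambda>w. F (snd w))"
    if "integrable (std_gaussian n) F" for F :: "vec \<Rightarrow> real"
  proof -
    have [measurable]: "F \<in> borel_measurable (std_gaussian n)" using that by auto
    have "integrable (distr (std2 n) (std_gaussian n) fst) F" using that by (simp add: G.distr_pair_fst)
    then show 1: "integrable (std2 n) (\<lambda>w. F (fst w))" by (rule integrable_distr[rotated]) measurable
    show "integrable (std2 n) (\<lambda>w. F (snd w))" using GG.integrable_product_swap[OF 1] by (simp add: split_def)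
  qed
  have ip: "integrable (std2 n) (\<lambda>w. sqn (fst w) * sqn (snd w))"
  proof (rule Bochner_Integration.integrable_bound[OF integrable_dom2])
    have "sqn (fst w) * sqn (snd w) \<le> dom2 n w" for w :: "vec \<times> vec"
    proof -
      have "sqn (fst w) * sqn (snd w) \<le> ip n (fst w) (fst w) * ip n (snd w) (snd w)"
        by (intro mult_mono sqn_le) auto
      moreover have "0 \<le> (1 + ip n (fst w) (fst w))\<^sup>2" "0 \<le> ip n (fst w) (fst w) * ip n (snd w) (snd w)" by simp_all
      ultimately show ?thesis using square_le_dom2[of n "fst w" "snd w", unfolded prod.collapse] by linarith
    qed
    then show "AE w in std2 n. norm (sqn (fst w) * sqn (snd w)) \<le> norm (dom2 n w)"
      by (intro AE_I2) (simp add: d0)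
  qed measurable
  have "(\<integral>w. sqn (fst w) * sqn (snd w) \<partial>std2 n) = (\<integral>h. \<integral>g. sqn h * sqn g \<partial>std_gaussian n \<partial>std_gaussian n)"
    using GG.integral_fst'[OF ip] by simp
  also have "\<dots> = delta * delta" by (simp add: delta_def)
  finally have cross: "(\<integral>w. sqn (fst w) * sqn (snd w) \<partial>std2 n) = delta\<^sup>2" by (simp add: power2_eq_square)
  have "integral\<^sup>L (std2 n) (case_prod H1)
     = (\<integral>w. (sqn (fst w))\<^sup>2 + (sqn (snd w))\<^sup>2 - 2 * (sqn (fst w) * sqn (snd w)) \<partial>std2 n)"
    by (simp add: H1_def split_def power2_diff mult.assoc)
  also have "\<dots> = (\<integral>w. (sqn (fst w))\<^sup>2 \<partial>std2 n) + (\<integral>w. (sqn (snd w))\<^sup>2 \<partial>std2 n) - 2 * (\<integral>w. sqn (fst w) * sqn (snd w) \<partial>std2 n)"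
    using i1[OF integrable_sqn(2)] ip by simp
  also have "\<dots> = 2 * delta2 - 2 * delta\<^sup>2"
    using integral_std2[of "\<lambda>h. (sqn h)\<^sup>2"] cross by (simp add: delta2_def)
  finally show ?thesis using upper by simp
qed

lemma delta_nonneg: "0 \<le> delta"
  unfolding delta_def by (rule integral_nonneg_AE) simp

text \<open>
  Along a half turn of the pair \<open>(h, g)\<close> the cone can touch the hyperplane orthogonal to the rotated
  \<open>g\<close> from a given side, at a point with positive \<open>h\<close>-component, at one angle at most.
\<close>

lemma touching_angle_unique:
  assumes \<sigma>: "\<sigma> = 1 \<or> \<sigma> = - 1" and \<theta>: "\<theta>1 < \<theta>2" "\<theta>2 < \<theta>1 + pi"
    and 1: "sqn (\<sigma> *\<^sub>R rotd \<theta>1 h g) = 0" "0 < sqn_proj n (slice n C (rotd \<theta>1 h g)) (rotv \<theta>1 h g)"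
    and 2: "sqn (\<sigma> *\<^sub>R rotd \<theta>2 h g) = 0" "0 < sqn_proj n (slice n C (rotd \<theta>2 h g)) (rotv \<theta>2 h g)"
  shows False
proof -
  have slice_pos: "\<exists>x\<in>C. ip n g' x = 0 \<and> 0 < ip n h' x" if "0 < sqn_proj n (slice n C g') h'" for h' g'
  proof -
    interpret S: closed_convex_cone n "slice n C g'"
      by (rule closed_convex_cone_slice) unfold_locales
    show ?thesis using that S.sqn_pos_iff by blast
  qed
  have no: "ip n v x \<le> 0" if "sqn v = 0" "x \<in> C" for v x
    using that sqn_pos_iff[of v] by (metis not_less less_irrefl)
  have split: "rotd b h g = cos (b - a) *\<^sub>R rotd a h g - sin (b - a) *\<^sub>R rotv a h g" for a b
    using rotv_split[of "b + pi / 2" h g a] by (simp add: cos_add sin_add add_diff_eq[symmetric] add.commute[of _ "pi / 2"])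
  have s: "0 < sin (\<theta>2 - \<theta>1)" using \<theta> by (intro sin_gt_zero) auto
  \<comment> \<open>The sign selects the touching point to test: for 1 the point found at
    \<open>\<theta>2\<close> is on the forbidden side at \<open>\<theta>1\<close>, for -1 the point
    found at \<open>\<theta>1\<close> is on the forbidden side at \<open>\<theta>2\<close>. In both
    cases the margin is sin(\<theta>2 - \<theta>1) times a positive number.\<close>
  from \<sigma> show False
  proof
    assume "\<sigma> = 1"
    obtain x where x: "x \<in> C" "ip n (rotd \<theta>2 h g) x = 0" "0 < ip n (rotv \<theta>2 h g) x"
      using slice_pos[OF 2(2)] by blast
    have "ip n (rotd \<theta>1 h g) x = sin (\<theta>2 - \<theta>1) * ip n (rotv \<theta>2 h g) x"
      using x(2) sin_minus[of "\<theta>2 - \<theta>1"] unfolding split[of \<theta>1 \<theta>2] by (simp add: ip_add_left ip_diff_left ip_scaleR_left)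
    then show False using no[OF 1(1) x(1)] \<open>\<sigma> = 1\<close> mult_pos_pos[OF s x(3)] by simp
  next
    assume "\<sigma> = - 1"
    obtain x where x: "x \<in> C" "ip n (rotd \<theta>1 h g) x = 0" "0 < ip n (rotv \<theta>1 h g) x"
      using slice_pos[OF 1(2)] by blast
    have "ip n (- rotd \<theta>2 h g) x = sin (\<theta>2 - \<theta>1) * ip n (rotv \<theta>1 h g) x"
      using x(2) unfolding split[of \<theta>2 \<theta>1] by (simp add: ip_diff_left ip_add_left ip_scaleR_left ip_minus_left)
    then show False using no[OF 2(1) x(1)] \<open>\<sigma> = - 1\<close> mult_pos_pos[OF s x(3)] by simp
  qed
qed

text \<open>Of N rotations of a pair by distinct angles within a half turn at most one is in the bad
  event E. All of them hit E with the same probability, so N P(E) \<le> 1 for every N.\<close>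

lemma touching_null:
  assumes \<sigma>: "\<sigma> = 1 \<or> \<sigma> = - 1"
  shows "AE w in std2 n. 0 < sqn_proj n (slice n C (snd w)) (fst w) \<longrightarrow> 0 < sqn (\<sigma> *\<^sub>R snd w)"
proof -
  interpret G: prob_space "std_gaussian n" by (rule prob_space_std_gaussian)
  interpret GG: pair_prob_space "std_gaussian n" "std_gaussian n" ..
  define P where "P h g \<longleftrightarrow> sqn (\<sigma> *\<^sub>R g) = 0 \<and> 0 < sqn_proj n (slice n C g) h" for h g
  have m1: "(\<lambda>w. sqn_proj n (slice n C (snd w)) (fst w)) \<in> borel_measurable (std2 n)"
    using slice_measurable by (simp add: split_def)
  have m2: "(\<lambda>w. sqn (\<sigma> *\<^sub>R snd w)) \<in> borel_measurable (std2 n)"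
  proof -
    have "(\<lambda>w::vec \<times> vec. \<lambda>i\<in>{..<n}. \<sigma> * snd w i) \<in> std2 n \<rightarrow>\<^sub>M PiM {..<n} (\<lambda>_. borel)"
      unfolding std_gaussian_def by measurable
    from measurable_compose[OF this sqn_measurable]
    have "(\<lambda>w. sqn (restrict (\<sigma> *\<^sub>R snd w) {..<n})) \<in> borel_measurable (std2 n)"
      by (simp add: scaleR_fun_def)
    then show ?thesis by simp
  qed
  define E where "E = {w \<in> space (std2 n). P (fst w) (snd w)}"
  have E[measurable]: "E \<in> sets (std2 n)"
    unfolding E_def P_def using m1 m2 by measurable
  have P_restrict: "P (restrict h {..<n}) (restrict g {..<n}) = P h g" for h g
  proof -
    interpret S: closed_convex_cone n "slice n C g"
      by (rule closed_convex_cone_slice) unfold_locales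
    have "sqn (\<sigma> *\<^sub>R restrict g {..<n}) = sqn (\<sigma> *\<^sub>R g)" by (rule sqn_cong) (simp add: scaleR_fun_def)
    then show ?thesis by (simp add: P_def)
  qed
  have bound: "measure (std2 n) E * real N \<le> 1" for N
  proof -
    \<comment> \<open>The endpoint pi is left out, so any two of the angles differ by less than a
      half turn, where touching is unique.\<close>
    define \<theta> where "\<theta> k = real k * (pi / real N)" for k
    have one: "(\<Sum>k<N. indicator E (rotp n (\<theta> k) w)) \<le> (1::real)" for w
    proof -
      obtain h g where w: "w = (h, g)" by fastforce
      have fin: "finite {k \<in> {..<N}. rotp n (\<theta> k) w \<in> E}" by simp
      have "k = l" if "k < l" "l < N" "rotp n (\<theta> k) w \<in> E" "rotp n (\<theta> l) w \<in> E" for k l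
      proof -
        have N: "0 < pi / real N" using that by simp
        have "\<theta> l < \<theta> k + pi"
        proof -
          have "real l * (pi / real N) < real N * (pi / real N)"
            using that(2) N by (intro mult_strict_right_mono) auto
          then show ?thesis using that(2) by (simp add: \<theta>_def add_strict_increasing2)
        qed
        moreover have "\<theta> k < \<theta> l" unfolding \<theta>_def using that(1) N by (intro mult_strict_right_mono) auto
        moreover have "P (rotv (\<theta> k) h g) (rotd (\<theta> k) h g)" "P (rotv (\<theta> l) h g) (rotd (\<theta> l) h g)"
          using that(3,4) by (auto simp: E_def w rotp_eq P_restrict)
        ultimately show ?thesis unfolding P_def using touching_angle_unique[OF \<sigma>, of "\<theta> k" "\<theta> l" h g] by blast
      qed
      then have "card {k \<in> {..<N}. rotp n (\<theta> k) w \<in> E} \<le> Suc 0"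
        unfolding card_le_Suc0_iff_eq[OF fin] by (metis (mono_tags, lifting) lessThan_iff linorder_neqE_nat mem_Collect_eq)
      moreover have "(\<Sum>k<N. indicator E (rotp n (\<theta> k) w)) = real (card {k \<in> {..<N}. rotp n (\<theta> k) w \<in> E})"
        by (simp add: indicator_def sum.If_cases Int_def)
      ultimately show ?thesis by simp
    qed
    have int: "integrable (std2 n) (\<lambda>w. indicator E (rotp n \<psi> w) :: real)" for \<psi>
      by (rule GG.P.integrable_const_bound[where B = 1]) (auto simp: indicator_def)
    have meas: "(\<integral>w. indicator E (rotp n \<psi> w) \<partial>std2 n) = measure (std2 n) E" for \<psi>
    proof -
      have "measure (std2 n) E = (\<integral>w. indicator E w \<partial>distr (std2 n) (std2 n) (rotp n \<psi>))"
        by (simp add: distr_rotp)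
      also have "\<dots> = (\<integral>w. indicator E (rotp n \<psi> w) \<partial>std2 n)"
        by (rule integral_distr) measurable
      finally show ?thesis by simp
    qed
    have "measure (std2 n) E * real N = (\<integral>w. (\<Sum>k<N. indicator E (rotp n (\<theta> k) w)) \<partial>std2 n)"
      using int by (simp add: meas)
    also have "\<dots> \<le> 1"
      using int one by (intro GG.P.integral_le_const) auto
    finally show ?thesis .
  qed
  have "measure (std2 n) E = 0"
  proof (rule ccontr)
    assume "measure (std2 n) E \<noteq> 0"
    then have "0 < measure (std2 n) E" by (simp add: zero_less_measure_iff)
    then obtain N where "1 < real N * measure (std2 n) E" using ex_less_of_nat_mult by blast
    then show False using bound[of N] by (simp add: mult.commute)
  qed
  then have "AE w in std2 n. w \<notin> E"
    using E by (intro AE_not_in) (auto simp: null_sets_def GG.P.emeasure_eq_measure)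
  then show ?thesis
    by (rule AE_mp) (auto simp: E_def P_def order_le_neq_trans intro!: AE_I2)
qed

end

subsection \<open>Several random hyperplanes\<close>

abbreviation gauss_rows :: "nat \<Rightarrow> nat \<Rightarrow> (nat \<Rightarrow> vec) measure"
  where "gauss_rows n m \<equiv> PiM {..<m} (\<lambda>_. std_gaussian n)"

lemma prob_space_rows: "prob_space (gauss_rows n m)"
  by (intro prob_space_PiM prob_space_std_gaussian)

lemma rows_entry_measurable:
  assumes "j < m" "i < n"
  shows "(\<lambda>G. G j i) \<in> borel_measurable (gauss_rows n m)"
proof -
  have "(\<lambda>G. G j) \<in> gauss_rows n m \<rightarrow>\<^sub>M std_gaussian n"
    using assms by (intro measurable_component_singleton) simp
  moreover have "(\<lambda>h. h i) \<in> borel_measurable (std_gaussian n)"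
    using assms unfolding std_gaussian_def by simp
  ultimately show ?thesis by (rule measurable_compose)
qed

lemma product_prob_space_std_gaussian: "product_prob_space (\<lambda>_::nat. std_gaussian n)"
proof -
  interpret prob_space "std_gaussian n" by (rule prob_space_std_gaussian)
  show ?thesis by unfold_locales
qed

lemma integral_rows_Suc:
  fixes F :: "(nat \<Rightarrow> vec) \<Rightarrow> real"
  assumes F: "integrable (gauss_rows n (Suc j)) F"
  shows "integral\<^sup>L (gauss_rows n (Suc j)) F = (\<integral>G. \<integral>g. F (G(j := g)) \<partial>std_gaussian n \<partial>gauss_rows n j)"
proof -
  interpret R: product_prob_space "\<lambda>_::nat. std_gaussian n" "{..<j}" by (rule product_prob_space_std_gaussian)
  show ?thesis
    using R.product_integral_insert[of "{..<j}" j F] F by (simp add: lessThan_Suc)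
qed

lemma rows_update_measurable: "(\<lambda>(G, g). G(j := g)) \<in> gauss_rows n j \<Otimes>\<^sub>M std_gaussian n \<rightarrow>\<^sub>M gauss_rows n (Suc j)"
  unfolding lessThan_Suc by (rule measurable_add_dim)

lemma integrable_inner_rows:
  assumes F: "F \<in> borel_measurable (gauss_rows n (Suc j))" and b: "\<And>G. \<bar>F G\<bar> \<le> (b::real)"
  shows "integrable (gauss_rows n j) (\<lambda>G. \<integral>g. F (G(j := g)) \<partial>std_gaussian n)"
proof -
  interpret G: prob_space "std_gaussian n" by (rule prob_space_std_gaussian)
  interpret R: prob_space "gauss_rows n j" by (rule prob_space_rows)
  have [measurable]: "(\<lambda>(G, g). F (G(j := g))) \<in> borel_measurable (gauss_rows n j \<Otimes>\<^sub>M std_gaussian n)"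
    using measurable_compose[OF rows_update_measurable F] by (simp add: split_def)
  show ?thesis
  proof (rule R.integrable_const_bound[where B = b])
    show "AE G in gauss_rows n j. norm (\<integral>g. F (G(j := g)) \<partial>std_gaussian n) \<le> b"
    proof (rule AE_I2)
      fix G assume G: "G \<in> space (gauss_rows n j)"
      have i: "integrable (std_gaussian n) (\<lambda>g. F (G(j := g)))"
      proof (rule G.integrable_const_bound[where B = b])
        show "(\<lambda>g. F (G(j := g))) \<in> borel_measurable (std_gaussian n)" using G by measurable
      qed (use b in auto)
      have "norm (\<integral>g. F (G(j := g)) \<partial>std_gaussian n) \<le> (\<integral>g. norm (F (G(j := g))) \<partial>std_gaussian n)"
        by (rule integral_norm_bound)
      also have "\<dots> \<le> b" using i b by (intro G.integral_le_const) auto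
      finally show "norm (\<integral>g. F (G(j := g)) \<partial>std_gaussian n) \<le> b" .
    qed
  qed measurable
qed

section \<open>Moments of the section by the first j rows\<close>

context closed_convex_cone
begin

abbreviation ksec :: "(nat \<Rightarrow> vec) \<Rightarrow> nat \<Rightarrow> vec set"
  where "ksec \<equiv> kcone n C"

lemma ksec_ccc: "closed_convex_cone n (ksec G j)"
  by (rule closed_convex_cone_kcone) unfold_locales

text \<open>The cone itself is random now, so joint measurability is carried along an induction on
  j: the next section is a limit of \<open>reg\<close>, and \<open>reg\<close> is a countable
  supremum of the previous function at h rotated towards row j.\<close>

lemma ksec_sqn_measurable:
  "j \<le> m \<Longrightarrow> (\<lambda>(G, h). sqn_proj n (ksec G j) h) \<in> borel_measurable (gauss_rows n m \<Otimes>\<^sub>M std_gaussian n)"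
proof (induction j)
  case 0
  have "(\<lambda>w. sqn (snd w)) \<in> borel_measurable (gauss_rows n m \<Otimes>\<^sub>M std_gaussian n)"
    by (rule measurable_compose[OF measurable_snd sqn_measurable'])
  then show ?case by (simp add: split_def)
next
  case (Suc j)
  then have j: "j < m" by simp
  define P where "P = gauss_rows n m \<Otimes>\<^sub>M std_gaussian n"
  have IH: "(\<lambda>w. sqn_proj n (ksec (fst w) j) (snd w)) \<in> borel_measurable P"
    using Suc by (simp add: split_def P_def)
  have rot: "(\<lambda>w. (fst w, restrict (rotv x (snd w) (fst w j)) {..<n})) \<in> P \<rightarrow>\<^sub>M P" for x
  proof -
    have "(\<lambda>w. \<lambda>i\<in>{..<n}. cos x * snd w i + sin x * fst w j i) \<in> P \<rightarrow>\<^sub>M std_gaussian n"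
      unfolding P_def std_gaussian_def
    proof (rule measurable_restrict)
      fix i assume i: "i \<in> {..<n}"
      have "(\<lambda>w. fst w j i) \<in> borel_measurable (gauss_rows n m \<Otimes>\<^sub>M std_gaussian n)"
        using measurable_compose[OF measurable_fst rows_entry_measurable[OF j]] i by simp
      moreover have "(\<lambda>h. h i) \<in> borel_measurable (std_gaussian n)"
        using i unfolding std_gaussian_def by simp
      then have "(\<lambda>w. snd w i) \<in> borel_measurable (gauss_rows n m \<Otimes>\<^sub>M std_gaussian n)"
        by (rule measurable_compose[OF measurable_snd])
      ultimately show "(\<lambda>w. cos x * snd w i + sin x * fst w j i) \<in>
          PiM {..<m} (\<lambda>_. gaussn {..<n}) \<Otimes>\<^sub>M gaussn {..<n} \<rightarrow>\<^sub>M gauss"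
        unfolding std_gaussian_def by simp
    qed
    then have "(\<lambda>w. restrict (rotv x (snd w) (fst w j)) {..<n}) \<in> P \<rightarrow>\<^sub>M std_gaussian n"
      by (simp add: rotv_def scaleR_fun_def plus_fun_def)
    then show ?thesis unfolding P_def by measurable
  qed
  have m: "(\<lambda>w. sqn_proj n (ksec (fst w) j) (restrict (rotv x (snd w) (fst w j)) {..<n})) \<in> borel_measurable P" for x
    using measurable_compose[OF rot IH] by simp
  have mreg: "(\<lambda>w. closed_convex_cone.reg n (ksec (fst w) j) \<epsilon> (snd w) (fst w j)) \<in> borel_measurable P" if "0 < \<epsilon>" for \<epsilon>
  proof -
    have "(\<lambda>w. SUP x\<in>\<rat>. cos x / sqrt (sqn_proj n (ksec (fst w) j) (restrict (rotv x (snd w) (fst w j)) {..<n}) + \<epsilon>\<^sup>2)) \<in> borel_measurable P"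
    proof (rule borel_measurable_cSUP[OF countable_rat])
      show "(\<lambda>w. cos x / sqrt (sqn_proj n (ksec (fst w) j) (restrict (rotv x (snd w) (fst w j)) {..<n}) + \<epsilon>\<^sup>2)) \<in> borel_measurable P" for x
        using m[of x] by measurable
    next
      show "bdd_above ((\<lambda>x. cos x / sqrt (sqn_proj n (ksec (fst w) j) (restrict (rotv x (snd w) (fst w j)) {..<n}) + \<epsilon>\<^sup>2)) ` \<rat>)" for w
        by (rule closed_convex_cone.bdd_above_ratio_Rats[OF ksec_ccc that])
    qed
    then show ?thesis by (simp add: closed_convex_cone.reg_eq_SUP_Rats[OF ksec_ccc that])
  qed
  have "(\<lambda>w. sqn_proj n (ksec (fst w) (Suc j)) (snd w)) \<in> borel_measurable P"
  proof (rule borel_measurable_LIMSEQ_metric)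
    show "(\<lambda>w. closed_convex_cone.reg n (ksec (fst w) j) (inverse (real (Suc k))) (snd w) (fst w j)) \<in> borel_measurable P" for k
      by (rule mreg) simp
    show "(\<lambda>k. closed_convex_cone.reg n (ksec (fst w) j) (inverse (real (Suc k))) (snd w) (fst w j))
        \<longlonglongrightarrow> sqn_proj n (ksec (fst w) (Suc j)) (snd w)" for w
      unfolding kcone_Suc by (rule closed_convex_cone.reg_tendsto_slice[OF ksec_ccc])
  qed
  then show ?case by (simp add: split_def P_def)
qed

definition sdelta :: "nat \<Rightarrow> (nat \<Rightarrow> vec) \<Rightarrow> real"
  where "sdelta j G = (\<integral>h. sqn_proj n (ksec G j) h \<partial>std_gaussian n)"

definition sdelta2 :: "nat \<Rightarrow> (nat \<Rightarrow> vec) \<Rightarrow> real"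
  where "sdelta2 j G = (\<integral>h. (sqn_proj n (ksec G j) h)\<^sup>2 \<partial>std_gaussian n)"

lemma sdelta_eq: "sdelta j G = closed_convex_cone.delta n (ksec G j)"
  "sdelta2 j G = closed_convex_cone.delta2 n (ksec G j)"
  by (simp_all add: sdelta_def sdelta2_def closed_convex_cone.delta_def[OF ksec_ccc]
      closed_convex_cone.delta2_def[OF ksec_ccc])

lemma sdelta_cong: "(\<And>i. i < j \<Longrightarrow> G i = G' i) \<Longrightarrow> sdelta j G = sdelta j G'"
  by (simp add: sdelta_def kcone_cong[of j G G'])

lemma sdelta_measurable:
  assumes "j \<le> m"
  shows "sdelta j \<in> borel_measurable (gauss_rows n m)" "sdelta2 j \<in> borel_measurable (gauss_rows n m)"
proof -
  interpret G: prob_space "std_gaussian n" by (rule prob_space_std_gaussian)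
  note [measurable] = ksec_sqn_measurable[OF assms]
  show "sdelta j \<in> borel_measurable (gauss_rows n m)" "sdelta2 j \<in> borel_measurable (gauss_rows n m)"
    unfolding sdelta_def sdelta2_def by measurable
qed

lemma sdelta_bounds:
  "0 \<le> sdelta j G" "sdelta j G \<le> (\<integral>h. (1 + ip n h h)\<^sup>2 \<partial>std_gaussian n)"
  "0 \<le> sdelta2 j G" "sdelta2 j G \<le> (\<integral>h. (1 + ip n h h)\<^sup>2 \<partial>std_gaussian n)"
proof -
  interpret S: closed_convex_cone n "ksec G j" by (rule ksec_ccc)
  have i: "integrable (std_gaussian n) (\<lambda>h. (1 + ip n h h)\<^sup>2)"
    by (rule integrable_std_gaussianI) auto
  show "0 \<le> sdelta j G" unfolding sdelta_eq by (rule S.delta_nonneg)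
  show "0 \<le> sdelta2 j G" unfolding sdelta2_def by (rule integral_nonneg_AE) simp
  show "sdelta j G \<le> (\<integral>h. (1 + ip n h h)\<^sup>2 \<partial>std_gaussian n)" unfolding sdelta_def
  proof (rule integral_mono[OF S.integrable_sqn(1) i])
    fix h show "S.sqn h \<le> (1 + ip n h h)\<^sup>2"
      using S.sqn_le[of h] one_le_square[of n h] by linarith
  qed
  show "sdelta2 j G \<le> (\<integral>h. (1 + ip n h h)\<^sup>2 \<partial>std_gaussian n)" unfolding sdelta2_def
  proof (rule integral_mono[OF S.integrable_sqn(2) i])
    fix h show "(S.sqn h)\<^sup>2 \<le> (1 + ip n h h)\<^sup>2"
      using S.sqn_le[of h] by (intro power_mono) auto
  qed
qed

lemma sdelta_integrable:
  assumes "j \<le> m"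
  shows "integrable (gauss_rows n m) (sdelta j)" "integrable (gauss_rows n m) (sdelta2 j)"
proof -
  interpret R: prob_space "gauss_rows n m" by (rule prob_space_rows)
  show "integrable (gauss_rows n m) (sdelta j)" "integrable (gauss_rows n m) (sdelta2 j)"
    using sdelta_bounds sdelta_measurable[OF assms]
    by (auto intro!: R.integrable_const_bound[where B = "\<integral>h. (1 + ip n h h)\<^sup>2 \<partial>std_gaussian n"] AE_I2)
qed

lemma ksec_step:
  "ksec (G(j := g)) (Suc j) = slice n (ksec G j) g"
  using kcone_cong[of j "G(j := g)" G n C] by (simp add: kcone_Suc)

text \<open>With the first j rows frozen, the section is a deterministic cone and
  \<open>slice_moments\<close> applies to the fresh row g; Fubini exchanges g with the auxiliary
  h.\<close>

lemma sdelta_step: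
  "(\<integral>g. sdelta (Suc j) (G(j := g)) \<partial>std_gaussian n) \<ge> sdelta j G - 1"
  "(\<integral>g. sdelta2 (Suc j) (G(j := g)) \<partial>std_gaussian n) \<le> sdelta2 j G - 2 * sdelta j G"
proof -
  interpret S: closed_convex_cone n "ksec G j" by (rule ksec_ccc)
  interpret G: prob_space "std_gaussian n" by (rule prob_space_std_gaussian)
  interpret GG: pair_prob_space "std_gaussian n" "std_gaussian n" ..
  have "(\<integral>g. sdelta (Suc j) (G(j := g)) \<partial>std_gaussian n)
      = (\<integral>w. sqn_proj n (slice n (ksec G j) (snd w)) (fst w) \<partial>std2 n)"
    unfolding sdelta_def ksec_step
    using GG.integral_snd[of "\<lambda>h g. sqn_proj n (slice n (ksec G j) g) h"] S.slice_moments(1)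
    by (simp add: split_def)
  then show "(\<integral>g. sdelta (Suc j) (G(j := g)) \<partial>std_gaussian n) \<ge> sdelta j G - 1"
    using S.slice_moments(3) by (simp add: sdelta_eq)
  have "(\<integral>g. sdelta2 (Suc j) (G(j := g)) \<partial>std_gaussian n)
      = (\<integral>w. (sqn_proj n (slice n (ksec G j) (snd w)) (fst w))\<^sup>2 \<partial>std2 n)"
    unfolding sdelta2_def ksec_step
    using GG.integral_snd[of "\<lambda>h g. (sqn_proj n (slice n (ksec G j) g) h)\<^sup>2"] S.slice_moments(2)
    by (simp add: split_def)
  then show "(\<integral>g. sdelta2 (Suc j) (G(j := g)) \<partial>std_gaussian n) \<le> sdelta2 j G - 2 * sdelta j G"
    using S.slice_moments(4) by (simp add: sdelta_eq)
qed

lemma mean_sdelta_Suc: "(\<integral>G. sdelta j G \<partial>gauss_rows n j) - 1 \<le> (\<integral>G. sdelta (Suc j) G \<partial>gauss_rows n (Suc j))"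
proof -
  interpret R: prob_space "gauss_rows n j" by (rule prob_space_rows)
  have "(\<integral>G. sdelta j G \<partial>gauss_rows n j) - 1 = (\<integral>G. sdelta j G - 1 \<partial>gauss_rows n j)"
    using sdelta_integrable(1)[of j j] by (simp add: R.prob_space)
  also have "\<dots> \<le> (\<integral>G. \<integral>g. sdelta (Suc j) (G(j := g)) \<partial>std_gaussian n \<partial>gauss_rows n j)"
    using sdelta_integrable(1)[of j j] sdelta_step(1) sdelta_bounds
    by (intro integral_mono integrable_inner_rows[where b = "\<integral>h. (1 + ip n h h)\<^sup>2 \<partial>std_gaussian n"] sdelta_measurable) auto
  also have "\<dots> = (\<integral>G. sdelta (Suc j) G \<partial>gauss_rows n (Suc j))"
    using sdelta_integrable(1)[of "Suc j" "Suc j"] by (simp add: integral_rows_Suc)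
  finally show ?thesis .
qed

lemma mean_sdelta2_Suc:
  "(\<integral>G. sdelta2 (Suc j) G \<partial>gauss_rows n (Suc j)) \<le> (\<integral>G. sdelta2 j G \<partial>gauss_rows n j) - 2 * (\<integral>G. sdelta j G \<partial>gauss_rows n j)"
proof -
  have "(\<integral>G. sdelta2 (Suc j) G \<partial>gauss_rows n (Suc j)) = (\<integral>G. \<integral>g. sdelta2 (Suc j) (G(j := g)) \<partial>std_gaussian n \<partial>gauss_rows n j)"
    using sdelta_integrable(2)[of "Suc j" "Suc j"] by (simp add: integral_rows_Suc)
  also have "\<dots> \<le> (\<integral>G. sdelta2 j G - 2 * sdelta j G \<partial>gauss_rows n j)"
    using sdelta_integrable[of j j] sdelta_step(2) sdelta_bounds
    by (intro integral_mono integrable_inner_rows[where b = "\<integral>h. (1 + ip n h h)\<^sup>2 \<partial>std_gaussian n"] sdelta_measurable) auto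
  also have "\<dots> = (\<integral>G. sdelta2 j G \<partial>gauss_rows n j) - 2 * (\<integral>G. sdelta j G \<partial>gauss_rows n j)"
    using sdelta_integrable[of j j] by simp
  finally show ?thesis .
qed

lemma mean_sdelta_ge: "delta - real j \<le> (\<integral>G. sdelta j G \<partial>gauss_rows n j)"
proof (induction j)
  case 0
  interpret R: prob_space "gauss_rows n 0" by (rule prob_space_rows)
  have "sdelta 0 G = delta" for G by (simp add: sdelta_eq)
  then show ?case using R.prob_space by simp
next
  case (Suc j)
  then show ?case using mean_sdelta_Suc[of j] by simp
qed

text \<open>Row i lowers the second moment by at least 2 (delta - i). The sum over i < j gives j (j
  - 1), which is rounded up to j^2 so that the bound equals delta2 - delta^2 + (delta -
  j)^2.\<close>

lemma mean_sdelta2_le: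
  "(\<integral>G. sdelta2 j G \<partial>gauss_rows n j) \<le> delta2 - 2 * real j * delta + (real j)\<^sup>2"
proof (induction j)
  case 0
  interpret R: prob_space "gauss_rows n 0" by (rule prob_space_rows)
  have "sdelta2 0 G = delta2" for G by (simp add: sdelta_eq)
  then show ?case using R.prob_space by simp
next
  case (Suc j)
  have "(\<integral>G. sdelta2 (Suc j) G \<partial>gauss_rows n (Suc j)) \<le> delta2 - 2 * real j * delta + (real j)\<^sup>2 - 2 * (delta - real j)"
  proof -
    have "x \<le> b - 2 * c" if "x \<le> y - 2 * z" "y \<le> b" "c \<le> z" for x y z b c :: real
      using that by linarith
    from this[OF mean_sdelta2_Suc Suc mean_sdelta_ge] show ?thesis .
  qed
  also have "\<dots> \<le> delta2 - 2 * real (Suc j) * delta + (real (Suc j))\<^sup>2"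
    by (simp add: power2_eq_square algebra_simps)
  finally show ?case .
qed

text \<open>Chebyshev around a = delta - m, over rows and auxiliary vector jointly. The first moment
  is at least a, and the second at most the original variance plus a^2, so the mean square deviation
  from a is at most the original variance.\<close>

lemma prob_sdelta_zero:
  assumes "real m < delta"
  shows "measure (gauss_rows n m) {G \<in> space (gauss_rows n m). sdelta m G = 0} \<le> 8 * pi\<^sup>2 * delta / (delta - real m)\<^sup>2"
proof -
  interpret R: prob_space "gauss_rows n m" by (rule prob_space_rows)
  interpret G: prob_space "std_gaussian n" by (rule prob_space_std_gaussian)
  define a where "a = delta - real m"
  define B where "B = {G \<in> space (gauss_rows n m). sdelta m G = 0}"
  have a: "0 < a" using assms by (simp add: a_def)
  have [measurable]: "B \<in> sets (gauss_rows n m)"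
    unfolding B_def using sdelta_measurable(1)[of m m] by measurable
  \<comment> \<open>On B the first moment is 0 and the right side is at least a^2; elsewhere it is
    the mean of (sqn - a)^2 over h, hence nonnegative.\<close>
  have le: "a\<^sup>2 * indicator B G \<le> sdelta2 m G - 2 * a * sdelta m G + a\<^sup>2" for G
  proof -
    interpret S: closed_convex_cone n "ksec G m" by (rule ksec_ccc)
    show ?thesis
    proof (cases "G \<in> B")
      case True
      then show ?thesis using sdelta_bounds(3)[of m G] by (simp add: B_def)
    next
      case False
      have "0 \<le> (\<integral>h. (S.sqn h - a)\<^sup>2 \<partial>std_gaussian n)" by (rule integral_nonneg_AE) simp
      also have "\<dots> = (\<integral>h. (S.sqn h)\<^sup>2 - 2 * a * S.sqn h + a\<^sup>2 \<partial>std_gaussian n)"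
        by (simp add: power2_diff algebra_simps)
      also have "\<dots> = sdelta2 m G - 2 * a * sdelta m G + a\<^sup>2"
        using S.integrable_sqn by (simp add: sdelta_def sdelta2_def G.prob_space)
      finally show ?thesis using False by simp
    qed
  qed
  have "a\<^sup>2 * measure (gauss_rows n m) B = (\<integral>G. a\<^sup>2 * indicator B G \<partial>gauss_rows n m)" by simp
  also have "\<dots> \<le> (\<integral>G. sdelta2 m G - 2 * a * sdelta m G + a\<^sup>2 \<partial>gauss_rows n m)"
    using sdelta_integrable[of m m] le by (intro integral_mono) (auto simp: R.emeasure_eq_measure)
  also have "\<dots> = (\<integral>G. sdelta2 m G \<partial>gauss_rows n m) - 2 * a * (\<integral>G. sdelta m G \<partial>gauss_rows n m) + a\<^sup>2"
    using sdelta_integrable[of m m] by (simp add: R.prob_space)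
  also have "\<dots> \<le> (delta2 - 2 * real m * delta + (real m)\<^sup>2) - 2 * a * a + a\<^sup>2"
  proof -
    have "2 * a * a \<le> 2 * a * (\<integral>G. sdelta m G \<partial>gauss_rows n m)"
      using mean_sdelta_ge[of m] a by (intro mult_left_mono) (auto simp: a_def)
    moreover have "x - z + t \<le> b - c + t" if "c \<le> z" "x \<le> b" for x z t b c :: real
      using that by linarith
    ultimately show ?thesis using mean_sdelta2_le[of m] by blast
  qed
  also have "\<dots> = delta2 - delta\<^sup>2" by (simp add: a_def power2_eq_square algebra_simps)
  also have "\<dots> \<le> 8 * pi\<^sup>2 * delta" using second_moment_le by simp
  finally show ?thesis using a unfolding B_def a_def by (simp add: field_simps)
qed

lemma AE_ksec_sign:
  assumes \<sigma>: "\<sigma> = 1 \<or> \<sigma> = - 1" and j: "j < m"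
  shows "AE G in gauss_rows n m. 0 < sdelta (Suc j) G \<longrightarrow> 0 < sqn_proj n (ksec G j) (\<sigma> *\<^sub>R G j)"
proof -
  interpret R: product_prob_space "\<lambda>_::nat. std_gaussian n" "{..<m}" by (rule product_prob_space_std_gaussian)
  interpret G: prob_space "std_gaussian n" by (rule prob_space_std_gaussian)
  interpret GG: pair_prob_space "std_gaussian n" "std_gaussian n" ..
  define Q where "Q G \<longleftrightarrow> 0 < sdelta (Suc j) G \<longrightarrow> 0 < sqn_proj n (ksec G j) (\<sigma> *\<^sub>R G j)" for G
  have ms: "(\<lambda>G. sqn_proj n (ksec G j) (\<sigma> *\<^sub>R G j)) \<in> borel_measurable (gauss_rows n (Suc j))"
  proof -
    have "(\<lambda>G. \<lambda>i\<in>{..<n}. \<sigma> * G j i) \<in> gauss_rows n (Suc j) \<rightarrow>\<^sub>M std_gaussian n"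
      unfolding std_gaussian_def
    proof (rule measurable_restrict)
      fix i assume "i \<in> {..<n}"
      then show "(\<lambda>G. \<sigma> * G j i) \<in> PiM {..<Suc j} (\<lambda>_. gaussn {..<n}) \<rightarrow>\<^sub>M gauss"
        using rows_entry_measurable[of j "Suc j" i n] unfolding std_gaussian_def by simp
    qed
    then have "(\<lambda>G. restrict (\<sigma> *\<^sub>R G j) {..<n}) \<in> gauss_rows n (Suc j) \<rightarrow>\<^sub>M std_gaussian n"
      by (simp add: scaleR_fun_def)
    then have "(\<lambda>G. (G, restrict (\<sigma> *\<^sub>R G j) {..<n})) \<in> gauss_rows n (Suc j) \<rightarrow>\<^sub>M gauss_rows n (Suc j) \<Otimes>\<^sub>M std_gaussian n"
      by measurable
    from measurable_compose[OF this ksec_sqn_measurable[of j "Suc j"]]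
    have "(\<lambda>G. sqn_proj n (ksec G j) (restrict (\<sigma> *\<^sub>R G j) {..<n})) \<in> borel_measurable (gauss_rows n (Suc j))" by simp
    then show ?thesis by (simp add: closed_convex_cone.sqn_restrict[OF ksec_ccc])
  qed
  define B where "B = {G \<in> space (gauss_rows n (Suc j)). \<not> Q G}"
  have B[measurable]: "B \<in> sets (gauss_rows n (Suc j))"
    unfolding B_def Q_def using ms sdelta_measurable(1)[of "Suc j" "Suc j"] by measurable
  have inner: "AE g in std_gaussian n. Q (G(j := g))" for G
  proof -
    interpret S: closed_convex_cone n "ksec G j" by (rule ksec_ccc)
    \<comment> \<open>The two Gaussian factors are swapped, so that splitting the almost sure
      statement puts the row g outside and h inside.\<close>
    have "AE w in std2 n. 0 < sqn_proj n (slice n (ksec G j) (fst w)) (snd w) \<longrightarrow> 0 < S.sqn (\<sigma> *\<^sub>R fst w)"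
    proof -
      have "AE w in distr (std2 n) (std2 n) (\<lambda>(x, y). (y, x)). 0 < sqn_proj n (slice n (ksec G j) (snd w)) (fst w) \<longrightarrow> 0 < S.sqn (\<sigma> *\<^sub>R snd w)"
        using S.touching_null[OF \<sigma>] by (simp only: GG.distr_pair_swap[symmetric])
      then show ?thesis by (auto dest!: AE_distrD[rotated] simp: split_def)
    qed
    from GG.AE_pair[OF this] have "AE g in std_gaussian n. AE h in std_gaussian n.
        0 < sqn_proj n (slice n (ksec G j) g) h \<longrightarrow> 0 < S.sqn (\<sigma> *\<^sub>R g)" by simp
    then show ?thesis
    proof (rule AE_mp, intro AE_I2 impI)
      fix g assume ae: "AE h in std_gaussian n. 0 < sqn_proj n (slice n (ksec G j) g) h \<longrightarrow> 0 < S.sqn (\<sigma> *\<^sub>R g)"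
      show "Q (G(j := g))"
      proof (rule ccontr)
        assume nQ: "\<not> Q (G(j := g))"
        have sec: "ksec (G(j := g)) j = ksec G j" by (rule kcone_cong) simp
        have "\<not> 0 < S.sqn (\<sigma> *\<^sub>R g)" using nQ by (simp add: Q_def sec)
        \<comment> \<open>The failed conclusion does not mention h, so the premise must fail for
          almost every h, which makes the mean vanish.\<close>
        then have "AE h in std_gaussian n. sqn_proj n (slice n (ksec G j) g) h = 0"
          using ae by (auto simp: sqn_proj_def less_le)
        then have "sdelta (Suc j) (G(j := g)) = 0"
          unfolding sdelta_def ksec_step by (simp add: integral_eq_zero_AE)
        then show False using nQ by (simp add: Q_def)
      qed
    qed
  qed
  have "emeasure (gauss_rows n (Suc j)) B = (\<integral>\<^sup>+G. indicator B G \<partial>PiM (insert j {..<j}) (\<lambda>_. std_gaussian n))"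
    using B by (simp add: lessThan_Suc[symmetric])
  also have "\<dots> = (\<integral>\<^sup>+G. \<integral>\<^sup>+g. indicator B (G(j := g)) \<partial>std_gaussian n \<partial>gauss_rows n j)"
    using B by (intro R.product_nn_integral_insert) (auto simp: lessThan_Suc[symmetric])
  also have "\<dots> = (\<integral>\<^sup>+G. \<integral>\<^sup>+g. 0 \<partial>std_gaussian n \<partial>gauss_rows n j)"
  proof (rule nn_integral_cong, rule nn_integral_cong_AE)
    fix G :: "nat \<Rightarrow> vec"
    show "AE g in std_gaussian n. indicator B (G(j := g)) = (0::ennreal)"
      using inner[of G] by (rule AE_mp) (auto simp: B_def intro!: AE_I2)
  qed
  finally have "emeasure (gauss_rows n (Suc j)) B = 0" by simp
  then have "AE G in gauss_rows n (Suc j). G \<notin> B"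
    using B by (intro AE_not_in) (simp add: null_sets_def)
  then have "AE G in gauss_rows n (Suc j). Q G" by (rule AE_mp) (auto simp: B_def intro!: AE_I2)
  \<comment> \<open>Only the first j + 1 rows matter; the statement is pulled back along the
    projection from all m rows.\<close>
  moreover have "distr (gauss_rows n m) (gauss_rows n (Suc j)) (\<lambda>G. restrict G {..<Suc j}) = gauss_rows n (Suc j)"
    using j by (intro R.distr_PiM_restrict_finite) auto
  ultimately have "AE G in distr (gauss_rows n m) (gauss_rows n (Suc j)) (\<lambda>G. restrict G {..<Suc j}). Q G" by metis
  then have "AE G in gauss_rows n m. Q (restrict G {..<Suc j})"
    using j by (intro AE_distrD[of "\<lambda>G. restrict G {..<Suc j}" "gauss_rows n m" "gauss_rows n (Suc j)"] measurable_restrict_subset) auto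
  moreover have "Q (restrict G {..<Suc j}) = Q G" for G
  proof -
    have "ksec (restrict G {..<Suc j}) j = ksec G j" by (rule kcone_cong) simp
    moreover have "sdelta (Suc j) (restrict G {..<Suc j}) = sdelta (Suc j) G" by (rule sdelta_cong) simp
    ultimately show ?thesis by (simp add: Q_def)
  qed
  ultimately show ?thesis by (simp add: Q_def)
qed

lemma sdelta_antimono: "i \<le> j \<Longrightarrow> sdelta j G \<le> sdelta i G"
proof -
  assume "i \<le> j"
  then have sub: "ksec G j \<subseteq> ksec G i" by (auto simp: kcone_def)
  interpret I: closed_convex_cone n "ksec G i" by (rule ksec_ccc)
  interpret J: closed_convex_cone n "ksec G j" by (rule ksec_ccc)
  have "J.sqn h \<le> I.sqn h" for h
    using I.sqn_ge[of "J.proj h" h] J.proj_in[of h] sub J.ip_proj_self[of h] by (auto simp: J.sqn_def)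
  then show "sdelta j G \<le> sdelta i G" unfolding sdelta_def
    by (intro integral_mono J.integrable_sqn I.integrable_sqn)
qed

text \<open>A positive \<open>sdelta m\<close> encodes a nonzero vector of the cone in the kernel of
  all rows; the two signs are the input of \<open>rows_surjective\<close>.\<close>

definition good_rows :: "nat \<Rightarrow> (nat \<Rightarrow> vec) set"
  where "good_rows m = {G \<in> space (gauss_rows n m). 0 < sdelta m G \<and>
    (\<forall>j<m. 0 < sqn_proj n (ksec G j) (1 *\<^sub>R G j) \<and> 0 < sqn_proj n (ksec G j) ((- 1) *\<^sub>R G j))}"

text \<open>Phrased with a measurable subset, the form that an inner probability asks for: remove
  the event of a trivial last section and a null set covering the exceptional signs. Since sections
  shrink, a positive last mean makes all earlier ones positive, which is the premise of the sign
  statements.\<close>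

lemma good_rows_prob:
  assumes "real m < delta"
  shows "\<exists>A\<in>sets (gauss_rows n m). A \<subseteq> good_rows m \<and> 1 - 8 * pi\<^sup>2 * delta / (delta - real m)\<^sup>2 \<le> measure (gauss_rows n m) A"
proof -
  interpret R: prob_space "gauss_rows n m" by (rule prob_space_rows)
  define B where "B = {G \<in> space (gauss_rows n m). sdelta m G = 0}"
  have B[measurable]: "B \<in> sets (gauss_rows n m)"
    unfolding B_def using sdelta_measurable(1)[of m m] by measurable
  have "AE G in gauss_rows n m. 0 < sdelta (Suc j) G \<longrightarrow> 0 < sqn_proj n (ksec G j) (\<sigma> *\<^sub>R G j)"
    if "j < m" "\<sigma> = 1 \<or> \<sigma> = - 1" for j \<sigma>
    using AE_ksec_sign[OF that(2,1)] .
  then have "AE G in gauss_rows n m. \<forall>j\<in>{..<m}. \<forall>\<sigma>\<in>{1, - 1}. 0 < sdelta (Suc j) G \<longrightarrow> 0 < sqn_proj n (ksec G j) (\<sigma> *\<^sub>R G j)"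
    by (intro AE_finite_allI) auto
  then obtain N where N: "N \<in> null_sets (gauss_rows n m)"
    and sub: "{G \<in> space (gauss_rows n m). \<not> (\<forall>j\<in>{..<m}. \<forall>\<sigma>\<in>{1, - 1}. 0 < sdelta (Suc j) G \<longrightarrow> 0 < sqn_proj n (ksec G j) (\<sigma> *\<^sub>R G j))} \<subseteq> N"
    by (auto simp: eventually_ae_filter)
  define A where "A = space (gauss_rows n m) - (B \<union> N)"
  have A: "A \<in> sets (gauss_rows n m)" using N B by (auto simp: A_def)
  have "A \<subseteq> good_rows m"
  proof
    fix G assume G: "G \<in> A"
    then have sp: "G \<in> space (gauss_rows n m)" and pos: "0 < sdelta m G"
      using sdelta_bounds(1)[of m G] by (auto simp: A_def B_def)
    have "0 < sqn_proj n (ksec G j) (\<sigma> *\<^sub>R G j)" if "j < m" "\<sigma> \<in> {1, - 1}" for j \<sigma>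
    proof -
      have "0 < sdelta (Suc j) G" using sdelta_antimono[of "Suc j" m G] that pos by simp
      moreover have "\<forall>j\<in>{..<m}. \<forall>\<sigma>\<in>{1, - 1}. 0 < sdelta (Suc j) G \<longrightarrow> 0 < sqn_proj n (ksec G j) (\<sigma> *\<^sub>R G j)"
        using G sub sp unfolding A_def by blast
      ultimately show ?thesis using that by blast
    qed
    from this[of _ 1] this[of _ "- 1"] show "G \<in> good_rows m" using sp pos by (simp add: good_rows_def)
  qed
  moreover have "measure (gauss_rows n m) A \<ge> 1 - 8 * pi\<^sup>2 * delta / (delta - real m)\<^sup>2"
  proof -
    have "measure (gauss_rows n m) (B \<union> N) = measure (gauss_rows n m) B"
      using B N by (rule measure_Un_null_set)
    then have "measure (gauss_rows n m) A = 1 - measure (gauss_rows n m) B"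
      unfolding A_def using R.prob_compl[of "B \<union> N"] B N by auto
    then show ?thesis using prob_sdelta_zero[OF assms] by (simp add: B_def)
  qed
  ultimately show ?thesis using A by auto
qed

end

subsection \<open>The least squares problem\<close>

lemma gauss_eq_scaled_normal:
  assumes "prob_space M" and X: "distributed M lborel X (normal_density 0 (sqrt (1 / real n)))" and n: "0 < n"
  shows "distr M borel (\<lambda>\<omega>. sqrt (real n) * X \<omega>) = gauss"
proof -
  interpret prob_space M by fact
  have s: "0 < sqrt (1 / real n)" using n by simp
  have "distributed M lborel (\<lambda>\<omega>. (X \<omega> - 0) / sqrt (1 / real n)) std_normal_density"
    using normal_standard_normal_convert[OF s, of X 0] X by simp
  moreover have "(x - 0) / sqrt (1 / real n) = sqrt (real n) * x" for x
    using n by (simp add: real_sqrt_divide)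
  ultimately have "distributed M lborel (\<lambda>\<omega>. sqrt (real n) * X \<omega>) std_normal_density" by simp
  then have "distr M lborel (\<lambda>\<omega>. sqrt (real n) * X \<omega>) = gauss" by (simp add: distributed_def)
  moreover have "distr M borel (\<lambda>\<omega>. sqrt (real n) * X \<omega>) = distr M lborel (\<lambda>\<omega>. sqrt (real n) * X \<omega>)"
    by (rule distr_cong) auto
  ultimately show ?thesis by simp
qed

text \<open>Rescales the entries to variance 1 and cuts to the index ranges, so that the values are
  points of the product space of \<open>gauss_rows\<close>.\<close>

definition row_matrix :: "nat \<Rightarrow> nat \<Rightarrow> (nat \<Rightarrow> vec) \<Rightarrow> nat \<Rightarrow> vec"
  where "row_matrix n m A = (\<lambda>i\<in>{..<m}. \<lambda>j\<in>{..<n}. sqrt (real n) * A i j)"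

text \<open>Independence of all entries is grouped twice: within row i it makes the row law a
  product of Gaussians, and over the disjoint rows it makes the matrix law a product of row
  laws.\<close>

lemma distr_row_matrix:
  fixes X :: "'a \<Rightarrow> nat \<Rightarrow> vec"
  assumes "prob_space M" and n: "0 < n"
    and X: "\<And>i j. i < m \<Longrightarrow> j < n \<Longrightarrow> distributed M lborel (\<lambda>\<omega>. X \<omega> i j) (normal_density 0 (sqrt (1 / real n)))"
    and ind: "prob_space.indep_vars M (\<lambda>_. borel) (\<lambda>(i, j) \<omega>. X \<omega> i j) ({..<m} \<times> {..<n})"
  shows "(\<lambda>\<omega>. row_matrix n m (X \<omega>)) \<in> M \<rightarrow>\<^sub>M gauss_rows n m"
    and "distr M (gauss_rows n m) (\<lambda>\<omega>. row_matrix n m (X \<omega>)) = gauss_rows n m"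
proof -
  interpret prob_space M by fact
  have dist: "distr M borel (\<lambda>\<omega>. sqrt (real n) * X \<omega> i j) = gauss" if "i < m" "j < n" for i j
    by (rule gauss_eq_scaled_normal[OF assms(1) X[OF that] n])
  have rvX: "(\<lambda>\<omega>. X \<omega> i j) \<in> borel_measurable M" if "i < m" "j < n" for i j
    using distributed_measurable[OF X[OF that]] by simp
  have row_rv: "(\<lambda>\<omega>. \<lambda>j\<in>{..<n}. sqrt (real n) * X \<omega> i j) \<in> M \<rightarrow>\<^sub>M std_gaussian n" if "i < m" for i
    unfolding std_gaussian_def using rvX[OF that] by (intro measurable_restrict) simp
  show meas: "(\<lambda>\<omega>. row_matrix n m (X \<omega>)) \<in> M \<rightarrow>\<^sub>M gauss_rows n m"
    unfolding row_matrix_def using row_rv by (intro measurable_restrict) simp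
  have ind2: "indep_vars (\<lambda>_. borel) (\<lambda>p \<omega>. sqrt (real n) * X \<omega> (fst p) (snd p)) ({..<m} \<times> {..<n})"
    using indep_vars_compose2[OF ind, of "\<lambda>_ x. sqrt (real n) * x" "\<lambda>_. borel"] by (simp add: split_def)
  have row_dist: "distr M (std_gaussian n) (\<lambda>\<omega>. \<lambda>j\<in>{..<n}. sqrt (real n) * X \<omega> i j) = std_gaussian n" if i: "i < m" for i
  proof -
    have "indep_vars (\<lambda>_. borel) (\<lambda>j \<omega>. sqrt (real n) * X \<omega> i j) {..<n}"
    proof -
      have "indep_vars (\<lambda>j. PiM {(i, j)} (\<lambda>_. borel))
          (\<lambda>j \<omega>. restrict (\<lambda>p. sqrt (real n) * X \<omega> (fst p) (snd p)) {(i, j)}) {..<n}"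
        using i by (intro indep_vars_restrict[OF ind2]) (auto simp: disjoint_family_on_def)
      from indep_vars_compose2[OF this, of "\<lambda>j x. x (i, j)" "\<lambda>_. borel"] show ?thesis by simp
    qed
    then have "distr M (PiM {..<n} (\<lambda>_. borel)) (\<lambda>\<omega>. \<lambda>j\<in>{..<n}. sqrt (real n) * X \<omega> i j)
        = PiM {..<n} (\<lambda>j. distr M borel (\<lambda>\<omega>. sqrt (real n) * X \<omega> i j))"
      using n rvX[OF i] by (subst indep_vars_iff_distr_eq_PiM'[symmetric]) auto
    also have "\<dots> = std_gaussian n"
      unfolding std_gaussian_def using dist[OF i] by (intro PiM_cong) auto
    finally show ?thesis
      by (subst distr_cong[OF refl sets_std_gaussian refl])
  qed
  show "distr M (gauss_rows n m) (\<lambda>\<omega>. row_matrix n m (X \<omega>)) = gauss_rows n m"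
  \<comment> \<open>The characterization of independence by a product law takes a nonempty index
    set. Without rows the space is a single point, where all probability measures agree.\<close>
  proof (cases "m = 0")
    case True
    interpret R: prob_space "gauss_rows n m" by (rule prob_space_rows)
    show ?thesis
    proof (rule measure_eqI)
      fix A assume "A \<in> sets (distr M (gauss_rows n m) (\<lambda>\<omega>. row_matrix n m (X \<omega>)))"
      interpret D: prob_space "distr M (gauss_rows n m) (\<lambda>\<omega>. row_matrix n m (X \<omega>))"
        using meas by (rule prob_space_distr)
      have "A = {} \<or> A = space (gauss_rows n m)"
        using sets.sets_into_space[of A "gauss_rows n m"] \<open>A \<in> _\<close> True by (auto simp: space_PiM)
      then show "emeasure (distr M (gauss_rows n m) (\<lambda>\<omega>. row_matrix n m (X \<omega>))) A = emeasure (gauss_rows n m) A"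
        using D.emeasure_space_1 R.emeasure_space_1 by auto
    qed simp
  next
    case False
    have disj: "disjoint_family_on (\<lambda>i. {i} \<times> {..<n}) {..<m}" by (auto simp: disjoint_family_on_def)
    have "indep_vars (\<lambda>i. PiM ({i} \<times> {..<n}) (\<lambda>_. borel))
        (\<lambda>i \<omega>. restrict (\<lambda>p. sqrt (real n) * X \<omega> (fst p) (snd p)) ({i} \<times> {..<n})) {..<m}"
      using disj by (intro indep_vars_restrict[OF ind2]) auto
    from indep_vars_compose2[OF this, of "\<lambda>i x. \<lambda>j\<in>{..<n}. x (i, j)" "\<lambda>_. std_gaussian n"]
    have "indep_vars (\<lambda>_. std_gaussian n) (\<lambda>i \<omega>. \<lambda>j\<in>{..<n}. restrict (\<lambda>p. sqrt (real n) * X \<omega> (fst p) (snd p)) ({i} \<times> {..<n}) (i, j)) {..<m}"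
      unfolding std_gaussian_def by (auto intro!: measurable_restrict)
    moreover have "(\<lambda>j\<in>{..<n}. restrict (\<lambda>p. sqrt (real n) * X \<omega> (fst p) (snd p)) ({i} \<times> {..<n}) (i, j))
      = (\<lambda>j\<in>{..<n}. sqrt (real n) * X \<omega> i j)" for i \<omega> by (auto simp: restrict_def fun_eq_iff)
    ultimately have "indep_vars (\<lambda>_. std_gaussian n) (\<lambda>i \<omega>. \<lambda>j\<in>{..<n}. sqrt (real n) * X \<omega> i j) {..<m}" by simp
    then have "distr M (gauss_rows n m) (\<lambda>\<omega>. \<lambda>i\<in>{..<m}. \<lambda>j\<in>{..<n}. sqrt (real n) * X \<omega> i j)
        = PiM {..<m} (\<lambda>i. distr M (std_gaussian n) (\<lambda>\<omega>. \<lambda>j\<in>{..<n}. sqrt (real n) * X \<omega> i j))"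
      using False row_rv by (subst indep_vars_iff_distr_eq_PiM'[symmetric]) auto
    also have "\<dots> = gauss_rows n m" using row_dist by (intro PiM_cong) auto
    finally show ?thesis by (simp add: row_matrix_def)
  qed
qed

lemma stat_dim_eq_delta:
  assumes "closed_convex_cone n C" shows "stat_dim n C = closed_convex_cone.delta n C"
  by (simp add: stat_dim_def sqn_proj_eq closed_convex_cone.delta_def[OF assms])

text \<open>Multiplying rows by the positive number sqrt n changes neither the kernel sections nor
  the signs of the rows on them, so goodness of the normalized matrix passes to A.\<close>

lemma (in closed_convex_cone) good_rows_least_squares:
  assumes n: "0 < n" and G: "row_matrix n m A \<in> good_rows m"
  shows "(SUP \<mu> \<in> least_squares m n A y C. ereal ((L2_set (\<mu> - \<mu>\<^sub>0) {..<n})\<^sup>2 / real n)) = \<infinity>"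
proof -
  define G where "G = row_matrix n m A"
  have s: "0 < sqrt (real n)" using n by simp
  have sec: "ksec G j = ksec A j" if "j \<le> m" for j
  proof -
    have "ksec G j = ksec (\<lambda>i. sqrt (real n) *\<^sub>R A i) j"
      unfolding kcone_def
    proof (rule Collect_cong, rule conj_cong[OF refl], rule all_cong)
      fix x i assume "i < j"
      then have "ip n (G i) x = ip n (sqrt (real n) *\<^sub>R A i) x"
        using that by (intro ip_cong) (auto simp: G_def row_matrix_def scaleR_fun_def)
      then show "(ip n (G i) x = 0) = (ip n (sqrt (real n) *\<^sub>R A i) x = 0)" by simp
    qed
    then show ?thesis using kcone_scaleR[of "sqrt (real n)"] s by simp
  qed
  have pos: "0 < sqn_proj n (ksec A j) (\<sigma> *\<^sub>R A j)"
    if "j < m" "0 < sqn_proj n (ksec G j) (\<sigma> *\<^sub>R G j)" for j \<sigma>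
  proof -
    interpret S: closed_convex_cone n "ksec A j" by (rule ksec_ccc)
    have "0 < S.sqn (\<sigma> *\<^sub>R G j)" using that sec[of j] by simp
    then obtain x where "x \<in> ksec A j" "0 < ip n (\<sigma> *\<^sub>R G j) x" using S.sqn_pos_iff by blast
    moreover have "ip n (\<sigma> *\<^sub>R G j) x = sqrt (real n) * ip n (\<sigma> *\<^sub>R A j) x"
    proof -
      have "ip n (\<sigma> *\<^sub>R G j) x = ip n (sqrt (real n) *\<^sub>R (\<sigma> *\<^sub>R A j)) x"
        using that by (intro ip_cong) (auto simp: G_def row_matrix_def scaleR_fun_def)
      then show ?thesis by (simp add: ip_scaleR_left)
    qed
    ultimately show ?thesis using S.sqn_pos_iff s by (auto simp: zero_less_mult_iff)
  qed
  have "0 < sdelta m G" using G by (simp add: G_def good_rows_def)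
  then obtain h where h: "0 < sqn_proj n (ksec A m) h"
  proof -
    have "\<exists>h. 0 < sqn_proj n (ksec G m) h"
    proof (rule ccontr)
      assume "\<not> ?thesis"
      then have "sqn_proj n (ksec G m) h = 0" for h by (simp add: sqn_proj_def order_antisym not_less)
      then show False using \<open>0 < sdelta m G\<close> by (simp add: sdelta_def)
    qed
    then show thesis using that sec[of m] by auto
  qed
  show ?thesis
  proof (rule least_squares_unbounded[OF _ _ h])
    fix j assume j: "j < m"
    show "0 < sqn_proj n (ksec A j) (A j)" using pos[OF j, of 1] G j by (simp add: G_def good_rows_def)
    show "0 < sqn_proj n (ksec A j) (- A j)" using pos[OF j, of "- 1"] G j by (simp add: G_def good_rows_def)
  qed
qed

lemma inner_prob_ge:
  assumes "prob_space M" "A \<in> sets M" "A \<subseteq> E"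
  shows "measure M A \<le> inner_prob M E" "inner_prob M E \<le> 1"
proof -
  interpret prob_space M by fact
  have bdd: "bdd_above (measure M ` {A \<in> sets M. A \<subseteq> E})" by (rule bdd_aboveI2[of _ _ 1]) simp
  show "measure M A \<le> inner_prob M E"
    unfolding inner_prob_def using assms bdd by (intro cSUP_upper) auto
  show "inner_prob M E \<le> 1"
    unfolding inner_prob_def using assms by (intro cSUP_least) auto
qed

theorem proposition2p6:
  fixes M :: "nat \<Rightarrow> 'a measure"
    and m :: "nat \<Rightarrow> nat"
    and K :: "nat \<Rightarrow> (nat \<Rightarrow> real) set"
    and X :: "nat \<Rightarrow> 'a \<Rightarrow> nat \<Rightarrow> nat \<Rightarrow> real"
    and \<xi> :: "nat \<Rightarrow> 'a \<Rightarrow> nat \<Rightarrow> real"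
    and \<sigma> :: real
  assumes prob: "\<And>n. prob_space (M n)"
    and X_normal: "\<And>n i j. i < m n \<Longrightarrow> j < n \<Longrightarrow>
      distributed (M n) lborel (\<lambda>\<omega>. X n \<omega> i j) (normal_density 0 (sqrt (1 / real n)))"
    and X_indep: "\<And>n. prob_space.indep_vars (M n) (\<lambda>_. borel)
      (\<lambda>(i, j) \<omega>. X n \<omega> i j) ({..<m n} \<times> {..<n})"
    and xi_indep: "\<And>n. prob_space.indep_vars (M n) (\<lambda>_. borel) (\<lambda>i \<omega>. \<xi> n \<omega> i) {..<m n}"
    and xi_ident: "\<And>n i i'. i < m n \<Longrightarrow> i' < m n \<Longrightarrow>
      distr (M n) borel (\<lambda>\<omega>. \<xi> n \<omega> i) = distr (M n) borel (\<lambda>\<omega>. \<xi> n \<omega> i')"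
    and xi_square_integrable: "\<And>n i. i < m n \<Longrightarrow> integrable (M n) (\<lambda>\<omega>. (\<xi> n \<omega> i)\<^sup>2)"
    and xi_mean: "\<And>n i. i < m n \<Longrightarrow> prob_space.expectation (M n) (\<lambda>\<omega>. \<xi> n \<omega> i) = 0"
    and xi_variance: "\<And>n i. i < m n \<Longrightarrow> prob_space.variance (M n) (\<lambda>\<omega>. \<xi> n \<omega> i) = \<sigma>\<^sup>2"
    and X_xi_indep: "\<And>n. prob_space.indep_set (M n)
      (sets (vimage_algebra (space (M n)) (\<lambda>\<omega>. \<lambda>(i, j)\<in>{..<m n} \<times> {..<n}. X n \<omega> i j)
        (\<Pi>\<^sub>M p\<in>{..<m n} \<times> {..<n}. borel)))
      (sets (vimage_algebra (space (M n)) (\<lambda>\<omega>. \<lambda>i\<in>{..<m n}. \<xi> n \<omega> i)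
        (\<Pi>\<^sub>M i\<in>{..<m n}. borel)))"
    and sigma_pos: "0 < \<sigma>"
    and K_nonempty: "\<And>n. K n \<noteq> {}"
    and K_closed: "\<And>n. closedin (Euclidean_space n) (K n)"
    and K_convex: "\<And>n. convex (K n)"
    and K_cone: "\<And>n. cone (K n)"
    and stat_dim_at_top: "filterlim (\<lambda>n. stat_dim n (K n)) at_top sequentially"
    and limsup_less: "limsup (\<lambda>n. ereal (real (m n) / stat_dim n (K n))) < 1"
  shows "(\<lambda>n. inner_prob (M n) {\<omega> \<in> space (M n). \<forall>\<mu>\<^sub>0 \<in> K n.
      (SUP \<mu> \<in> least_squares (m n) n (X n \<omega>) (mat_vec n (X n \<omega>) \<mu>\<^sub>0 + \<xi> n \<omega>) (K n).
        ereal ((L2_set (\<mu> - \<mu>\<^sub>0) {..<n})\<^sup>2 / real n)) = \<infinity>}) \<longlonglongrightarrow> 1"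
proof -
  define E where "E n = {\<omega> \<in> space (M n). \<forall>\<mu>\<^sub>0 \<in> K n.
      (SUP \<mu> \<in> least_squares (m n) n (X n \<omega>) (mat_vec n (X n \<omega>) \<mu>\<^sub>0 + \<xi> n \<omega>) (K n).
        ereal ((L2_set (\<mu> - \<mu>\<^sub>0) {..<n})\<^sup>2 / real n)) = \<infinity>}" for n
  define \<delta> where "\<delta> n = stat_dim n (K n)" for n
  have ccc: "closed_convex_cone n (K n)" for n
    by unfold_locales (rule K_nonempty K_closed K_convex K_cone)+
  \<comment> \<open>The bound at fixed n, before any limit is taken.\<close>
  have lower: "1 - 8 * pi\<^sup>2 * \<delta> n / (\<delta> n - real (m n))\<^sup>2 \<le> inner_prob (M n) (E n)"
    if n: "0 < n" and less: "real (m n) < \<delta> n" for n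
  proof -
    interpret C: closed_convex_cone n "K n" by (rule ccc)
    interpret prob_space "M n" by (rule prob)
    have \<delta>: "\<delta> n = C.delta" unfolding \<delta>_def by (rule stat_dim_eq_delta[OF ccc])
    obtain A where A: "A \<in> sets (gauss_rows n (m n))" "A \<subseteq> C.good_rows (m n)"
      and pA: "1 - 8 * pi\<^sup>2 * \<delta> n / (\<delta> n - real (m n))\<^sup>2 \<le> measure (gauss_rows n (m n)) A"
      using C.good_rows_prob less unfolding \<delta> by blast
    let ?R = "\<lambda>\<omega>. row_matrix n (m n) (X n \<omega>)"
    note R = distr_row_matrix[OF prob n X_normal X_indep]
    have "measure (gauss_rows n (m n)) A = measure (M n) (?R -` A \<inter> space (M n))"
      using measure_distr[OF R(1) A(1)] R(2) by simp
    \<comment> \<open>The event is described by X alone, and on it every right-hand side y has an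
      unbounded set of minimizers; a single measurable event therefore serves all
      \<open>\<mu>\<^sub>0\<close> at once.\<close>
    also have "\<dots> \<le> inner_prob (M n) (E n)"
    proof (rule inner_prob_ge(1)[OF prob])
      show "?R -` A \<inter> space (M n) \<in> sets (M n)" using R(1) A(1) by (rule measurable_sets)
      show "?R -` A \<inter> space (M n) \<subseteq> E n"
        using C.good_rows_least_squares[OF n] A(2) by (auto simp: E_def)
    qed
    finally show ?thesis using pA by linarith
  qed
  obtain c where c: "limsup (\<lambda>n. ereal (real (m n) / \<delta> n)) < ereal c" "c < 1"
    using ereal_dense2[OF limsup_less] by (auto simp: \<delta>_def one_ereal_def)
  have ev_ratio: "\<forall>\<^sub>F n in sequentially. real (m n) / \<delta> n < c"
    using Limsup_lessD[OF c(1)] by simp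
  have \<delta>_top: "filterlim \<delta> at_top sequentially" using stat_dim_at_top by (simp add: \<delta>_def[abs_def])
  \<comment> \<open>Eventually \<open>\<delta> n\<close> is positive, so the ratio is a genuine
    quotient and not the default value of a division by zero.\<close>
  have ev: "\<forall>\<^sub>F n in sequentially. 1 - 8 * pi\<^sup>2 / (1 - c)\<^sup>2 * inverse (\<delta> n) \<le> inner_prob (M n) (E n)"
    using ev_ratio filterlim_at_top_dense[THEN iffD1, OF \<delta>_top, rule_format, of 0] eventually_gt_at_top[of 0]
  proof eventually_elim
    case (elim n)
    then have mc: "real (m n) < c * \<delta> n" by (simp add: pos_divide_less_eq)
    have "c * \<delta> n < 1 * \<delta> n" using c(2) elim by (intro mult_strict_right_mono) auto
    then have less: "real (m n) < \<delta> n" using mc by simp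
    \<comment> \<open>The gap in the denominator is now proportional to \<open>\<delta> n\<close>,
      so the failure probability is of order 1 / \<delta>.\<close>
    have "(1 - c) * \<delta> n \<le> \<delta> n - real (m n)" using mc by (simp add: algebra_simps)
    then have "((1 - c) * \<delta> n)\<^sup>2 \<le> (\<delta> n - real (m n))\<^sup>2" using c(2) elim by (intro power_mono) auto
    then have "8 * pi\<^sup>2 * \<delta> n / (\<delta> n - real (m n))\<^sup>2 \<le> 8 * pi\<^sup>2 * \<delta> n / ((1 - c) * \<delta> n)\<^sup>2"
      using c(2) elim by (intro divide_left_mono mult_pos_pos) auto
    also have "\<dots> = 8 * pi\<^sup>2 / (1 - c)\<^sup>2 * inverse (\<delta> n)"
    proof -
      have "a * y / (d * y)\<^sup>2 = a / d\<^sup>2 * inverse y" if "0 < y" for a d y :: real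
        using that by (simp add: power2_eq_square divide_inverse)
      from this[OF elim(2)] show ?thesis by blast
    qed
    finally show ?case using lower[OF _ less] elim by simp
  qed
  have "(\<lambda>n. inner_prob (M n) (E n)) \<longlonglongrightarrow> 1"
  proof (rule tendsto_sandwich[OF ev])
    show "\<forall>\<^sub>F n in sequentially. inner_prob (M n) (E n) \<le> 1"
      using inner_prob_ge(2)[OF prob, of "{}"] by simp
    have "(\<lambda>n. 1 - 8 * pi\<^sup>2 / (1 - c)\<^sup>2 * inverse (\<delta> n)) \<longlonglongrightarrow> 1 - 8 * pi\<^sup>2 / (1 - c)\<^sup>2 * 0"
      by (intro tendsto_intros tendsto_inverse_0_at_top \<delta>_top)
    then show "(\<lambda>n. 1 - 8 * pi\<^sup>2 / (1 - c)\<^sup>2 * inverse (\<delta> n)) \<longlonglongrightarrow> 1" by simp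
  qed simp
  then show ?thesis by (simp add: E_def)
qed

end
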